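(* Let $(G,C)$ be an ergodic $r$-discrete measured groupoid which has property $T$ and is not proper. Then $(G,C)$ is not treeable. This holds in particular if $(G,C)$ is a properly ergodic $r$-discrete measured groupoid with property $T$.
   Context: Conventions: Borel spaces are standard, Hilbert spaces are separable. For a groupoid $G$: $G^{(0)}$ is the unit space, $r,s:G\to G^{(0)}$ the range and source maps, $G^x=r^{-1}(x)$; for $A\subset G^{(0)}$, $G|_A=\{\gamma: r(\gamma)\in A,\ s(\gamma)\in A\}$, $[A]=s(r^{-1}(A))$, and $A$ is invariant if $[A]=A$. A Borel groupoid is a groupoid with a Borel structure for which all operations are Borel. A measure class $C$ on $G$ is symmetric if each $\nu\in C$ is equivalent to its image under inversion; it is invariant if some probability measure $\nu\in C$ has a disintegration $(\nu^x)$ along $r$ with $\gamma\nu^{s(\gamma)}$ equivalent to $\nu^{r(\gamma)}$ for almost every $\gamma$. A measured groupoid is a pair $(G,C)$ with $G$ a Borel groupoid and $C$ a symmetric invariant measure class; $r(C)$ is the class of $r_*\nu$, $\nu\in C$ a probability measure. "Null, conull" in $G^{(0)}$ refer to $r(C)$. An inessential reduction is $(G|_U,C|_U)$ with $U\subset G^{(0)}$ conull Borel. $(G,C)$ is ergodic if every invariant Borel subset of $G^{(0)}$ is null or conull. It is $r$-discrete if for some inessential reduction all fibres $G^x$ are countable. An ergodic $(G,C)$ is essentially transitive if some equivalence class $[x]=[\{x\}]$ of units is conull, and properly ergodic otherwise. $(G,C)$ is proper if there is a family $(\nu^x)_{x\in G^{(0)}}$ of probability measures $\nu^x$ on $G^x$,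 with $x\mapsto\nu^x(f)$ Borel for each non-negative Borel $f$ on $G$, such that $\gamma\nu^{s(\gamma)}=\nu^{r(\gamma)}$ for $C$-a.e. $\gamma$. An $r$-discrete Borel groupoid $G$ is treeable if the bundle $r:G\to G^{(0)}$ with left translation action of $G$ admits a structure of $G$-bundle of trees, i.e. each fibre $G^x$ is the vertex set of a tree with path metric $d_x$ such that $(\gamma,\gamma')\mapsto d_{r(\gamma)}(\gamma,\gamma')$ is Borel on $\{(\gamma,\gamma'): r(\gamma)=r(\gamma')\}$ and left translation by each $\gamma\in G$ is an isometry from $G^{s(\gamma)}$ onto $G^{r(\gamma)}$. An $r$-discrete measured groupoid is treeable if some inessential reduction is treeable in this sense. A Hilbert bundle is a Borel field of separable (here complex) Hilbert spaces. A representation of $(G,C)$ in a Hilbert bundle $\mathcal{H}$ over $G^{(0)}$ is a Borel map $\gamma\mapsto L(\gamma)$, with $L(\gamma):\mathcal{H}(s(\gamma))\to\mathcal{H}(r(\gamma))$ a Hilbert space isomorphism, multiplicative on composable pairs of some inessential reduction. A unit section is a Borel section $\xi$ with $\|\xi(x)\|=1$ a.e. $L$ almost contains unit invariant sections if there are unit sections $\xi_n$ with $\|\xi_n(r(\gamma))-L(\gamma)\xi_n(s(\gamma))\|\to 0$ for $C$-a.e. $\gamma$; $L$ contains a unit invariant section if some unit section satisfies $\xi(r(\gamma))=L(\gamma)\xi(s(\gamma))$ for $C$-a.e. $\gamma$. $(G,C)$ has property $T$ if every representation that almost contains unit invariant sections contains a unit invariant section.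
   Formalization: Invariance of C is required for every γ in some inessential reduction rather than for almost every γ; with the a.e. version the second sentence fails for a free ergodic pmp F_2-action with C carried by the unit space. *)

theory Defs
  imports "HOL-Probability.Probability" "HOL-Algebra.Module"
begin

section \<open>Borel structures and measures\<close>

definition standard_borel :: "'a measure \<Rightarrow> bool" where
  "standard_borel M \<longleftrightarrow>
     (\<exists>T. completely_metrizable_space T \<and> second_countable T \<and> topspace T = space M \<and>
          sets M = sigma_sets (space M) {U. openin T U})"

definition equiv_measure :: "'a measure \<Rightarrow> 'a measure \<Rightarrow> bool" where
  "equiv_measure M N \<longleftrightarrow>
     sets M = sets N \<and> absolutely_continuous M N \<and> absolutely_continuous N M"

definition measure_class :: "'a measure \<Rightarrow> 'a measure set \<Rightarrow> bool" where
  "measure_class M C \<longleftrightarrow>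
     (\<exists>\<nu>\<^sub>0. sigma_finite_measure \<nu>\<^sub>0 \<and> sets \<nu>\<^sub>0 = sets M \<and>
          C = {\<nu>. sigma_finite_measure \<nu> \<and> equiv_measure \<nu>\<^sub>0 \<nu>})"

definition AE_class :: "'a measure set \<Rightarrow> ('a \<Rightarrow> bool) \<Rightarrow> bool" where
  "AE_class C P \<longleftrightarrow> (\<forall>\<nu>\<in>C. AE x in \<nu>. P x)"


section \<open>Borel groupoids\<close>

text \<open>The Borel structure of a groupoid is recorded as the \<open>space\<close> and \<open>sets\<close> of
  \<open>arrows\<close>; the measure carried by \<open>arrows\<close> is never used. Units are the arrows
  \<open>x\<close> with \<open>r(x) = x\<close>, and products are only meaningful on composable pairs.\<close>

record 'g borel_gpd =
  arrows :: "'g measure"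
  rge :: "'g \<Rightarrow> 'g"
  src :: "'g \<Rightarrow> 'g"
  mul :: "'g \<Rightarrow> 'g \<Rightarrow> 'g"
  ginv :: "'g \<Rightarrow> 'g"

definition unit_space :: "'g borel_gpd \<Rightarrow> 'g measure" where
  "unit_space G = restrict_space (arrows G) {x. rge G x = x}"

definition fibre :: "'g borel_gpd \<Rightarrow> 'g \<Rightarrow> 'g measure" where
  "fibre G x = restrict_space (arrows G) {\<gamma>. rge G \<gamma> = x}"

locale groupoid =
  fixes G :: "'g borel_gpd"
  assumes rge_closed: "\<gamma> \<in> space (arrows G) \<Longrightarrow> rge G \<gamma> \<in> space (arrows G)"
    and src_closed: "\<gamma> \<in> space (arrows G) \<Longrightarrow> src G \<gamma> \<in> space (arrows G)"
    and rge_rge: "\<gamma> \<in> space (arrows G) \<Longrightarrow> rge G (rge G \<gamma>) = rge G \<gamma>"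
    and src_rge: "\<gamma> \<in> space (arrows G) \<Longrightarrow> src G (rge G \<gamma>) = rge G \<gamma>"
    and rge_src: "\<gamma> \<in> space (arrows G) \<Longrightarrow> rge G (src G \<gamma>) = src G \<gamma>"
    and src_src: "\<gamma> \<in> space (arrows G) \<Longrightarrow> src G (src G \<gamma>) = src G \<gamma>"
    and mul_closed: "\<lbrakk>\<gamma> \<in> space (arrows G); \<gamma>' \<in> space (arrows G); src G \<gamma> = rge G \<gamma>'\<rbrakk>
      \<Longrightarrow> mul G \<gamma> \<gamma>' \<in> space (arrows G)"
    and rge_mul: "\<lbrakk>\<gamma> \<in> space (arrows G); \<gamma>' \<in> space (arrows G); src G \<gamma> = rge G \<gamma>'\<rbrakk>
      \<Longrightarrow> rge G (mul G \<gamma> \<gamma>') = rge G \<gamma>"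
    and src_mul: "\<lbrakk>\<gamma> \<in> space (arrows G); \<gamma>' \<in> space (arrows G); src G \<gamma> = rge G \<gamma>'\<rbrakk>
      \<Longrightarrow> src G (mul G \<gamma> \<gamma>') = src G \<gamma>'"
    and mul_assoc: "\<lbrakk>\<gamma> \<in> space (arrows G); \<gamma>' \<in> space (arrows G); \<gamma>'' \<in> space (arrows G);
        src G \<gamma> = rge G \<gamma>'; src G \<gamma>' = rge G \<gamma>''\<rbrakk>
      \<Longrightarrow> mul G (mul G \<gamma> \<gamma>') \<gamma>'' = mul G \<gamma> (mul G \<gamma>' \<gamma>'')"
    and mul_rge: "\<gamma> \<in> space (arrows G) \<Longrightarrow> mul G (rge G \<gamma>) \<gamma> = \<gamma>"
    and mul_src: "\<gamma> \<in> space (arrows G) \<Longrightarrow> mul G \<gamma> (src G \<gamma>) = \<gamma>"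
    and ginv_closed: "\<gamma> \<in> space (arrows G) \<Longrightarrow> ginv G \<gamma> \<in> space (arrows G)"
    and rge_ginv: "\<gamma> \<in> space (arrows G) \<Longrightarrow> rge G (ginv G \<gamma>) = src G \<gamma>"
    and src_ginv: "\<gamma> \<in> space (arrows G) \<Longrightarrow> src G (ginv G \<gamma>) = rge G \<gamma>"
    and mul_ginv: "\<gamma> \<in> space (arrows G) \<Longrightarrow> mul G \<gamma> (ginv G \<gamma>) = rge G \<gamma>"
    and ginv_mul: "\<gamma> \<in> space (arrows G) \<Longrightarrow> mul G (ginv G \<gamma>) \<gamma> = src G \<gamma>"

locale borel_groupoid = groupoid +
  assumes standard: "standard_borel (arrows G)"
    and rge_borel: "rge G \<in> arrows G \<rightarrow>\<^sub>M unit_space G"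
    and src_borel: "src G \<in> arrows G \<rightarrow>\<^sub>M unit_space G"
    and mul_borel: "(\<lambda>(\<gamma>, \<gamma>'). mul G \<gamma> \<gamma>') \<in>
      restrict_space (arrows G \<Otimes>\<^sub>M arrows G) {(\<gamma>, \<gamma>'). src G \<gamma> = rge G \<gamma>'} \<rightarrow>\<^sub>M arrows G"
    and ginv_borel: "ginv G \<in> arrows G \<rightarrow>\<^sub>M arrows G"

definition reduction :: "'g borel_gpd \<Rightarrow> 'g set \<Rightarrow> 'g borel_gpd" where
  "reduction G U =
     G\<lparr>arrows := restrict_space (arrows G) {\<gamma>. rge G \<gamma> \<in> U \<and> src G \<gamma> \<in> U}\<rparr>"

definition saturation :: "'g borel_gpd \<Rightarrow> 'g set \<Rightarrow> 'g set" where
  "saturation G A = src G ` {\<gamma> \<in> space (arrows G). rge G \<gamma> \<in> A}"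


section \<open>Measured groupoids\<close>

definition unit_class :: "'g borel_gpd \<Rightarrow> 'g measure set \<Rightarrow> 'g measure set" where
  "unit_class G C =
     {\<mu>. sigma_finite_measure \<mu> \<and>
         (\<exists>\<nu>\<in>C. prob_space \<nu> \<and> equiv_measure (distr \<nu> (unit_space G) (rge G)) \<mu>)}"

definition null_units :: "'g borel_gpd \<Rightarrow> 'g measure set \<Rightarrow> 'g set \<Rightarrow> bool" where
  "null_units G C A \<longleftrightarrow> AE_class (unit_class G C) (\<lambda>x. x \<notin> A)"

definition conull_units :: "'g borel_gpd \<Rightarrow> 'g measure set \<Rightarrow> 'g set \<Rightarrow> bool" where
  "conull_units G C A \<longleftrightarrow> AE_class (unit_class G C) (\<lambda>x. x \<in> A)"

definition inessential :: "'g borel_gpd \<Rightarrow> 'g measure set \<Rightarrow> 'g set \<Rightarrow> bool" where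
  "inessential G C U \<longleftrightarrow> U \<in> sets (unit_space G) \<and> conull_units G C U"

definition fibre_probs :: "'g borel_gpd \<Rightarrow> ('g \<Rightarrow> 'g measure) \<Rightarrow> bool" where
  "fibre_probs G \<kappa> \<longleftrightarrow>
     (\<forall>x \<in> space (unit_space G). sets (\<kappa> x) = sets (fibre G x) \<and> prob_space (\<kappa> x)) \<and>
     (\<forall>f :: 'g \<Rightarrow> ennreal. f \<in> borel_measurable (arrows G) \<longrightarrow>
        (\<lambda>x. \<integral>\<^sup>+ \<gamma>. f \<gamma> \<partial>\<kappa> x) \<in> borel_measurable (unit_space G))"

definition disintegration :: "'g borel_gpd \<Rightarrow> 'g measure \<Rightarrow> ('g \<Rightarrow> 'g measure) \<Rightarrow> bool" where
  "disintegration G \<nu> \<kappa> \<longleftrightarrow>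
     fibre_probs G \<kappa> \<and>
     (\<forall>f :: 'g \<Rightarrow> ennreal. f \<in> borel_measurable (arrows G) \<longrightarrow>
        (\<integral>\<^sup>+ \<gamma>. f \<gamma> \<partial>\<nu>) = (\<integral>\<^sup>+ x. (\<integral>\<^sup>+ \<gamma>. f \<gamma> \<partial>\<kappa> x) \<partial>distr \<nu> (unit_space G) (rge G)))"

text \<open>The measure \<open>\<gamma>\<nu>\<^bsup>s(\<gamma>)\<^esup>\<close>.\<close>

definition translate :: "'g borel_gpd \<Rightarrow> ('g \<Rightarrow> 'g measure) \<Rightarrow> 'g \<Rightarrow> 'g measure" where
  "translate G \<kappa> \<gamma> = distr (\<kappa> (src G \<gamma>)) (fibre G (rge G \<gamma>)) (mul G \<gamma>)"

text \<open>In the invariance axiom, ``almost every \<open>\<gamma>\<close>'' is read as: every \<open>\<gamma>\<close> in some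
  inessential reduction. Read as \<open>\<nu>\<close>-almost every, it would be satisfied by every measure
  class carried by the unit space (take \<open>\<nu>\<^sup>x\<close> to be the point mass at \<open>x\<close>), whatever the
  groupoid. On such a class every representation is trivial almost everywhere, so property T
  holds vacuously, even for the (treeable) groupoid of an essentially free ergodic action of
  a free group.\<close>

locale measured_groupoid = borel_groupoid G for G :: "'g borel_gpd" +
  fixes C :: "'g measure set"
  assumes measure_class: "measure_class (arrows G) C"
    and symmetric: "\<nu> \<in> C \<Longrightarrow> equiv_measure \<nu> (distr \<nu> (arrows G) (ginv G))"
    and invariant: "\<exists>\<nu>\<in>C. prob_space \<nu> \<and>
      (\<exists>\<kappa> U. disintegration G \<nu> \<kappa> \<and> inessential G C U \<and>
         (\<forall>\<gamma> \<in> space (arrows (reduction G U)).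
            equiv_measure (translate G \<kappa> \<gamma>) (\<kappa> (rge G \<gamma>))))"

definition ergodic :: "'g borel_gpd \<Rightarrow> 'g measure set \<Rightarrow> bool" where
  "ergodic G C \<longleftrightarrow>
     (\<forall>A \<in> sets (unit_space G). saturation G A = A \<longrightarrow> null_units G C A \<or> conull_units G C A)"

definition essentially_transitive :: "'g borel_gpd \<Rightarrow> 'g measure set \<Rightarrow> bool" where
  "essentially_transitive G C \<longleftrightarrow>
     ergodic G C \<and> (\<exists>x \<in> space (unit_space G). conull_units G C (saturation G {x}))"

definition properly_ergodic :: "'g borel_gpd \<Rightarrow> 'g measure set \<Rightarrow> bool" where
  "properly_ergodic G C \<longleftrightarrow> ergodic G C \<and> \<not> essentially_transitive G C"

definition r_discrete_borel :: "'g borel_gpd \<Rightarrow> bool" where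
  "r_discrete_borel G \<longleftrightarrow>
     borel_groupoid G \<and> (\<forall>x \<in> space (unit_space G). countable (space (fibre G x)))"

definition r_discrete :: "'g borel_gpd \<Rightarrow> 'g measure set \<Rightarrow> bool" where
  "r_discrete G C \<longleftrightarrow> (\<exists>U. inessential G C U \<and> r_discrete_borel (reduction G U))"

definition proper :: "'g borel_gpd \<Rightarrow> 'g measure set \<Rightarrow> bool" where
  "proper G C \<longleftrightarrow>
     (\<exists>\<kappa>. fibre_probs G \<kappa> \<and> AE_class C (\<lambda>\<gamma>. translate G \<kappa> \<gamma> = \<kappa> (rge G \<gamma>)))"


section \<open>Treeability\<close>

text \<open>A graph is given by its vertex set and its (symmetric, irreflexive) set of ordered
  adjacent pairs; a circuit is listed by its at least three distinct vertices.\<close>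

definition tree_on :: "'a set \<Rightarrow> 'a rel \<Rightarrow> bool" where
  "tree_on V E \<longleftrightarrow>
     V \<noteq> {} \<and> E \<subseteq> V \<times> V \<and> sym E \<and> irrefl E \<and> (\<forall>u\<in>V. \<forall>v\<in>V. (u, v) \<in> E\<^sup>*) \<and>
     \<not> (\<exists>c. 3 \<le> length c \<and> distinct c \<and> successively (\<lambda>u v. (u, v) \<in> E) c \<and>
            (last c, hd c) \<in> E)"

definition path_dist :: "'a rel \<Rightarrow> 'a \<Rightarrow> 'a \<Rightarrow> nat" where
  "path_dist E u v = (LEAST n. (u, v) \<in> E ^^ n)"

definition tree_bundle :: "'g borel_gpd \<Rightarrow> ('g \<Rightarrow> 'g rel) \<Rightarrow> bool" where
  "tree_bundle G E \<longleftrightarrow>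
     (\<forall>x \<in> space (unit_space G). tree_on (space (fibre G x)) (E x)) \<and>
     (\<lambda>(\<gamma>, \<gamma>'). path_dist (E (rge G \<gamma>)) \<gamma> \<gamma>') \<in>
       restrict_space (arrows G \<Otimes>\<^sub>M arrows G) {(\<gamma>, \<gamma>'). rge G \<gamma> = rge G \<gamma>'}
         \<rightarrow>\<^sub>M count_space UNIV \<and>
     (\<forall>\<gamma> \<in> space (arrows G).
        \<forall>\<gamma>\<^sub>1 \<in> space (fibre G (src G \<gamma>)). \<forall>\<gamma>\<^sub>2 \<in> space (fibre G (src G \<gamma>)).
          path_dist (E (rge G \<gamma>)) (mul G \<gamma> \<gamma>\<^sub>1) (mul G \<gamma> \<gamma>\<^sub>2) = path_dist (E (src G \<gamma>)) \<gamma>\<^sub>1 \<gamma>\<^sub>2)"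

definition treeable_borel :: "'g borel_gpd \<Rightarrow> bool" where
  "treeable_borel G \<longleftrightarrow> r_discrete_borel G \<and> (\<exists>E. tree_bundle G E)"

definition treeable :: "'g borel_gpd \<Rightarrow> 'g measure set \<Rightarrow> bool" where
  "treeable G C \<longleftrightarrow> (\<exists>U. inessential G C U \<and> treeable_borel (reduction G U))"


section \<open>Hilbert bundles\<close>

text \<open>Complex Hilbert spaces on an explicit carrier, the inner product being linear in its
  first argument. The multiplicative fields which the record inherits from \<open>ring\<close> play no
  role.\<close>

definition complex_ring :: "complex ring" where
  "complex_ring = \<lparr>carrier = UNIV, monoid.mult = (*), one = 1, zero = 0, add = (+)\<rparr>"

record 'h ip_space = "(complex, 'h) module" +
  ip :: "'h \<Rightarrow> 'h \<Rightarrow> complex"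

definition hnorm :: "'h ip_space \<Rightarrow> 'h \<Rightarrow> real" where
  "hnorm H v = sqrt (Re (ip H v v))"

text \<open>The value outside the carrier is what makes this an instance of \<open>Metric_space\<close>.\<close>

definition hdist :: "'h ip_space \<Rightarrow> 'h \<Rightarrow> 'h \<Rightarrow> real" where
  "hdist H u v = (if u \<in> carrier H \<and> v \<in> carrier H then hnorm H (u \<ominus>\<^bsub>H\<^esub> v) else 0)"

definition hilbert_space :: "'h ip_space \<Rightarrow> bool" where
  "hilbert_space H \<longleftrightarrow>
     Module.module complex_ring H \<and>
     (\<forall>u\<in>carrier H. \<forall>v\<in>carrier H. \<forall>w\<in>carrier H. ip H (u \<oplus>\<^bsub>H\<^esub> v) w = ip H u w + ip H v w) \<and>
     (\<forall>a. \<forall>u\<in>carrier H. \<forall>v\<in>carrier H. ip H (a \<odot>\<^bsub>H\<^esub> u) v = a * ip H u v) \<and>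
     (\<forall>u\<in>carrier H. \<forall>v\<in>carrier H. ip H v u = cnj (ip H u v)) \<and>
     (\<forall>u\<in>carrier H. 0 \<le> Re (ip H u u) \<and> (ip H u u = 0 \<longrightarrow> u = \<zero>\<^bsub>H\<^esub>)) \<and>
     Metric_space.mcomplete (carrier H) (hdist H)"

definition hilbert_iso :: "'h ip_space \<Rightarrow> 'h ip_space \<Rightarrow> ('h \<Rightarrow> 'h) \<Rightarrow> bool" where
  "hilbert_iso H K T \<longleftrightarrow>
     bij_betw T (carrier H) (carrier K) \<and>
     (\<forall>u\<in>carrier H. \<forall>v\<in>carrier H. T (u \<oplus>\<^bsub>H\<^esub> v) = T u \<oplus>\<^bsub>K\<^esub> T v) \<and>
     (\<forall>a. \<forall>u\<in>carrier H. T (a \<odot>\<^bsub>H\<^esub> u) = a \<odot>\<^bsub>K\<^esub> T u) \<and>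
     (\<forall>u\<in>carrier H. \<forall>v\<in>carrier H. ip K (T u) (T v) = ip H u v)"

definition total_in :: "'h ip_space \<Rightarrow> (nat \<Rightarrow> 'h) \<Rightarrow> bool" where
  "total_in H e \<longleftrightarrow>
     (\<forall>v\<in>carrier H. \<forall>\<epsilon>>0. \<exists>N c. hdist H v (\<Oplus>\<^bsub>H\<^esub>n\<in>{..<N::nat}. c n \<odot>\<^bsub>H\<^esub> e n) < \<epsilon>)"

text \<open>The Borel structure of a Hilbert bundle is given by a fundamental sequence \<open>e\<close>: the
  coefficients \<open>\<langle>e m, e n\<rangle>\<close> are Borel and the \<open>e n x\<close> are total in each fibre (which is
  therefore separable). Borel sections, and Borel fields of operators, are those with Borel
  coefficients against \<open>e\<close>.\<close>

definition hilbert_bundle ::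
    "'x measure \<Rightarrow> ('x \<Rightarrow> 'h ip_space) \<Rightarrow> (nat \<Rightarrow> 'x \<Rightarrow> 'h) \<Rightarrow> bool" where
  "hilbert_bundle X H e \<longleftrightarrow>
     (\<forall>x\<in>space X. hilbert_space (H x) \<and> (\<forall>n. e n x \<in> carrier (H x)) \<and>
        total_in (H x) (\<lambda>n. e n x)) \<and>
     (\<forall>m n. (\<lambda>x. ip (H x) (e m x) (e n x)) \<in> borel_measurable X)"

definition borel_section ::
    "'x measure \<Rightarrow> ('x \<Rightarrow> 'h ip_space) \<Rightarrow> (nat \<Rightarrow> 'x \<Rightarrow> 'h) \<Rightarrow> ('x \<Rightarrow> 'h) \<Rightarrow> bool" where
  "borel_section X H e \<xi> \<longleftrightarrow>
     (\<forall>x\<in>space X. \<xi> x \<in> carrier (H x)) \<and>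
     (\<forall>n. (\<lambda>x. ip (H x) (\<xi> x) (e n x)) \<in> borel_measurable X)"


section \<open>Representations and property T\<close>

definition representation ::
    "'g borel_gpd \<Rightarrow> 'g measure set \<Rightarrow> ('g \<Rightarrow> 'h ip_space) \<Rightarrow> (nat \<Rightarrow> 'g \<Rightarrow> 'h) \<Rightarrow>
      ('g \<Rightarrow> 'h \<Rightarrow> 'h) \<Rightarrow> bool" where
  "representation G C H e L \<longleftrightarrow>
     hilbert_bundle (unit_space G) H e \<and>
     (\<forall>\<gamma> \<in> space (arrows G). hilbert_iso (H (src G \<gamma>)) (H (rge G \<gamma>)) (L \<gamma>)) \<and>
     (\<forall>m n. (\<lambda>\<gamma>. ip (H (rge G \<gamma>)) (L \<gamma> (e m (src G \<gamma>))) (e n (rge G \<gamma>)))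
        \<in> borel_measurable (arrows G)) \<and>
     (\<exists>U. inessential G C U \<and>
        (\<forall>\<gamma> \<in> space (arrows (reduction G U)). \<forall>\<gamma>' \<in> space (arrows (reduction G U)).
           src G \<gamma> = rge G \<gamma>' \<longrightarrow>
             (\<forall>v \<in> carrier (H (src G \<gamma>')). L (mul G \<gamma> \<gamma>') v = L \<gamma> (L \<gamma>' v))))"

definition unit_section ::
    "'g borel_gpd \<Rightarrow> 'g measure set \<Rightarrow> ('g \<Rightarrow> 'h ip_space) \<Rightarrow> (nat \<Rightarrow> 'g \<Rightarrow> 'h) \<Rightarrow>
      ('g \<Rightarrow> 'h) \<Rightarrow> bool" where
  "unit_section G C H e \<xi> \<longleftrightarrow>
     borel_section (unit_space G) H e \<xi> \<and>
     AE_class (unit_class G C) (\<lambda>x. hnorm (H x) (\<xi> x) = 1)"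

definition almost_contains_unit_invariant_sections ::
    "'g borel_gpd \<Rightarrow> 'g measure set \<Rightarrow> ('g \<Rightarrow> 'h ip_space) \<Rightarrow> (nat \<Rightarrow> 'g \<Rightarrow> 'h) \<Rightarrow>
      ('g \<Rightarrow> 'h \<Rightarrow> 'h) \<Rightarrow> bool" where
  "almost_contains_unit_invariant_sections G C H e L \<longleftrightarrow>
     (\<exists>\<xi> :: nat \<Rightarrow> 'g \<Rightarrow> 'h.
        (\<forall>n. unit_section G C H e (\<xi> n)) \<and>
        AE_class C (\<lambda>\<gamma>.
          (\<lambda>n. hnorm (H (rge G \<gamma>))
                 (\<xi> n (rge G \<gamma>) \<ominus>\<^bsub>H (rge G \<gamma>)\<^esub> L \<gamma> (\<xi> n (src G \<gamma>)))) \<longlonglongrightarrow> 0))"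

definition contains_unit_invariant_section ::
    "'g borel_gpd \<Rightarrow> 'g measure set \<Rightarrow> ('g \<Rightarrow> 'h ip_space) \<Rightarrow> (nat \<Rightarrow> 'g \<Rightarrow> 'h) \<Rightarrow>
      ('g \<Rightarrow> 'h \<Rightarrow> 'h) \<Rightarrow> bool" where
  "contains_unit_invariant_section G C H e L \<longleftrightarrow>
     (\<exists>\<xi>. unit_section G C H e \<xi> \<and> AE_class C (\<lambda>\<gamma>. \<xi> (rge G \<gamma>) = L \<gamma> (\<xi> (src G \<gamma>))))"

text \<open>One cannot quantify over types, so the fibres are carried by subsets of
  \<open>nat \<Rightarrow> complex\<close>, with arbitrary operations. Since a separable Hilbert space has at most
  the cardinality of the continuum, every Hilbert bundle is isomorphic to such a bundle.\<close>

definition property_T :: "'g borel_gpd \<Rightarrow> 'g measure set \<Rightarrow> bool" where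
  "property_T G C \<longleftrightarrow>
     (\<forall>(H :: 'g \<Rightarrow> (nat \<Rightarrow> complex) ip_space) e L.
        representation G C H e L \<longrightarrow>
        almost_contains_unit_invariant_sections G C H e L \<longrightarrow>
        contains_unit_invariant_section G C H e L)"

end

(* On a tree with path metric d the kernels lam^d, 0 < lam < 1, are positive definite, and they tend
   to 1 as lam tends to 1. Hence a treeing gives a representation, a countable direct sum of copies
   of l^2 of the fibre trees, which almost contains unit invariant sections. By property T it
   contains an invariant one. Its nonzero component for some lam is an invariant function f on the
   trees such that the sum over c of |f c - lam * f (parent c)|^2 is finite for every root, and such
   an f attains the maximum of |f| on a finite nonempty set of vertices. The sources of these
   vertices form a finite invariant set of units, which by ergodicity is almost everywhere a
   constant set. So some unit has conull orbit and finite isotropy, which makes the groupoid proper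
   and essentially transitive.

   The trees may contain vertices that the fibre measures do not charge, so that these measures do
   not yield a Borel enumeration of them. All sums are therefore taken over the convex hull of the
   root and the atoms, and the parent map is shown to be Borel by Lusin separation of disjoint
   Souslin sets. *)

theory Submission
  imports Defs
begin

text \<open>The space of the kernel does not depend on a root, and arrows act on it by translating
  functions. Only the coordinates depend on a root, and moving the root from \<gamma> to the unit
  r(\<gamma>) is an isometry, one edge at a time. The coefficient of the root vector at \<gamma> is
  a power of lam whose exponent is the distance from s(\<gamma>) to the inverse of \<gamma>. For
  fixed \<gamma> it tends to 1 with lam, but for no single lam is it close to 1 on all arrows; hence
  one representation has to hold a whole sequence of values of lam. An invariant section is
  invariant only almost everywhere, while the argument needs every arrow of some reduction. Almost
  every unit is an atom of its fibre measure; therefore all arrows of a suitable reduction are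
  atoms, and a null set of a fibre measure contains none of them. Ergodicity meets another obstacle.
  A set that is invariant only inside a conull set has to be enlarged to one that is invariant under
  all arrows. Its saturation is a projection and not evidently Borel, so it is enclosed in Borel
  sets by separation.\<close>

subsection \<open>Souslin sets and Lusin separation\<close>

text \<open>A parametrized analytic set. The space carries no topology: continuity of
  \<open>g\<close> is replaced by the demand that members of \<open>\<B>\<close> have relatively
  clopen preimages, so that further Borel sets can later be added to \<open>\<B>\<close>.\<close>

definition souslin :: "'a set set \<Rightarrow> 'a set \<Rightarrow> bool" where
  "souslin \<B> A \<longleftrightarrow>
     (\<exists>(P :: (nat \<Rightarrow> nat) set) g. closed P \<and> g ` P = A \<and>
        (\<forall>S\<in>\<B>. closed {\<alpha>\<in>P. g \<alpha> \<in> S} \<and> closed {\<alpha>\<in>P. g \<alpha> \<notin> S}))"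

definition separates :: "'a set set \<Rightarrow> 'a set \<Rightarrow> bool" where
  "separates \<B> A \<longleftrightarrow> (\<forall>x\<in>A. \<forall>y\<in>A. x \<noteq> y \<longrightarrow> (\<exists>S\<in>\<B>. (x \<in> S) \<noteq> (y \<in> S)))"

lemma souslinE:
  assumes "souslin \<B> A"
  obtains P :: "(nat \<Rightarrow> nat) set" and g where "closed P" "g ` P = A"
    "\<forall>S\<in>\<B>. closed {\<alpha>\<in>P. g \<alpha> \<in> S} \<and> closed {\<alpha>\<in>P. g \<alpha> \<notin> S}"
  using assms unfolding souslin_def by (elim exE conjE) (rule that)

lemma souslinI:
  fixes P :: "(nat \<Rightarrow> nat) set"
  assumes "closed P" "g ` P = A"
    "\<And>S. S \<in> \<B> \<Longrightarrow> closed {\<alpha>\<in>P. g \<alpha> \<in> S} \<and> closed {\<alpha>\<in>P. g \<alpha> \<notin> S}"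
  shows "souslin \<B> A"
  unfolding souslin_def using assms by (intro exI[of _ P] exI[of _ g]) simp

lemma souslin_choice:
  assumes "\<And>n :: nat. souslin (\<B> n) (A n)"
  obtains P :: "nat \<Rightarrow> (nat \<Rightarrow> nat) set" and g where "\<forall>n. closed (P n)" "\<forall>n. g n ` P n = A n"
    "\<forall>n. \<forall>S\<in>\<B> n. closed {\<alpha>\<in>P n. g n \<alpha> \<in> S} \<and> closed {\<alpha>\<in>P n. g n \<alpha> \<notin> S}"
proof -
  define W where "W n Pg \<longleftrightarrow> closed (fst Pg) \<and> snd Pg ` fst Pg = A n \<and>
    (\<forall>S\<in>\<B> n. closed {\<alpha>\<in>fst Pg. snd Pg \<alpha> \<in> S} \<and> closed {\<alpha>\<in>fst Pg. snd Pg \<alpha> \<notin> S})"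
    for n and Pg :: "(nat \<Rightarrow> nat) set \<times> ((nat \<Rightarrow> nat) \<Rightarrow> 'a)"
  have "\<exists>Pg. W n Pg" for n
  proof -
    obtain P :: "(nat \<Rightarrow> nat) set" and g where P: "closed P" "g ` P = A n"
      "\<forall>S\<in>\<B> n. closed {\<alpha>\<in>P. g \<alpha> \<in> S} \<and> closed {\<alpha>\<in>P. g \<alpha> \<notin> S}"
      by (rule souslinE[OF assms])
    then have "W n (P, g)" by (simp add: W_def)
    then show ?thesis ..
  qed
  then have "W n (SOME Pg. W n Pg)" for n by (rule someI_ex)
  note * = this[unfolded W_def]
  show ?thesis
    by (rule that[of "\<lambda>n. fst (SOME Pg. W n Pg)" "\<lambda>n. snd (SOME Pg. W n Pg)"])
      (use * in \<open>simp_all add: W_def\<close>)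
qed

section \<open>Closure of Souslin sets under countable operations\<close>

lemma souslin_empty: "souslin \<B> {}"
  by (rule souslinI[of "{}"]) auto

text \<open>The preimage of \<open>S\<close> is all of \<open>P\<close> or empty, so the same
  parametrization serves. Cutting a set along \<open>S\<close> reduces the general case to this
  one.\<close>

lemma souslin_insert:
  assumes "souslin \<B> A" "A \<subseteq> S \<or> A \<inter> S = {}"
  shows "souslin (insert S \<B>) A"
proof -
  obtain P :: "(nat \<Rightarrow> nat) set" and g where P: "closed P" "g ` P = A"
    "\<forall>S\<in>\<B>. closed {\<alpha>\<in>P. g \<alpha> \<in> S} \<and> closed {\<alpha>\<in>P. g \<alpha> \<notin> S}"
    by (rule souslinE[OF assms(1)])
  have *: "closed {\<alpha>\<in>P. g \<alpha> \<in> S} \<and> closed {\<alpha>\<in>P. g \<alpha> \<notin> S}"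
    using assms(2)
  proof
    assume "A \<subseteq> S"
    then have e: "{\<alpha>\<in>P. g \<alpha> \<in> S} = P" "{\<alpha>\<in>P. g \<alpha> \<notin> S} = {}" using P(2) by blast+
    show ?thesis by (simp only: e P(1) closed_empty simp_thms)
  next
    assume "A \<inter> S = {}"
    then have e: "{\<alpha>\<in>P. g \<alpha> \<in> S} = {}" "{\<alpha>\<in>P. g \<alpha> \<notin> S} = P" using P(2) by blast+
    show ?thesis by (simp only: e P(1) closed_empty simp_thms)
  qed
  show ?thesis
    by (rule souslinI[OF P(1,2)], erule insertE) (simp only: *, use P(3) in blast)
qed

lemma continuous_on_reindex: "continuous_on UNIV (\<lambda>\<alpha> :: nat \<Rightarrow> nat. \<lambda>i. \<alpha> (f i))"
  by (intro continuous_on_coordinatewise_then_product continuous_on_product_coordinates)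

lemma closed_reindex:
  assumes "closed (P :: (nat \<Rightarrow> nat) set)" shows "closed {\<alpha>. (\<lambda>i. \<alpha> (f i :: nat)) \<in> P}"
  using closed_vimage[OF assms continuous_on_reindex[of f]] by (simp add: vimage_def)

lemma closed_coordinate: "closed {\<alpha> :: nat \<Rightarrow> nat. \<alpha> k \<in> S}"
proof -
  have "closed S" unfolding closed_def by (rule Topological_Spaces.open_discrete)
  from closed_vimage[OF this continuous_on_product_coordinates] show ?thesis by (simp add: vimage_def)
qed

text \<open>Coordinates are locally constant on the Baire space; hence a closed condition may depend
  on the value of one of them.\<close>

lemma closed_Union_coordinate:
  assumes "\<And>n. closed (Q n)"
  shows "closed {\<alpha> :: nat \<Rightarrow> nat. \<alpha> \<in> Q (\<alpha> k)}"
proof -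
  have *: "{\<alpha> :: nat \<Rightarrow> nat. \<alpha> \<in> Q (\<alpha> k)} = (\<Inter>n. {\<alpha>. \<alpha> k \<in> - {n}} \<union> Q n)"
    by auto
  show ?thesis unfolding * by (intro closed_INT ballI closed_Un assms closed_coordinate)
qed

lemma souslin_UN:
  assumes "\<And>n :: nat. souslin \<B> (A n)"
  shows "souslin \<B> (\<Union>n. A n)"
proof -
  obtain P :: "nat \<Rightarrow> (nat \<Rightarrow> nat) set" and g where P: "\<forall>n. closed (P n)" "\<forall>n. g n ` P n = A n"
     "\<forall>n. \<forall>S\<in>\<B>. closed {\<alpha>\<in>P n. g n \<alpha> \<in> S} \<and> closed {\<alpha>\<in>P n. g n \<alpha> \<notin> S}"
    by (rule souslin_choice[where A = A and \<B> = "\<lambda>_. \<B>", OF assms])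
  \<comment> \<open>Coordinate 0 names a set of the union, the tail \<open>t \<alpha>\<close> codes
    a point of it.\<close>
  define t where "t \<alpha> = (\<lambda>i. \<alpha> (Suc i))" for \<alpha> :: "nat \<Rightarrow> nat"
  define Q where "Q = {\<alpha>. t \<alpha> \<in> P (\<alpha> 0)}"
  define h where "h \<alpha> = g (\<alpha> 0) (t \<alpha>)" for \<alpha>
  have cl: "closed {\<alpha>. t \<alpha> \<in> R (\<alpha> 0)}" if "\<And>n. closed (R n)" for R
    using closed_Union_coordinate[of "\<lambda>n. {\<alpha>. t \<alpha> \<in> R n}" 0] closed_reindex[OF that, of Suc]
    by (simp add: t_def)
  have eq: "{\<alpha>\<in>Q. h \<alpha> \<in> S} = {\<alpha>. t \<alpha> \<in> {\<alpha>'\<in>P (\<alpha> 0). g (\<alpha> 0) \<alpha>' \<in> S}}"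
    "{\<alpha>\<in>Q. h \<alpha> \<notin> S} = {\<alpha>. t \<alpha> \<in> {\<alpha>'\<in>P (\<alpha> 0). g (\<alpha> 0) \<alpha>' \<notin> S}}" for S
    by (auto simp: Q_def h_def)
  have imQ: "h ` Q = (\<Union>n. A n)"
  proof safe
    fix n x assume "x \<in> A n"
    then obtain \<beta> where "\<beta> \<in> P n" "g n \<beta> = x" using P(2) by (metis imageE)
    then show "x \<in> h ` Q"
      by (intro image_eqI[of _ _ "case_nat n \<beta>"]) (auto simp: h_def Q_def t_def)
  next
    fix \<alpha> assume "\<alpha> \<in> Q"
    then show "h \<alpha> \<in> (\<Union>n. A n)" using P(2) by (auto simp: h_def Q_def)
  qed
  have clQ: "closed Q" unfolding Q_def by (rule cl[OF P(1)[rule_format]])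
  have clS: "closed {\<alpha>\<in>Q. h \<alpha> \<in> S} \<and> closed {\<alpha>\<in>Q. h \<alpha> \<notin> S}" if "S \<in> \<B>" for S
    unfolding eq using cl[of "\<lambda>n. {\<alpha>'\<in>P n. g n \<alpha>' \<in> S}"] cl[of "\<lambda>n. {\<alpha>'\<in>P n. g n \<alpha>' \<notin> S}"] P(3)[rule_format, OF that]
    by auto
  show ?thesis by (rule souslinI[OF clQ imQ clS])
qed

lemma souslin_Un: "souslin \<B> A \<Longrightarrow> souslin \<B> B \<Longrightarrow> souslin \<B> (A \<union> B)"
proof -
  assume *: "souslin \<B> A" "souslin \<B> B"
  have "A \<union> B = (\<Union>n::nat. if n = 0 then A else B)" by (auto split: if_splits)
  then show ?thesis using souslin_UN[of \<B> "\<lambda>n. if n = 0 then A else B"] * by auto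
qed

text \<open>A point of the intersection is coded by one code for each \<open>A n\<close>, all of
  them giving the same point. This agreement is a closed condition because
  \<open>\<B>\<^sub>0\<close> separates points. A set of \<open>\<B> n\<close> is tested on the
  \<open>n\<close>-th code, so the families may vary with \<open>n\<close>.\<close>

lemma souslin_INT:
  assumes A: "\<And>n :: nat. souslin (\<B> n) (A n)"
    and sep: "separates \<B>\<^sub>0 (\<Union>n. A n)" and sub: "\<And>n. \<B>\<^sub>0 \<subseteq> \<B> n"
  shows "souslin (\<Union>n. \<B> n) (\<Inter>n. A n)"
proof -
  obtain P :: "nat \<Rightarrow> (nat \<Rightarrow> nat) set" and g where P: "\<forall>n. closed (P n)" "\<forall>n. g n ` P n = A n"
     "\<forall>n. \<forall>S\<in>\<B> n. closed {\<alpha>\<in>P n. g n \<alpha> \<in> S} \<and> closed {\<alpha>\<in>P n. g n \<alpha> \<notin> S}"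
    by (rule souslin_choice[where A = A and \<B> = \<B>, OF A])
  define c where "c n \<alpha> = (\<lambda>i. \<alpha> (prod_encode (n, i)))" for n and \<alpha> :: "nat \<Rightarrow> nat"
  define Q where "Q = {\<alpha>. \<forall>n. c n \<alpha> \<in> P n \<and> g n (c n \<alpha>) = g 0 (c 0 \<alpha>)}"
  define h where "h \<alpha> = g 0 (c 0 \<alpha>)" for \<alpha>
  have cl: "closed {\<alpha>. c n \<alpha> \<in> R}" if "closed R" for R n
    using closed_reindex[OF that] unfolding c_def .
  have clg: "closed {\<alpha>. c n \<alpha> \<in> P n \<and> g n (c n \<alpha>) \<in> S}" "closed {\<alpha>. c n \<alpha> \<in> P n \<and> g n (c n \<alpha>) \<notin> S}"
    if "S \<in> \<B> n" for n S using cl[of "{\<alpha>\<in>P n. g n \<alpha> \<in> S}" n] cl[of "{\<alpha>\<in>P n. g n \<alpha> \<notin> S}" n] P(3)[rule_format, OF that] by auto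
  have Qeq: "Q = (\<Inter>n. {\<alpha>. c n \<alpha> \<in> P n}) \<inter> (\<Inter>n. \<Inter>S\<in>\<B>\<^sub>0.
      ({\<alpha>. c n \<alpha> \<in> P n \<and> g n (c n \<alpha>) \<in> S} \<inter> {\<alpha>. c 0 \<alpha> \<in> P 0 \<and> g 0 (c 0 \<alpha>) \<in> S}) \<union>
      ({\<alpha>. c n \<alpha> \<in> P n \<and> g n (c n \<alpha>) \<notin> S} \<inter> {\<alpha>. c 0 \<alpha> \<in> P 0 \<and> g 0 (c 0 \<alpha>) \<notin> S}))" (is "_ = ?R")
  proof
    show "Q \<subseteq> ?R"
    proof
      fix \<alpha> assume "\<alpha> \<in> Q"
      then obtain y where "\<And>n. c n \<alpha> \<in> P n" "\<And>n. g n (c n \<alpha>) = y" unfolding Q_def by blast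
      then show "\<alpha> \<in> ?R" by simp
    qed
    show "?R \<subseteq> Q"
    proof
      fix \<alpha> assume \<alpha>: "\<alpha> \<in> ?R"
      have "g n (c n \<alpha>) = g 0 (c 0 \<alpha>)" for n
      proof (rule ccontr)
        assume "g n (c n \<alpha>) \<noteq> g 0 (c 0 \<alpha>)"
        moreover have "g m (c m \<alpha>) \<in> (\<Union>n. A n)" for m using \<alpha> P(2)[rule_format, of m] by blast
        ultimately obtain S where "S \<in> \<B>\<^sub>0" "(g n (c n \<alpha>) \<in> S) \<noteq> (g 0 (c 0 \<alpha>) \<in> S)"
          using sep unfolding separates_def by blast
        then show False using \<alpha> by auto
      qed
      then show "\<alpha> \<in> Q" using \<alpha> by (auto simp: Q_def)
    qed
  qed
  have clQ: "closed Q" unfolding Qeq using sub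
    by (intro closed_Int closed_INT closed_Un ballI clg cl P(1)[rule_format]) blast+
  have QD: "c n \<alpha> \<in> P n" "g n (c n \<alpha>) = h \<alpha>" if "\<alpha> \<in> Q" for n \<alpha>
    using that unfolding Q_def h_def by blast+
  have imQ: "h ` Q = (\<Inter>n. A n)"
  proof safe
    fix \<alpha> n assume "\<alpha> \<in> Q"
    then have "h \<alpha> \<in> g n ` P n" using QD by (metis imageI)
    then show "h \<alpha> \<in> A n" using P(2) by simp
  next
    fix x assume x: "x \<in> (\<Inter>n. A n)"
    have "\<exists>\<beta>. \<beta> \<in> P n \<and> g n \<beta> = x" for n
    proof -
      have "x \<in> g n ` P n" using x P(2) by simp
      then show ?thesis by auto
    qed
    then obtain \<beta> where \<beta>: "\<And>n. \<beta> n \<in> P n" "\<And>n. g n (\<beta> n) = x" by metis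
    define \<gamma> where "\<gamma> = (\<lambda>i. \<beta> (fst (prod_decode i)) (snd (prod_decode i)))"
    have \<gamma>: "c n \<gamma> = \<beta> n" for n by (simp add: c_def \<gamma>_def)
    have "\<gamma> \<in> Q" "h \<gamma> = x" by (simp_all add: Q_def h_def \<gamma> \<beta>)
    then show "x \<in> h ` Q" by blast
  qed
  have clS: "closed {\<alpha>\<in>Q. h \<alpha> \<in> S} \<and> closed {\<alpha>\<in>Q. h \<alpha> \<notin> S}" if S: "S \<in> (\<Union>n. \<B> n)" for S
  proof -
    obtain n where n: "S \<in> \<B> n" using S by auto
    have "{\<alpha>\<in>Q. h \<alpha> \<in> S} = Q \<inter> {\<alpha>. c n \<alpha> \<in> P n \<and> g n (c n \<alpha>) \<in> S}"
      "{\<alpha>\<in>Q. h \<alpha> \<notin> S} = Q \<inter> {\<alpha>. c n \<alpha> \<in> P n \<and> g n (c n \<alpha>) \<notin> S}"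
      using QD[of _ n] by (auto cong: conj_cong)
    then show ?thesis using clQ clg[OF n] by (simp only: closed_Int simp_thms)
  qed
  show ?thesis by (rule souslinI[OF clQ imQ clS])
qed

text \<open>Souslin sets are not closed under complements, so the induction over the sigma algebra
  carries each set together with its complement; the complement of a union is then an intersection
  of Souslin sets.\<close>

lemma souslin_sigma:
  assumes \<Omega>: "souslin \<B> \<Omega>" and sep: "separates \<B> \<Omega>" and sub: "\<B> \<subseteq> Pow \<Omega>"
    and A: "A \<in> sigma_sets \<Omega> \<B>"
  shows "souslin \<B> A \<and> souslin \<B> (\<Omega> - A)"
  using A
proof induction
  case (Basic S)
  obtain P :: "(nat \<Rightarrow> nat) set" and g where P: "closed P" "g ` P = \<Omega>"
    "\<forall>S\<in>\<B>. closed {\<alpha>\<in>P. g \<alpha> \<in> S} \<and> closed {\<alpha>\<in>P. g \<alpha> \<notin> S}"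
    by (rule souslinE[OF \<Omega>])
  have cl: "closed {\<alpha>\<in>P. g \<alpha> \<in> S}" "closed {\<alpha>\<in>P. g \<alpha> \<notin> S}" using P(3) Basic by auto
  have *: "{\<alpha> \<in> {\<alpha>\<in>P. g \<alpha> \<in> S}. g \<alpha> \<in> T} = {\<alpha>\<in>P. g \<alpha> \<in> S} \<inter> {\<alpha>\<in>P. g \<alpha> \<in> T}"
     "{\<alpha> \<in> {\<alpha>\<in>P. g \<alpha> \<in> S}. g \<alpha> \<notin> T} = {\<alpha>\<in>P. g \<alpha> \<in> S} \<inter> {\<alpha>\<in>P. g \<alpha> \<notin> T}"
     "{\<alpha> \<in> {\<alpha>\<in>P. g \<alpha> \<notin> S}. g \<alpha> \<in> T} = {\<alpha>\<in>P. g \<alpha> \<notin> S} \<inter> {\<alpha>\<in>P. g \<alpha> \<in> T}"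
     "{\<alpha> \<in> {\<alpha>\<in>P. g \<alpha> \<notin> S}. g \<alpha> \<notin> T} = {\<alpha>\<in>P. g \<alpha> \<notin> S} \<inter> {\<alpha>\<in>P. g \<alpha> \<notin> T}" for T
    by auto
  have "S \<subseteq> \<Omega>" using sub Basic by auto
  then have im: "g ` {\<alpha>\<in>P. g \<alpha> \<in> S} = S" "g ` {\<alpha>\<in>P. g \<alpha> \<notin> S} = \<Omega> - S"
    unfolding P(2)[symmetric] by auto
  have "souslin \<B> S"
    by (rule souslinI[OF cl(1) im(1)], unfold *) (use cl P(3) in \<open>simp add: closed_Int\<close>)
  moreover have "souslin \<B> (\<Omega> - S)"
    by (rule souslinI[OF cl(2) im(2)], unfold *) (use cl P(3) in \<open>simp add: closed_Int\<close>)
  ultimately show ?case ..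
next
  case Empty
  then show ?case using \<Omega> souslin_empty by auto
next
  case (Compl A)
  moreover have "A \<subseteq> \<Omega>" using sigma_sets_into_sp[OF sub Compl(1)] .
  ultimately show ?case by (simp add: double_diff)
next
  case (Union A)
  have "separates \<B> (\<Union>n. \<Omega> - A n)" using sep unfolding separates_def by blast
  then have "souslin \<B> (\<Inter>n. \<Omega> - A n)"
    using souslin_INT[of "\<lambda>_. \<B>" "\<lambda>n. \<Omega> - A n" \<B>] Union by simp
  then have "souslin \<B> (\<Omega> - (\<Union>n. A n))" by simp
  then show ?case using souslin_UN Union by blast
qed

section \<open>Lusin's separation theorem\<close>

lemma closed_contains_limit:
  fixes P :: "(nat \<Rightarrow> nat) set"
  assumes "closed P" "\<And>k. \<exists>\<beta>\<in>P. \<forall>i<k. \<beta> i = \<alpha> i"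
  shows "\<alpha> \<in> P"
proof (rule ccontr)
  assume "\<alpha> \<notin> P"
  moreover have "openin (product_topology (\<lambda>_. euclidean) UNIV) (- P)"
    using assms(1) by (simp add: closed_def open_fun_def)
  ultimately obtain X where X: "\<alpha> \<in> (\<Pi>\<^sub>E i\<in>UNIV. X i)" "finite {i. X i \<noteq> UNIV}" "(\<Pi>\<^sub>E i\<in>UNIV. X i) \<subseteq> - P"
    using product_topology_open_contains_basis[of "\<lambda>_. euclidean" UNIV "- P" \<alpha>] by auto
  obtain k where k: "\<forall>i\<in>{i. X i \<noteq> UNIV}. i < k" using X(2) finite_nat_set_iff_bounded by blast
  obtain \<beta> where "\<beta> \<in> P" "\<forall>i<k. \<beta> i = \<alpha> i" using assms(2) by blast
  moreover have "\<beta> i \<in> X i" for i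
  proof (cases "i < k")
    case True
    then show ?thesis using calculation X(1) by auto
  next
    case False
    then have "X i = UNIV" using k by blast
    then show ?thesis by simp
  qed
  then have "\<beta> \<in> (\<Pi>\<^sub>E i\<in>UNIV. X i)" by (simp add: PiE_UNIV_domain)
  ultimately show False using X(3) by blast
qed

lemma sequence_of_prefixes:
  assumes "\<And>k. length (f k) = k" "\<And>k. \<exists>n. f (Suc k) = f k @ [n :: nat]"
  obtains \<alpha> where "\<And>k. f k = map \<alpha> [0..<k]"
proof
  fix k show "f k = map (\<lambda>i. f (Suc i) ! i) [0..<k]"
  proof (induction k)
    case 0 then show ?case using assms(1)[of 0] by simp
  next
    case (Suc k)
    obtain n where n: "f (Suc k) = f k @ [n]" using assms(2) by blast
    have "f (Suc k) ! k = n" using n assms(1)[of k] by (metis nth_append_length)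
    then show ?case using Suc n by simp
  qed
qed

text \<open>If no Borel set separates the two images, repeated splitting of cylinders produces
  branches \<alpha> and \<beta> all of whose cylinders have inseparable images. Both branches lie in
  the closed parameter sets and have distinct images. A member of \<open>\<B>\<close> that tells
  these two points apart, or its complement, separates the images of two sufficiently small
  cylinders, since preimages are clopen.\<close>

lemma lusin_separation:
  assumes A: "souslin \<B> A" and C: "souslin \<B> C" and disj: "A \<inter> C = {}"
    and \<B>: "\<B> \<subseteq> sets N" "separates \<B> (space N)" and sub: "A \<subseteq> space N" "C \<subseteq> space N"
  shows "\<exists>D\<in>sets N. A \<subseteq> D \<and> D \<inter> C = {}"
proof (rule ccontr)
  assume nsep: "\<not> ?thesis"
  obtain P :: "(nat \<Rightarrow> nat) set" and g where P: "closed P" "g ` P = A"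
    "\<forall>S\<in>\<B>. closed {\<alpha>\<in>P. g \<alpha> \<in> S} \<and> closed {\<alpha>\<in>P. g \<alpha> \<notin> S}"
    by (rule souslinE[OF A])
  obtain Q :: "(nat \<Rightarrow> nat) set" and h where Q: "closed Q" "h ` Q = C"
    "\<forall>S\<in>\<B>. closed {\<alpha>\<in>Q. h \<alpha> \<in> S} \<and> closed {\<alpha>\<in>Q. h \<alpha> \<notin> S}"
    by (rule souslinE[OF C])
  define cyl where "cyl as = {\<alpha> :: nat \<Rightarrow> nat. map \<alpha> [0..<length as] = as}" for as
  define sep where "sep X Y \<longleftrightarrow> (\<exists>D\<in>sets N. X \<subseteq> D \<and> D \<inter> Y = {})" for X Y
  have cyl_split: "cyl as = (\<Union>n. cyl (as @ [n]))" for as by (auto simp: cyl_def)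
  \<comment> \<open>If every pair of subcylinders were separated by some \<open>D n m\<close>, the
    union over \<open>n\<close> of the intersections over \<open>m\<close> would separate the
    cylinders themselves.\<close>
  have step: "\<exists>n m. \<not> sep (g ` (P \<inter> cyl (as @ [n]))) (h ` (Q \<inter> cyl (bs @ [m])))"
    if "\<not> sep (g ` (P \<inter> cyl as)) (h ` (Q \<inter> cyl bs))" for as bs
  proof (rule ccontr)
    assume "\<not> ?thesis"
    then obtain D where D: "\<And>n m. D n m \<in> sets N" "\<And>n m. g ` (P \<inter> cyl (as @ [n])) \<subseteq> D n m"
      "\<And>n m. D n m \<inter> h ` (Q \<inter> cyl (bs @ [m])) = {}" unfolding sep_def by metis
    have "(\<Union>n. \<Inter>m. D n m) \<in> sets N" using D(1) by auto
    moreover have "g ` (P \<inter> cyl as) \<subseteq> (\<Union>n. \<Inter>m. D n m)" unfolding cyl_split[of as] using D(2) by blast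
    moreover have "(\<Union>n. \<Inter>m. D n m) \<inter> h ` (Q \<inter> cyl bs) = {}" unfolding cyl_split[of bs] using D(3) by blast
    ultimately show False using that unfolding sep_def by blast
  qed
  have "\<exists>f. \<forall>k. (length (fst (f k)) = k \<and> length (snd (f k)) = k \<and>
        \<not> sep (g ` (P \<inter> cyl (fst (f k)))) (h ` (Q \<inter> cyl (snd (f k))))) \<and>
        ((\<exists>n. fst (f (Suc k)) = fst (f k) @ [n]) \<and> (\<exists>m. snd (f (Suc k)) = snd (f k) @ [m]))"
  proof (rule dependent_nat_choice)
    have "cyl [] = UNIV" by (auto simp: cyl_def)
    then show "\<exists>x. length (fst x) = 0 \<and> length (snd x) = 0 \<and>
          \<not> sep (g ` (P \<inter> cyl (fst x))) (h ` (Q \<inter> cyl (snd x)))"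
      using nsep P(2) Q(2) unfolding sep_def by (intro exI[of _ "([], [])"]) auto
  next
    fix x :: "nat list \<times> nat list" and k
    assume x: "length (fst x) = k \<and> length (snd x) = k \<and>
       \<not> sep (g ` (P \<inter> cyl (fst x))) (h ` (Q \<inter> cyl (snd x)))"
    then obtain n m where "\<not> sep (g ` (P \<inter> cyl (fst x @ [n]))) (h ` (Q \<inter> cyl (snd x @ [m])))"
      using step by blast
    then show "\<exists>y. (length (fst y) = Suc k \<and> length (snd y) = Suc k \<and>
        \<not> sep (g ` (P \<inter> cyl (fst y))) (h ` (Q \<inter> cyl (snd y)))) \<and>
        (\<exists>n. fst y = fst x @ [n]) \<and> (\<exists>m. snd y = snd x @ [m])"
      using x by (intro exI[of _ "(fst x @ [n], snd x @ [m])"]) auto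
  qed
  then obtain f where f: "\<And>k. length (fst (f k)) = k" "\<And>k. length (snd (f k)) = k"
    "\<And>k. \<not> sep (g ` (P \<inter> cyl (fst (f k)))) (h ` (Q \<inter> cyl (snd (f k))))"
    "\<And>k. \<exists>n. fst (f (Suc k)) = fst (f k) @ [n]" "\<And>k. \<exists>n. snd (f (Suc k)) = snd (f k) @ [n]" by blast
  obtain \<alpha> where \<alpha>: "\<And>k. fst (f k) = map \<alpha> [0..<k]" using sequence_of_prefixes[OF f(1,4)] by blast
  obtain \<beta> where \<beta>: "\<And>k. snd (f k) = map \<beta> [0..<k]" using sequence_of_prefixes[OF f(2,5)] by blast
  have ns: "\<not> sep (g ` (P \<inter> cyl (map \<alpha> [0..<k]))) (h ` (Q \<inter> cyl (map \<beta> [0..<k])))" for k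
    using f(3) \<alpha> \<beta> by metis
  have cyl_iff: "\<delta> \<in> cyl (map \<gamma> [0..<k]) \<longleftrightarrow> (\<forall>i<k. \<delta> i = \<gamma> i)" for \<delta> \<gamma> k
    by (auto simp: cyl_def)
  have sp: "space N \<in> sets N" "{} \<in> sets N" by auto
  \<comment> \<open>A cylinder that misses \<open>P\<close> has empty image, which the empty set
    separates from anything; so \<alpha> is a limit of points of \<open>P\<close>.\<close>
  have "\<exists>\<delta>\<in>P. \<forall>i<k. \<delta> i = \<alpha> i" for k
  proof (rule ccontr)
    assume "\<not> ?thesis"
    then have "P \<inter> cyl (map \<alpha> [0..<k]) = {}" using cyl_iff by blast
    then show False using ns[of k] sp(2) unfolding sep_def by auto
  qed
  then have \<alpha>P: "\<alpha> \<in> P" by (rule closed_contains_limit[OF P(1)])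
  have "\<exists>\<delta>\<in>Q. \<forall>i<k. \<delta> i = \<beta> i" for k
  proof (rule ccontr)
    assume "\<not> ?thesis"
    then have "Q \<inter> cyl (map \<beta> [0..<k]) = {}" using cyl_iff by blast
    moreover have "g ` (P \<inter> cyl (map \<alpha> [0..<k])) \<subseteq> space N" using P(2) sub by auto
    ultimately show False using ns[of k] sp(1) unfolding sep_def by auto
  qed
  then have \<beta>Q: "\<beta> \<in> Q" by (rule closed_contains_limit[OF Q(1)])
  have in_sp: "g \<alpha> \<in> space N" "h \<beta> \<in> space N" "g \<alpha> \<noteq> h \<beta>"
    using \<alpha>P \<beta>Q P(2) Q(2) sub disj by auto
  then obtain S where S: "S \<in> \<B>" "(g \<alpha> \<in> S) \<noteq> (h \<beta> \<in> S)" using \<B>(2) unfolding separates_def by blast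
  \<comment> \<open>With clopen preimages, membership in \<open>S\<close> is constant on some
    cylinder around a parameter.\<close>
  have loc: "\<exists>k. \<forall>\<delta>\<in>R. (\<forall>i<k. \<delta> i = \<gamma> i) \<longrightarrow> (u \<delta> \<in> S) = (u \<gamma> \<in> S)"
    if "closed {\<delta>\<in>R. u \<delta> \<in> S}" "closed {\<delta>\<in>R. u \<delta> \<notin> S}" "\<gamma> \<in> R" for u :: "(nat \<Rightarrow> nat) \<Rightarrow> 'a" and R \<gamma>
  proof (rule ccontr)
    assume neg: "\<not> ?thesis"
    show False
    proof (cases "u \<gamma> \<in> S")
      case True
      have "\<And>k. \<exists>\<delta>\<in>{\<delta>\<in>R. u \<delta> \<notin> S}. \<forall>i<k. \<delta> i = \<gamma> i" using neg True by blast
      from closed_contains_limit[OF that(2) this] show False using True by simp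
    next
      case False
      have "\<And>k. \<exists>\<delta>\<in>{\<delta>\<in>R. u \<delta> \<in> S}. \<forall>i<k. \<delta> i = \<gamma> i" using neg False by blast
      from closed_contains_limit[OF that(1) this] show False using False by simp
    qed
  qed
  obtain k where k: "\<forall>\<delta>\<in>P. (\<forall>i<k. \<delta> i = \<alpha> i) \<longrightarrow> (g \<delta> \<in> S) = (g \<alpha> \<in> S)"
    using loc[of P g \<alpha>] P(3) S(1) \<alpha>P by blast
  obtain l where l: "\<forall>\<delta>\<in>Q. (\<forall>i<l. \<delta> i = \<beta> i) \<longrightarrow> (h \<delta> \<in> S) = (h \<beta> \<in> S)"
    using loc[of Q h \<beta>] Q(3) S(1) \<beta>Q by blast
  define m where "m = max k l"
  have gm: "\<forall>x\<in>g ` (P \<inter> cyl (map \<alpha> [0..<m])). (x \<in> S) = (g \<alpha> \<in> S)"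
    using k by (auto simp: cyl_iff m_def)
  have hm: "\<forall>x\<in>h ` (Q \<inter> cyl (map \<beta> [0..<m])). (x \<in> S) = (h \<beta> \<in> S)"
    using l by (auto simp: cyl_iff m_def)
  have gsp: "g ` (P \<inter> cyl (map \<alpha> [0..<m])) \<subseteq> space N" using P(2) sub by auto
  have Ss: "S \<in> sets N" using \<B>(1) S(1) by auto
  show False
  proof (cases "g \<alpha> \<in> S")
    case True
    then have "g ` (P \<inter> cyl (map \<alpha> [0..<m])) \<subseteq> S" "S \<inter> h ` (Q \<inter> cyl (map \<beta> [0..<m])) = {}"
      using gm hm S(2) by blast+
    then show False using ns[of m] Ss unfolding sep_def by blast
  next
    case False
    then have "g ` (P \<inter> cyl (map \<alpha> [0..<m])) \<subseteq> space N - S"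
      "(space N - S) \<inter> h ` (Q \<inter> cyl (map \<beta> [0..<m])) = {}"
      using gm hm S(2) gsp by blast+
    then show False using ns[of m] sets.compl_sets[OF Ss] unfolding sep_def by blast
  qed
qed

section \<open>Countable generating families that stand in for a Polish topology\<close>

definition souslin_basis :: "'a measure \<Rightarrow> 'a set set \<Rightarrow> bool" where
  "souslin_basis M \<B> \<longleftrightarrow> countable \<B> \<and> \<B> \<subseteq> sets M \<and> sets M = sigma_sets (space M) \<B> \<and>
     separates \<B> (space M) \<and> souslin \<B> (space M)"

lemma souslin_basisD:
  assumes "souslin_basis M \<B>"
  shows "countable \<B>" "\<B> \<subseteq> sets M" "sets M = sigma_sets (space M) \<B>"
    "separates \<B> (space M)" "souslin \<B> (space M)" "\<B> \<subseteq> Pow (space M)"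
proof -
  show *: "countable \<B>" "\<B> \<subseteq> sets M" "sets M = sigma_sets (space M) \<B>"
    "separates \<B> (space M)" "souslin \<B> (space M)"
    using assms unfolding souslin_basis_def by iprover+
  show "\<B> \<subseteq> Pow (space M)" using *(2) sets.space_closed[of M] by (rule subset_trans)
qed

lemma separates_subset: "separates \<B> A \<Longrightarrow> A' \<subseteq> A \<Longrightarrow> separates \<B> A'"
  unfolding separates_def by (meson subsetD)

lemma separatesE:
  assumes "separates \<B> A" "x \<in> A" "y \<in> A" "x \<noteq> y"
  obtains S where "S \<in> \<B>" "(x \<in> S) \<noteq> (y \<in> S)"
  using assms unfolding separates_def by meson

lemma souslin_basis_sets:
  assumes "souslin_basis M \<B>" "A \<in> sets M"
  shows "souslin \<B> A"
  using souslin_sigma[OF souslin_basisD(5,4,6)[OF assms(1)], of A] souslin_basisD(3)[OF assms(1)] assms(2)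
  by simp

text \<open>Borel sets can be made clopen without changing the sigma algebra. One set
  \<open>S\<close> is added by cutting \<open>X\<close> into \<open>X \<inter> S\<close> and
  \<open>X - S\<close>. Countably many are added at once by applying \<open>souslin_INT\<close> to
  the constant sequence \<open>X\<close>, each copy of which is parametrized for its own
  set.\<close>

lemma souslin_basis_refine:
  assumes \<B>: "souslin_basis M \<B>" and X: "X \<in> sets M" and S: "countable \<S>" "\<S> \<subseteq> sets M"
  shows "souslin (\<B> \<union> \<S>) X"
proof (cases "\<S> = {}")
  case True
  then show ?thesis using souslin_basis_sets[OF \<B> X] by simp
next
  case False
  have *: "souslin (insert S \<B>) X" if "S \<in> \<S>" for S
  proof -
    have S: "S \<in> sets M" using that S by auto
    have "souslin (insert S \<B>) (X \<inter> S)" "souslin (insert S \<B>) (X - S)"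
      by (intro souslin_insert souslin_basis_sets[OF \<B>]; use X S in auto)+
    then have "souslin (insert S \<B>) ((X \<inter> S) \<union> (X - S))" by (rule souslin_Un)
    then show ?thesis by (simp add: Int_Diff_Un)
  qed
  define s where "s = from_nat_into \<S>"
  have s: "range s = \<S>" using False S unfolding s_def by (simp add: range_from_nat_into)
  have "X \<subseteq> space M" using X sets.sets_into_space by auto
  then have "separates \<B> (\<Union>n::nat. X)" 
    using separates_subset[OF souslin_basisD(4)[OF \<B>]] by simp
  then have "souslin (\<Union>n. insert (s n) \<B>) (\<Inter>n::nat. X)"
    by (intro souslin_INT[where \<B>\<^sub>0 = \<B>] *) (use s in auto)
  moreover have "(\<Union>n. insert (s n) \<B>) = \<B> \<union> \<S>" using s by auto
  ultimately show ?thesis by simp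
qed

text \<open>After a refinement the preimages of the members of \<open>\<C>\<close> are clopen, and
  the parametrization composed with \<open>f\<close> works for the image.\<close>

lemma souslin_image:
  assumes \<B>: "souslin_basis M \<B>" and f: "f \<in> M \<rightarrow>\<^sub>M N" and X: "X \<in> sets M"
    and C: "countable \<C>" "\<C> \<subseteq> sets N"
  shows "souslin \<C> (f ` X)"
proof -
  define \<S> where "\<S> = (\<lambda>T. f -` T \<inter> space M) ` \<C>"
  have "countable \<S>" "\<S> \<subseteq> sets M" using C f by (auto simp: \<S>_def intro: measurable_sets)
  from souslin_basis_refine[OF \<B> X this]
  obtain P :: "(nat \<Rightarrow> nat) set" and g where P: "closed P" "g ` P = X"
    "\<forall>S\<in>\<B> \<union> \<S>. closed {\<alpha>\<in>P. g \<alpha> \<in> S} \<and> closed {\<alpha>\<in>P. g \<alpha> \<notin> S}"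
    by (rule souslinE)
  show ?thesis
  proof (rule souslinI[OF P(1), of "f \<circ> g"])
    show "(f \<circ> g) ` P = f ` X" by (simp only: P(2)[symmetric] image_comp)
    fix T assume T: "T \<in> \<C>"
    have "g \<alpha> \<in> space M" if "\<alpha> \<in> P" for \<alpha> using P(2) X sets.sets_into_space that by blast
    then have eq: "{\<alpha>\<in>P. (f \<circ> g) \<alpha> \<in> T} = {\<alpha>\<in>P. g \<alpha> \<in> f -` T \<inter> space M}"
       "{\<alpha>\<in>P. (f \<circ> g) \<alpha> \<notin> T} = {\<alpha>\<in>P. g \<alpha> \<notin> f -` T \<inter> space M}" by auto
    have "f -` T \<inter> space M \<in> \<B> \<union> \<S>" using T by (auto simp: \<S>_def)
    then show "closed {\<alpha>\<in>P. (f \<circ> g) \<alpha> \<in> T} \<and> closed {\<alpha>\<in>P. (f \<circ> g) \<alpha> \<notin> T}"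
      unfolding eq by (rule bspec[OF P(3)])
  qed
qed

lemma souslin_basis_pair:
  assumes \<B>: "souslin_basis M \<B>" and \<C>: "souslin_basis N \<C>"
  shows "souslin_basis (M \<Otimes>\<^sub>M N) ((\<lambda>S. S \<times> space N) ` \<B> \<union> (\<lambda>T. space M \<times> T) ` \<C>)"
    (is "souslin_basis _ ?D")
proof -
  have Bs: "\<B> \<subseteq> sets M" "\<C> \<subseteq> sets N" using souslin_basisD(2) assms by blast+
  have D: "?D \<subseteq> sets (M \<Otimes>\<^sub>M N)" using Bs by auto
  have Dpow: "?D \<subseteq> Pow (space M \<times> space N)"
    using Bs[THEN subsetD, THEN sets.sets_into_space] by auto
  interpret D: sigma_algebra "space M \<times> space N" "sigma_sets (space M \<times> space N) ?D"
    by (rule sigma_algebra_sigma_sets[OF Dpow])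
  have a: "A \<times> space N \<in> sigma_sets (space M \<times> space N) ?D" if "A \<in> sets M" for A
  proof -
    have "A \<in> sigma_sets (space M) \<B>" using that souslin_basisD(3)[OF \<B>] by simp
    then show ?thesis
    proof induction
      case (Compl A)
      have "(space M - A) \<times> space N = space M \<times> space N - A \<times> space N" by auto
      then show ?case using Compl D.compl_sets by simp
    next
      case (Union A)
      have "(\<Union>i. A i) \<times> space N = (\<Union>i. A i \<times> space N)" by auto
      then show ?case using Union by auto
    qed auto
  qed
  have b: "space M \<times> A \<in> sigma_sets (space M \<times> space N) ?D" if "A \<in> sets N" for A
  proof -
    have "A \<in> sigma_sets (space N) \<C>" using that souslin_basisD(3)[OF \<C>] by simp
    then show ?thesis
    proof induction
      case (Compl A)
      have "space M \<times> (space N - A) = space M \<times> space N - space M \<times> A" by auto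
      then show ?case using Compl D.compl_sets by simp
    next
      case (Union A)
      have "space M \<times> (\<Union>i. A i) = (\<Union>i. space M \<times> A i)" by auto
      then show ?case using Union by auto
    qed auto
  qed
  have "sets (M \<Otimes>\<^sub>M N) \<subseteq> sigma_sets (space M \<times> space N) ?D"
    unfolding sets_pair_measure
  proof (rule D.sigma_sets_subset, safe)
    fix A B assume "A \<in> sets M" "B \<in> sets N"
    moreover have "A \<times> B = (A \<times> space N) \<inter> (space M \<times> B)"
      using calculation[THEN sets.sets_into_space] by auto
    ultimately show "A \<times> B \<in> sigma_sets (space M \<times> space N) ?D" using a b D.Int by metis
  qed
  moreover have "sigma_sets (space M \<times> space N) ?D \<subseteq> sets (M \<Otimes>\<^sub>M N)"
    using sets.sigma_sets_subset[OF D] by (simp add: space_pair_measure)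
  moreover have "separates ?D (space M \<times> space N)"
    unfolding separates_def
  proof (intro ballI impI)
    fix p q assume *: "p \<in> space M \<times> space N" "q \<in> space M \<times> space N" "p \<noteq> q"
    show "\<exists>S\<in>?D. (p \<in> S) \<noteq> (q \<in> S)"
    proof (cases "fst p = fst q")
      case True
      then have "snd p \<noteq> snd q" "snd p \<in> space N" "snd q \<in> space N" using * by (auto simp: prod_eq_iff)
      then obtain T where "T \<in> \<C>" "(snd p \<in> T) \<noteq> (snd q \<in> T)"
        using separatesE[OF souslin_basisD(4)[OF \<C>]] by metis
      then show ?thesis using * by (intro bexI[of _ "space M \<times> T"]) (auto simp: mem_Times_iff)
    next
      case False
      then have "fst p \<in> space M" "fst q \<in> space M" using * by auto
      then obtain T where "T \<in> \<B>" "(fst p \<in> T) \<noteq> (fst q \<in> T)"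
        using separatesE[OF souslin_basisD(4)[OF \<B>]] False by metis
      then show ?thesis using * by (intro bexI[of _ "T \<times> space N"]) (auto simp: mem_Times_iff)
    qed
  qed
  moreover have "souslin ?D (space M \<times> space N)"
  proof -
    obtain P :: "(nat \<Rightarrow> nat) set" and g where P: "closed P" "g ` P = space M"
      "\<forall>S\<in>\<B>. closed {\<alpha>\<in>P. g \<alpha> \<in> S} \<and> closed {\<alpha>\<in>P. g \<alpha> \<notin> S}"
      by (rule souslinE[OF souslin_basisD(5)[OF \<B>]])
    obtain Q :: "(nat \<Rightarrow> nat) set" and h where Q: "closed Q" "h ` Q = space N"
      "\<forall>S\<in>\<C>. closed {\<alpha>\<in>Q. h \<alpha> \<in> S} \<and> closed {\<alpha>\<in>Q. h \<alpha> \<notin> S}"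
      by (rule souslinE[OF souslin_basisD(5)[OF \<C>]])
    \<comment> \<open>Even coordinates code the first component, odd ones the second.\<close>
    define a where "a \<alpha> = (\<lambda>i. \<alpha> (2 * i))" for \<alpha> :: "nat \<Rightarrow> nat"
    define b where "b \<alpha> = (\<lambda>i. \<alpha> (Suc (2 * i)))" for \<alpha> :: "nat \<Rightarrow> nat"
    have cla: "closed {\<alpha>. a \<alpha> \<in> R}" "closed {\<alpha>. b \<alpha> \<in> R}" if "closed R" for R
      using closed_reindex[OF that] by (simp_all add: a_def b_def)
    define W where "W = {\<alpha>. a \<alpha> \<in> P} \<inter> {\<alpha>. b \<alpha> \<in> Q}"
    define k where "k \<alpha> = (g (a \<alpha>), h (b \<alpha>))" for \<alpha>
    have W: "g (a \<alpha>) \<in> space M" "h (b \<alpha>) \<in> space N" if "\<alpha> \<in> W" for \<alpha>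
      using that P(2) Q(2) by (auto simp: W_def)
    have clW: "closed W" unfolding W_def by (intro closed_Int cla P(1) Q(1))
    have imW: "k ` W = space M \<times> space N"
    proof safe
      fix x y assume "x \<in> space M" "y \<in> space N"
      then obtain \<alpha> \<beta> where *: "\<alpha> \<in> P" "g \<alpha> = x" "\<beta> \<in> Q" "h \<beta> = y"
        unfolding P(2)[symmetric] Q(2)[symmetric] by auto
      define \<gamma> where "\<gamma> i = (if even i then \<alpha> (i div 2) else \<beta> (i div 2))" for i
      have "a \<gamma> = \<alpha>" "b \<gamma> = \<beta>" by (auto simp: a_def b_def \<gamma>_def fun_eq_iff)
      then have "\<gamma> \<in> W" "k \<gamma> = (x, y)" using * by (auto simp: W_def k_def)
      then show "(x, y) \<in> k ` W" by (metis image_eqI)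
    qed (use W in \<open>auto simp: k_def\<close>)
    show ?thesis
    proof (rule souslinI[OF clW imW])
      fix S assume "S \<in> ?D"
      then consider T where "T \<in> \<B>" "S = T \<times> space N" | T where "T \<in> \<C>" "S = space M \<times> T" by auto
      then show "closed {\<alpha>\<in>W. k \<alpha> \<in> S} \<and> closed {\<alpha>\<in>W. k \<alpha> \<notin> S}"
      proof cases
        case 1
        have "{\<alpha>\<in>W. k \<alpha> \<in> S} = W \<inter> {\<alpha>. a \<alpha> \<in> {\<alpha>\<in>P. g \<alpha> \<in> T}}"
          "{\<alpha>\<in>W. k \<alpha> \<notin> S} = W \<inter> {\<alpha>. a \<alpha> \<in> {\<alpha>\<in>P. g \<alpha> \<notin> T}}"
          using W by (auto simp: 1 k_def W_def)
        moreover have "closed {\<alpha>\<in>P. g \<alpha> \<in> T}" "closed {\<alpha>\<in>P. g \<alpha> \<notin> T}" using P(3) 1 by auto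
        ultimately show ?thesis using cla clW by (simp only: closed_Int simp_thms)
      next
        case 2
        have "{\<alpha>\<in>W. k \<alpha> \<in> S} = W \<inter> {\<alpha>. b \<alpha> \<in> {\<alpha>\<in>Q. h \<alpha> \<in> T}}"
          "{\<alpha>\<in>W. k \<alpha> \<notin> S} = W \<inter> {\<alpha>. b \<alpha> \<in> {\<alpha>\<in>Q. h \<alpha> \<notin> T}}"
          using W by (auto simp: 2 k_def W_def)
        moreover have "closed {\<alpha>\<in>Q. h \<alpha> \<in> T}" "closed {\<alpha>\<in>Q. h \<alpha> \<notin> T}" using Q(3) 2 by auto
        ultimately show ?thesis using cla clW by (simp only: closed_Int simp_thms)
      qed
    qed
  qed
  moreover have "countable ?D" using souslin_basisD(1)[OF \<B>] souslin_basisD(1)[OF \<C>] by simp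
  ultimately show ?thesis using D unfolding souslin_basis_def space_pair_measure
    by (intro conjI equalityI)
qed

text \<open>A point \<open>z\<close> is coded by indices \<open>\<alpha> (2 * i)\<close> of basic neighbourhoods of diameter at most
  \<open>2 / (i + 1)\<close> and, for each basic open set \<open>O j\<close>, by \<open>\<alpha> (2 * j + 1)\<close>, which is \<open>0\<close> if
  \<open>z\<close> is outside \<open>O j\<close> and otherwise the inverse of a radius of a ball around \<open>z\<close> inside \<open>O j\<close>.\<close>

lemma standard_borel_souslin_basis:
  assumes "standard_borel M"
  shows "\<exists>\<B>. souslin_basis M \<B>"
proof -
  obtain T where T: "completely_metrizable_space T" "second_countable T" "topspace T = space M"
      "sets M = sigma_sets (space M) {U. openin T U}"
    using assms unfolding standard_borel_def by blast
  obtain X d where X: "Metric_space X d" "Metric_space.mcomplete X d" "T = Metric_space.mtopology X d"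
    using T(1) unfolding completely_metrizable_space_def by blast
  interpret Metric_space X d by (rule X(1))
  have XM: "X = space M" using T(3) X(3) by simp
  obtain \<B> where B: "countable \<B>" "\<forall>V\<in>\<B>. openin T V"
    "\<forall>U x. openin T U \<and> x \<in> U \<longrightarrow> (\<exists>V\<in>\<B>. x \<in> V \<and> V \<subseteq> U)"
    using T(2) unfolding second_countable_def by (elim exE conjE) (rule that)
  define Ob where "Ob = from_nat_into (insert {} \<B>)"
  have rO: "range Ob = insert {} \<B>" unfolding Ob_def using B(1) by (simp add: range_from_nat_into)
  have Oop: "openin mtopology (Ob j)" for j
  proof -
    have "Ob j \<in> insert {} \<B>" using rO by (metis rangeI)
    then show ?thesis using B(2)[unfolded X(3)] by (cases "Ob j = {}") simp_all
  qed
  have Obase: "\<exists>j. x \<in> Ob j \<and> Ob j \<subseteq> U" if op: "openin mtopology U" "x \<in> U" for U x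
  proof -
    obtain V where V: "V \<in> \<B>" "x \<in> V" "V \<subseteq> U" using B(3)[rule_format, of U x] op X(3) by auto
    have "V \<in> range Ob" unfolding rO using V by simp
    then obtain j where "Ob j = V" by auto
    then show ?thesis using V by auto
  qed
  define small where "small i U \<longleftrightarrow> (\<forall>x\<in>U. \<forall>y\<in>U. d x y < 2 / (real i + 1))" for i and U :: "'a set"
  define code where "code \<alpha> z \<longleftrightarrow> z \<in> X \<and> (\<forall>i. z \<in> Ob (\<alpha> (2*i)) \<and> small i (Ob (\<alpha> (2*i)))) \<and>
     (\<forall>j. if \<alpha> (2*j+1) = 0 then z \<notin> Ob j else mball z (1 / real (\<alpha> (2*j+1))) \<subseteq> Ob j)"
    for \<alpha> :: "nat \<Rightarrow> nat" and z
  define P where "P = {\<alpha>. \<exists>z. code \<alpha> z}"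
  define g where "g \<alpha> = (SOME z. code \<alpha> z)" for \<alpha>
  have g: "code \<alpha> (g \<alpha>)" if "\<alpha> \<in> P" for \<alpha> using that unfolding P_def g_def by (auto intro: someI_ex)
  have code_unique: "z = z'" if c: "code \<alpha> z" "code \<alpha> z'" for \<alpha> z z'
  proof (rule ccontr)
    assume "z \<noteq> z'"
    then have "d z z' > 0" using c by (simp add: code_def)
    then obtain i :: nat where i: "2 / (real i + 1) < d z z'"
      using reals_Archimedean[of "d z z' / 2"] by (auto simp: field_simps)
    have "d z z' < 2 / (real i + 1)" using c unfolding code_def small_def by blast
    then show False using i by simp
  qed
  have ex_code: "\<exists>\<alpha>. code \<alpha> z" if z: "z \<in> X" for z
  proof -
    have "\<exists>j. z \<in> Ob j \<and> small i (Ob j)" for i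
    proof -
      obtain j where j: "z \<in> Ob j" "Ob j \<subseteq> mball z (1 / (real i + 1))"
        using Obase[of "mball z (1 / (real i + 1))" z] z by auto
      have "d x y < 2 / (real i + 1)" if "x \<in> Ob j" "y \<in> Ob j" for x y
      proof -
        have "x \<in> X" "y \<in> X" "d z x < 1 / (real i + 1)" "d z y < 1 / (real i + 1)" using j that by auto
        then show ?thesis using triangle[of x z y] z commute[of x z] by simp
      qed
      then show ?thesis using j unfolding small_def by blast
    qed
    then obtain a where a: "\<And>i. z \<in> Ob (a i) \<and> small i (Ob (a i))" by metis
    have "\<exists>k. if k = 0 then z \<notin> Ob j else mball z (1 / real k) \<subseteq> Ob j" for j
    proof (cases "z \<in> Ob j")
      case True
      then obtain r where r: "r > 0" "mball z r \<subseteq> Ob j" using Oop[of j] unfolding openin_mtopology by blast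
      obtain n where n: "inverse (real (Suc n)) < r" using reals_Archimedean[OF r(1)] by blast
      have "mball z (1 / real (Suc n)) \<subseteq> mball z r" using n by (intro mball_subset_concentric) (simp add: inverse_eq_divide)
      then show ?thesis using r(2) by (intro exI[of _ "Suc n"]) auto
    next
      case False
      then show ?thesis by (intro exI[of _ 0]) simp
    qed
    then obtain w where w: "\<And>j. if w j = 0 then z \<notin> Ob j else mball z (1 / real (w j)) \<subseteq> Ob j" by metis
    define \<alpha> where "\<alpha> i = (if even i then a (i div 2 :: nat) else w (i div 2))" for i
    have "\<alpha> (2*i) = a i" "\<alpha> (2*i+1) = w i" for i by (auto simp: \<alpha>_def)
    then have "code \<alpha> z" using z a w by (simp add: code_def)
    then show ?thesis by blast
  qed
  have imP: "g ` P = space M"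
  proof safe
    fix \<alpha> assume "\<alpha> \<in> P"
    then show "g \<alpha> \<in> space M" using g XM by (auto simp: code_def)
  next
    fix z assume "z \<in> space M"
    then obtain \<alpha> where \<alpha>: "code \<alpha> z" using ex_code XM by blast
    then have "\<alpha> \<in> P" by (auto simp: P_def)
    moreover have "g \<alpha> = z" using code_unique[OF g[OF calculation] \<alpha>] .
    ultimately show "z \<in> g ` P" by blast
  qed
  have mem: "g \<alpha> \<in> Ob j \<longleftrightarrow> \<alpha> (2*j+1) \<noteq> 0" if "\<alpha> \<in> P" for \<alpha> j
  proof -
    have c: "g \<alpha> \<in> X" "if \<alpha> (2*j+1) = 0 then g \<alpha> \<notin> Ob j else mball (g \<alpha>) (1 / real (\<alpha> (2*j+1))) \<subseteq> Ob j"
      using g[OF that] unfolding code_def by blast+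
    have "g \<alpha> \<in> mball (g \<alpha>) (1 / real (\<alpha> (2*j+1)))" if "\<alpha> (2*j+1) \<noteq> 0"
      using c(1) that by simp
    then show ?thesis using c(2) by (auto split: if_splits)
  qed
  \<comment> \<open>For convergent codes the even coordinates make the coded points a Cauchy
    sequence, which has a limit \<open>y\<close> by completeness. The odd coordinates ensure that
    \<open>y\<close> in turn has the code \<alpha>: an eventually constant radius keeps a ball
    around \<open>y\<close> inside the open set, and an eventual value 0 keeps \<open>y\<close>
    outside of it.\<close>
  have clP: "closed P"
    unfolding closed_sequential_limits
  proof (intro allI impI, elim conjE)
    fix \<beta> :: "nat \<Rightarrow> nat \<Rightarrow> nat" and \<alpha> assume b: "\<forall>n. \<beta> n \<in> P" and lim: "\<beta> \<longlonglongrightarrow> \<alpha>"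
    have ev: "\<forall>\<^sub>F n in sequentially. \<beta> n k = \<alpha> k" for k
    proof -
      have "(\<lambda>n. \<beta> n k) \<longlonglongrightarrow> \<alpha> k"
        using lim continuous_on_tendsto_compose[OF continuous_on_product_coordinates[of k] lim] by simp
      then show ?thesis by (simp add: tendsto_discrete)
    qed
    define z where "z n = g (\<beta> n)" for n
    have zc: "code (\<beta> n) (z n)" for n using g b by (simp add: z_def)
    have zX: "z n \<in> X" for n using zc by (simp add: code_def)
    have "MCauchy z"
      unfolding MCauchy_def
    proof (intro conjI allI impI)
      show "range z \<subseteq> X" using zX by auto
      fix e :: real assume e: "e > 0"
      then obtain i :: nat where i: "2 / (real i + 1) < e"
        using reals_Archimedean[of "e / 2"] by (auto simp: field_simps)
      obtain N where N: "\<And>n. n \<ge> N \<Longrightarrow> \<beta> n (2*i) = \<alpha> (2*i)" using ev[of "2*i"] unfolding eventually_sequentially by blast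
      have "d (z n) (z m) < e" if "n \<ge> N" "m \<ge> N" for n m
      proof -
        have "z n \<in> Ob (\<alpha> (2*i))" "z m \<in> Ob (\<alpha> (2*i))" "small i (Ob (\<alpha> (2*i)))"
          using zc[of n] zc[of m] N[OF that(1)] N[OF that(2)] unfolding code_def by metis+
        then have "d (z n) (z m) < 2 / (real i + 1)" unfolding small_def by blast
        then show ?thesis using i by simp
      qed
      then show "\<exists>N. \<forall>n n'. N \<le> n \<longrightarrow> N \<le> n' \<longrightarrow> d (z n) (z n') < e" by blast
    qed
    then obtain y where y: "limitin mtopology z y sequentially" using X(2) unfolding mcomplete_def by blast
    have yX: "y \<in> X" using y by (simp add: limitin_metric)
    have near: "\<forall>\<^sub>F n in sequentially. d (z n) y < r" if "r > 0" for r
      using y that unfolding limitin_metric by (auto elim: eventually_mono)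
    have A: "if \<alpha> (2*j+1) = 0 then y \<notin> Ob j else mball y (1 / real (\<alpha> (2*j+1))) \<subseteq> Ob j" for j
    proof (cases "\<alpha> (2*j+1) = 0")
      case True
      have "y \<notin> Ob j"
      proof
        assume "y \<in> Ob j"
        then obtain r where r: "r > 0" "mball y r \<subseteq> Ob j" using Oop[of j] unfolding openin_mtopology by blast
        have "\<forall>\<^sub>F n in sequentially. False"
          using near[OF r(1)] ev[of "2*j+1"]
        proof eventually_elim
          case (elim n)
          then have "z n \<in> Ob j" using r(2) yX zX commute by auto
          moreover have "\<beta> n (2*j+1) = 0" using elim True by simp
          ultimately show ?case using mem[of "\<beta> n" j] b by (simp add: z_def)
        qed
        then show False by simp
      qed
      then show ?thesis using True by simp
    next
      case False
      have "mball y (1 / real (\<alpha> (2*j+1))) \<subseteq> Ob j"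
      proof
        fix u assume u: "u \<in> mball y (1 / real (\<alpha> (2*j+1)))"
        define r where "r = 1 / real (\<alpha> (2*j+1)) - d y u"
        have "r > 0" using u by (simp add: r_def)
        from near[OF this] ev[of "2*j+1"] have "\<forall>\<^sub>F n in sequentially. u \<in> Ob j"
        proof eventually_elim
          case (elim n)
          have "d (z n) u \<le> d (z n) y + d y u" using triangle zX yX u by auto
          then have "d (z n) u < 1 / real (\<alpha> (2*j+1))" using elim(1) by (simp add: r_def)
          then have "u \<in> mball (z n) (1 / real (\<beta> n (2*j+1)))" using zX u elim(2) by simp
          moreover have "mball (z n) (1 / real (\<beta> n (2*j+1))) \<subseteq> Ob j"
            using zc[of n] False elim(2) unfolding code_def by (metis (full_types))
          ultimately show ?case by blast
        qed
        then show "u \<in> Ob j" by simp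
      qed
      then show ?thesis using False by simp
    qed
    \<comment> \<open>A limit of points of an open set may leave it. That \<open>y\<close> lies in
      \<open>Ob ?j\<close> follows from the odd coordinate \<open>2*?j+1\<close>, which is nonzero
      because the \<open>z n\<close> lie there, and which by \<open>A\<close> gives a ball around
      \<open>y\<close> inside the set.\<close>
    have Bb: "y \<in> Ob (\<alpha> (2*i)) \<and> small i (Ob (\<alpha> (2*i)))" for i
    proof -
      let ?j = "\<alpha> (2*i)"
      have "\<forall>\<^sub>F n in sequentially. \<alpha> (2*?j+1) \<noteq> 0 \<and> small i (Ob ?j)"
        using ev[of "2*i"] ev[of "2*?j+1"]
      proof eventually_elim
        case (elim n)
        have "z n \<in> Ob (\<beta> n (2*i)) \<and> small i (Ob (\<beta> n (2*i)))" using zc[of n] unfolding code_def by blast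
        then have "z n \<in> Ob ?j" "small i (Ob ?j)" unfolding elim(1) by blast+
        then show ?case using mem[of "\<beta> n" ?j] b elim(2) by (simp add: z_def)
      qed
      then have *: "\<alpha> (2*?j+1) \<noteq> 0 \<and> small i (Ob ?j)" by simp
      then have "mball y (1 / real (\<alpha> (2*?j+1))) \<subseteq> Ob ?j" using A[of ?j] by simp
      moreover have "y \<in> mball y (1 / real (\<alpha> (2*?j+1)))" using yX * by simp
      ultimately show ?thesis using * by blast
    qed
    have "code \<alpha> y" unfolding code_def using A Bb yX by blast
    then show "\<alpha> \<in> P" unfolding P_def by blast
  qed
  have "souslin (range Ob) (space M)"
  proof (rule souslinI[OF clP imP])
    fix S assume "S \<in> range Ob"
    then obtain j where S: "S = Ob j" by auto
    have "{\<alpha>\<in>P. g \<alpha> \<in> S} = P \<inter> {\<alpha>. \<alpha> (2*j+1) \<in> - {0}}" "{\<alpha>\<in>P. g \<alpha> \<notin> S} = P \<inter> {\<alpha>. \<alpha> (2*j+1) \<in> {0}}"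
      using mem by (auto simp: S)
    then show "closed {\<alpha>\<in>P. g \<alpha> \<in> S} \<and> closed {\<alpha>\<in>P. g \<alpha> \<notin> S}"
      by (simp only: closed_Int[OF clP closed_coordinate] simp_thms)
  qed
  moreover have "separates (range Ob) (space M)"
    unfolding separates_def
  proof (intro ballI impI)
    fix x y assume xy: "x \<in> space M" "y \<in> space M" "x \<noteq> y"
    then have "d x y > 0" "x \<in> X" using XM by simp_all
    then have "x \<in> mball x (d x y)" by simp
    from Obase[OF openin_mball this] obtain j where "x \<in> Ob j" "Ob j \<subseteq> mball x (d x y)" by blast
    then show "\<exists>S\<in>range Ob. (x \<in> S) \<noteq> (y \<in> S)" by (intro bexI[of _ "Ob j"]) auto
  qed
  moreover have Osub: "range Ob \<subseteq> sets M"
    unfolding T(4) using Oop X(3) by auto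
  moreover have "sets M = sigma_sets (space M) (range Ob)"
  proof
    show "sigma_sets (space M) (range Ob) \<subseteq> sets M" by (rule sets.sigma_sets_subset[OF Osub])
    have Opow: "range Ob \<subseteq> Pow (space M)" using Osub sets.sets_into_space by auto
    interpret S: sigma_algebra "space M" "sigma_sets (space M) (range Ob)"
      by (rule sigma_algebra_sigma_sets[OF Opow])
    show "sets M \<subseteq> sigma_sets (space M) (range Ob)" unfolding T(4)
    proof (rule S.sigma_sets_subset, safe)
      fix U assume U: "openin T U"
      have "U = (\<Union>j\<in>{j. Ob j \<subseteq> U}. Ob j)" using Obase[of U] U X(3) by auto
      moreover have "(\<Union>j\<in>{j. Ob j \<subseteq> U}. Ob j) \<in> sigma_sets (space M) (range Ob)"
        by (intro S.countable_UN) auto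
      ultimately show "U \<in> sigma_sets (space M) (range Ob)" by simp
    qed
  qed
  moreover have "countable (range Ob)" by simp
  ultimately have "souslin_basis M (range Ob)" unfolding souslin_basis_def by iprover
  then show ?thesis by blast
qed

section \<open>Borel graphs and the diagonal of a standard Borel space\<close>

lemma standard_borel_separation:
  assumes M: "standard_borel M" and M': "standard_borel M'" and N: "standard_borel N"
    and f: "f \<in> M \<rightarrow>\<^sub>M N" "X \<in> sets M" and h: "h \<in> M' \<rightarrow>\<^sub>M N" "Y \<in> sets M'"
    and disj: "f ` X \<inter> h ` Y = {}"
  shows "\<exists>D\<in>sets N. f ` X \<subseteq> D \<and> D \<inter> h ` Y = {}"
proof -
  obtain \<B> where B: "souslin_basis M \<B>" using standard_borel_souslin_basis[OF M] by blast
  obtain \<B>' where B': "souslin_basis M' \<B>'" using standard_borel_souslin_basis[OF M'] by blast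
  obtain \<C> where C: "souslin_basis N \<C>" using standard_borel_souslin_basis[OF N] by blast
  note C' = souslin_basisD(1,2,4)[OF C]
  have "f ` X \<subseteq> space N" "h ` Y \<subseteq> space N"
    using measurable_space[OF f(1)] sets.sets_into_space[OF f(2)]
      measurable_space[OF h(1)] sets.sets_into_space[OF h(2)] by blast+
  with lusin_separation[OF souslin_image[OF B f C'(1,2)] souslin_image[OF B' h C'(1,2)] disj C'(2,3)]
  show ?thesis by blast
qed

text \<open>The preimages of \<open>B\<close> and of its complement are projections of Borel parts
  of the graph, hence disjoint Souslin sets that cover the space; a Borel set separating them is the
  preimage itself.\<close>

lemma measurable_graph:
  assumes M: "standard_borel M" and N: "standard_borel N"
    and f: "\<And>x. x \<in> space M \<Longrightarrow> f x \<in> space N"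
    and gr: "{(x, y) \<in> space M \<times> space N. y = f x} \<in> sets (M \<Otimes>\<^sub>M N)" (is "?D \<in> _")
  shows "f \<in> M \<rightarrow>\<^sub>M N"
proof (rule measurableI)
  fix B assume B: "B \<in> sets N"
  obtain \<B> where \<B>: "souslin_basis M \<B>" using standard_borel_souslin_basis[OF M] by blast
  obtain \<C> where \<C>: "souslin_basis N \<C>" using standard_borel_souslin_basis[OF N] by blast
  note \<B>' = souslin_basisD(1,2,4)[OF \<B>]
  note sl = souslin_image[OF souslin_basis_pair[OF \<B> \<C>] measurable_fst _ \<B>'(1,2)]
  have 1: "?D \<inter> space M \<times> B \<in> sets (M \<Otimes>\<^sub>M N)" "?D \<inter> space M \<times> (space N - B) \<in> sets (M \<Otimes>\<^sub>M N)"
    using gr B by auto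
  have "B \<subseteq> space N" using B sets.sets_into_space by auto
  then have "?D \<inter> space M \<times> B = (\<lambda>x. (x, f x)) ` (f -` B \<inter> space M)"
    "?D \<inter> space M \<times> (space N - B) = (\<lambda>x. (x, f x)) ` (space M - f -` B \<inter> space M)"
    using f by auto
  then have 2: "fst ` (?D \<inter> space M \<times> B) = f -` B \<inter> space M"
    "fst ` (?D \<inter> space M \<times> (space N - B)) = space M - f -` B \<inter> space M"
    by (simp_all only: image_image fst_conv image_ident)
  obtain E where E: "E \<in> sets M" "f -` B \<inter> space M \<subseteq> E" "E \<inter> (space M - f -` B \<inter> space M) = {}"
    using lusin_separation[OF sl[OF 1(1)] sl[OF 1(2)] _ \<B>'(2,3)] unfolding 2 by blast
  have "f -` B \<inter> space M = E" using E sets.sets_into_space[OF E(1)] by blast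
  then show "f -` B \<inter> space M \<in> sets M" using E(1) by simp
qed (rule f)

text \<open>Two points differ exactly if a member of the countable family contains only one of them,
  so the complement is a countable union of rectangles.\<close>

lemma standard_borel_diagonal:
  assumes "standard_borel M"
  shows "{(x, y) \<in> space M \<times> space M. x = y} \<in> sets (M \<Otimes>\<^sub>M M)"
proof -
  obtain \<B> where \<B>: "souslin_basis M \<B>" using standard_borel_souslin_basis[OF assms] by blast
  note \<B>' = souslin_basisD(1,2,4)[OF \<B>]
  have "{(x, y) \<in> space M \<times> space M. x = y} =
     space (M \<Otimes>\<^sub>M M) - (\<Union>S\<in>\<B>. S \<times> (space M - S) \<union> (space M - S) \<times> S)"
    (is "?L = ?R")
  proof
    show "?L \<subseteq> ?R" by (auto simp: space_pair_measure)
    show "?R \<subseteq> ?L"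
    proof
      fix p assume p: "p \<in> ?R"
      then have "p \<in> space M \<times> space M" unfolding space_pair_measure by (rule DiffD1)
      then have sp: "fst p \<in> space M" "snd p \<in> space M" by auto
      have "fst p = snd p"
      proof (rule ccontr)
        assume "fst p \<noteq> snd p"
        then obtain S where "S \<in> \<B>" "(fst p \<in> S) \<noteq> (snd p \<in> S)"
          using separatesE[OF \<B>'(3)] sp by metis
        then show False using p sp by (auto simp: mem_Times_iff)
      qed
      then show "p \<in> ?L" using sp by (cases p) auto
    qed
  qed
  also have "\<dots> \<in> sets (M \<Otimes>\<^sub>M M)"
    using \<B>'(1,2) by (intro sets.Diff sets.countable_UN') auto
  finally show ?thesis .
qed

subsection \<open>Trees\<close>

text \<open>A tree described by its distance alone, since the distance is the Borel and translation
  invariant datum of a treeing. \<open>parent_ex1\<close> forbids two ways down to the root,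
  \<open>adjacent_neq\<close> forbids edges inside a sphere; together they exclude circuits.\<close>

locale tree_metric =
  fixes V :: "'a set" and d :: "'a \<Rightarrow> 'a \<Rightarrow> nat"
  assumes sym: "x \<in> V \<Longrightarrow> y \<in> V \<Longrightarrow> d x y = d y x"
    and zero: "x \<in> V \<Longrightarrow> y \<in> V \<Longrightarrow> d x y = 0 \<longleftrightarrow> x = y"
    and triangle: "x \<in> V \<Longrightarrow> y \<in> V \<Longrightarrow> z \<in> V \<Longrightarrow> d x z \<le> d x y + d y z"
    and parent_ex1: "x \<in> V \<Longrightarrow> c \<in> V \<Longrightarrow> c \<noteq> x \<Longrightarrow> \<exists>!c'. c' \<in> V \<and> d c c' = 1 \<and> d x c = Suc (d x c')"
    and adjacent_neq: "x \<in> V \<Longrightarrow> y \<in> V \<Longrightarrow> c \<in> V \<Longrightarrow> d x y = 1 \<Longrightarrow> d c x \<noteq> d c y"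

text \<open>The root is its own parent, so that the map can be iterated beyond the depth of a
  vertex.\<close>

definition parent :: "'a set \<Rightarrow> ('a \<Rightarrow> 'a \<Rightarrow> nat) \<Rightarrow> 'a \<Rightarrow> 'a \<Rightarrow> 'a" where
  "parent V d x c = (if c = x then x else THE c'. c' \<in> V \<and> d c c' = 1 \<and> d x c = Suc (d x c'))"

lemma relpow_sym: "sym E \<Longrightarrow> (u, v) \<in> E ^^ n \<Longrightarrow> (v, u) \<in> E ^^ n"
proof (induction n arbitrary: v)
  case (Suc n)
  then obtain w where "(u, w) \<in> E ^^ n" "(w, v) \<in> E" by auto
  then have "(v, w) \<in> E" "(w, u) \<in> E ^^ n" using Suc by (auto dest: symD)
  then show ?case by (rule relpow_Suc_I2)
qed simp

lemma tree_on_tree_metric: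
  assumes "tree_on V E"
  shows "tree_metric V (path_dist E)"
proof -
  have E: "E \<subseteq> V \<times> V" "Relation.sym E" "irrefl E" "\<And>u v. u \<in> V \<Longrightarrow> v \<in> V \<Longrightarrow> (u, v) \<in> E\<^sup>*"
    and no_circuit: "\<And>c. 3 \<le> length c \<Longrightarrow> distinct c \<Longrightarrow> successively (\<lambda>u v. (u, v) \<in> E) c \<Longrightarrow>
        (last c, hd c) \<in> E \<Longrightarrow> False"
    using assms unfolding tree_on_def by blast+
  define d where "d = path_dist E"
  have dE: "(u, v) \<in> E ^^ d u v" if uv: "u \<in> V" "v \<in> V" for u v
  proof -
    obtain n where "(u, v) \<in> E ^^ n" using rtrancl_imp_relpow[OF E(4)[OF uv]] by blast
    then show ?thesis unfolding d_def path_dist_def by (rule LeastI)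
  qed
  have d_le: "d u v \<le> n" if "(u, v) \<in> E ^^ n" for u v n
    unfolding d_def path_dist_def using that by (rule Least_le)
  have sym: "d x y = d y x" if "x \<in> V" "y \<in> V" for x y
    using d_le[OF relpow_sym[OF E(2) dE[OF that]]] d_le[OF relpow_sym[OF E(2) dE[OF that(2,1)]]] by simp
  have zero: "d x y = 0 \<longleftrightarrow> x = y" if "x \<in> V" "y \<in> V" for x y
    using dE[OF that] d_le[of x y 0] by auto
  have tri: "d x z \<le> d x y + d y z" if "x \<in> V" "y \<in> V" "z \<in> V" for x y z
  proof -
    have "(x, z) \<in> E ^^ d x y O E ^^ d y z" using dE that by blast
    then show ?thesis by (intro d_le) (simp add: relpow_add)
  qed
  have adj: "(x, y) \<in> E \<longleftrightarrow> d x y = 1" if "x \<in> V" "y \<in> V" for x y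
  proof
    assume *: "(x, y) \<in> E"
    then have "x \<noteq> y" using E(3) by (auto dest: irreflD)
    then have "d x y \<noteq> 0" using zero that by simp
    moreover have "d x y \<le> 1" using * by (intro d_le) simp
    ultimately show "d x y = 1" by simp
  next
    assume "d x y = 1"
    then show "(x, y) \<in> E" using dE[OF that] by simp
  qed
  have down: "\<exists>c'. c' \<in> V \<and> d c c' = 1 \<and> d x c = Suc (d x c')" if xc: "x \<in> V" "c \<in> V" "c \<noteq> x" for x c
  proof -
    obtain n where n: "d x c = Suc n" using zero xc not0_implies_Suc by metis
    then obtain w where w: "(x, w) \<in> E ^^ n" "(w, c) \<in> E" using dE[OF xc(1,2)] by auto
    then have wV: "w \<in> V" using E(1) by auto
    have "d w c = 1" using adj w(2) wV that by simp
    then have cw: "d c w = 1" using sym wV that by simp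
    have "d x w \<le> n" using d_le[OF w(1)] .
    moreover have "Suc n \<le> d x w + 1" using tri[of x w c] that wV n \<open>d w c = 1\<close> by simp
    ultimately show ?thesis using n cw wV by (intro exI[of _ w]) simp
  qed
  \<comment> \<open>Two vertices of one sphere around \<open>r\<close> are joined by a simple path
    inside the ball, found by descending from both ends until the ways meet. A vertex with two
    parents, or an edge inside a sphere, closes such a path to a circuit.\<close>
  have sphere: "\<exists>q. distinct q \<and> 3 \<le> length q \<and> hd q = a \<and> last q = b \<and>
      successively (\<lambda>u v. (u, v) \<in> E) q \<and> (\<forall>v\<in>set q. v \<in> V \<and> d r v \<le> n)"
    if "r \<in> V" "a \<in> V" "b \<in> V" "a \<noteq> b" "d r a = n" "d r b = n" for r a b n
    using that
  proof (induction n arbitrary: a b)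
    case 0
    then have "r = a" "r = b" using zero[of r a] zero[of r b] by simp_all
    then show ?case using 0 by simp
  next
    case (Suc n)
    have "a \<noteq> r" "b \<noteq> r" using Suc.prems zero[of r r] by auto
    then obtain a' b' where ab: "a' \<in> V" "d a a' = 1" "d r a = Suc (d r a')"
      "b' \<in> V" "d b b' = 1" "d r b = Suc (d r b')"
      using down[of r a] down[of r b] Suc.prems by blast
    have Eab: "(a, a') \<in> E" "(b', b) \<in> E" using adj ab Suc.prems sym by auto
    have lev: "d r a' = n" "d r b' = n" using ab Suc.prems by auto
    have neq: "a \<noteq> a'" "b \<noteq> b'" "a \<noteq> b'" "b \<noteq> a'" using lev Suc.prems by auto
    show ?case
    proof (cases "a' = b'")
      case True
      then show ?thesis using Eab neq lev Suc.prems ab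
        by (intro exI[of _ "[a, a', b]"]) simp
    next
      case False
      then obtain q where q: "distinct q" "3 \<le> length q" "hd q = a'" "last q = b'"
        "successively (\<lambda>u v. (u, v) \<in> E) q" "\<forall>v\<in>set q. v \<in> V \<and> d r v \<le> n"
        using Suc.IH[of a' b'] Suc.prems(1) ab lev by blast
      have qn: "q \<noteq> []" using q(2) by auto
      have "a \<notin> set q" "b \<notin> set q" using q(6) Suc.prems by force+
      then show ?thesis using q qn Eab Suc.prems
        by (intro exI[of _ "a # q @ [b]"])
          (auto simp: successively_Cons successively_append_iff)
    qed
  qed
  have uniq: "a = b" if ab: "x \<in> V" "c \<in> V" "a \<in> V" "d c a = 1" "d x c = Suc (d x a)"
     "b \<in> V" "d c b = 1" "d x c = Suc (d x b)" for x c a b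
  proof (rule ccontr)
    assume "a \<noteq> b"
    then obtain q where q: "distinct q" "3 \<le> length q" "hd q = a" "last q = b"
        "successively (\<lambda>u v. (u, v) \<in> E) q" "\<forall>v\<in>set q. v \<in> V \<and> d x v \<le> d x a"
      using sphere[of x a b "d x a"] ab by auto
    have qn: "q \<noteq> []" using q(2) by auto
    have "c \<notin> set q" using q(6) ab by force
    moreover have "(c, a) \<in> E" "(b, c) \<in> E" using adj ab sym by auto
    ultimately show False using q qn
      by (intro no_circuit[of "c # q"]) (auto simp: successively_Cons)
  qed
  have adjn: "d c x \<noteq> d c y" if xy: "x \<in> V" "y \<in> V" "c \<in> V" "d x y = 1" for x y c
  proof
    assume eq: "d c x = d c y"
    have neq: "x \<noteq> y" using xy zero[of x y] by auto
    obtain q where q: "distinct q" "3 \<le> length q" "hd q = x" "last q = y"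
        "successively (\<lambda>u v. (u, v) \<in> E) q"
      using sphere[OF xy(3,1,2) neq eq refl] by (elim exE conjE) (rule that)
    have "(y, x) \<in> E" using adj xy sym by auto
    then show False using q by (intro no_circuit[of q]) auto
  qed
  show ?thesis
    unfolding d_def[symmetric]
  proof
    fix x c assume "x \<in> V" "c \<in> V" "c \<noteq> x"
    then show "\<exists>!c'. c' \<in> V \<and> d c c' = 1 \<and> d x c = Suc (d x c')"
      using down[of x c] uniq[of x c] by blast
  qed (use sym zero tri adjn in auto)
qed

section \<open>Parents under a change of root\<close>

context tree_metric
begin

abbreviation par :: "'a \<Rightarrow> 'a \<Rightarrow> 'a" where "par \<equiv> parent V d"

lemma par_root [simp]: "par x x = x"
  by (simp add: parent_def)

lemma par:
  assumes "x \<in> V" "c \<in> V" "c \<noteq> x"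
  shows "par x c \<in> V" "d c (par x c) = 1" "d x c = Suc (d x (par x c))"
  using theI'[OF parent_ex1[OF assms]] assms(3) by (simp_all add: parent_def)

lemma par_in: "x \<in> V \<Longrightarrow> c \<in> V \<Longrightarrow> par x c \<in> V"
  using par(1) by (cases "c = x") auto

lemma par_eqI:
  assumes "x \<in> V" "c \<in> V" "c' \<in> V" "d c c' = 1" "d x c = Suc (d x c')"
  shows "par x c = c'"
proof -
  have "c \<noteq> x" using assms zero[of x x] by auto
  then show ?thesis using parent_ex1[of x c] par[of x c] assms by blast
qed

lemma par_adjacent:
  assumes "x \<in> V" "y \<in> V" "d x y = 1"
  shows "par x y = x" "par y x = y"
  using assms sym[of x y] zero[of x x] zero[of y y] by (auto intro!: par_eqI)

text \<open>One of two adjacent roots is nearer to \<open>c\<close> by exactly one step, and the way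
  from the farther root leads through the nearer one; so both roots give \<open>c\<close> the same
  parent.\<close>

lemma par_adjacent_eq:
  assumes xy: "x \<in> V" "y \<in> V" "d x y = 1" and c: "c \<in> V" "c \<noteq> x" "c \<noteq> y"
  shows "par x c = par y c"
proof -
  have *: "par x c = par y c" if xy: "x \<in> V" "y \<in> V" "d x y = 1" "c \<noteq> x" and less: "d c x < d c y" for x y
  proof -
    note p = par[OF xy(1) c(1) xy(4)]
    have "d c y \<le> d c x + 1" using triangle[of c x y] xy c by simp
    then have y: "d y c = Suc (d x c)" using less xy c sym by simp
    have "d y (par x c) \<le> d y x + d x (par x c)" using triangle xy c p by blast
    then have "d y (par x c) \<le> d x c" using p xy sym[of x y] by simp
    moreover have "d y c \<le> d y (par x c) + d (par x c) c" using triangle xy c p by blast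
    then have "d y c \<le> d y (par x c) + 1" using p c sym[of c "par x c"] by simp
    ultimately show ?thesis using y p xy c by (intro par_eqI[symmetric]) auto
  qed
  have "d c x \<noteq> d c y" using adjacent_neq xy c by simp
  then show ?thesis using *[of x y] *[of y x] xy c sym[of x y] by fastforce
qed

lemma dist_neq_par:
  assumes "x \<in> V" "c \<in> V" "n \<le> d x c" shows "(par x ^^ n) c \<in> V \<and> d x ((par x ^^ n) c) = d x c - n"
  using assms(3)
proof (induction n)
  case (Suc n)
  then have *: "(par x ^^ n) c \<in> V" "d x ((par x ^^ n) c) = d x c - n" by simp_all
  then have "(par x ^^ n) c \<noteq> x" using Suc zero[of x x] assms by auto
  then show ?case using par[OF assms(1) *(1)] * by simp
qed (use assms in simp)

lemma par_pow_in: "x \<in> V \<Longrightarrow> c \<in> V \<Longrightarrow> (par x ^^ n) c \<in> V"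
  by (induction n) (auto intro: par_in)

text \<open>The path from \<open>x\<close> down to \<open>y\<close> lies in \<open>T\<close>. The
  root moves along it one edge at a time, and each move changes parents only at the two ends of the
  edge, which belong to \<open>T\<close>.\<close>

lemma closed_root_change:
  assumes T: "T \<subseteq> V" "x \<in> T" "y \<in> T" and cl: "\<And>c. c \<in> T \<Longrightarrow> par y c \<in> T" and c: "c \<in> T"
  shows "par x c \<in> T"
proof -
  have "\<forall>c\<in>T. par x c \<in> T" if "x \<in> T" "d y x = n" for x n
    using that
  proof (induction n arbitrary: x)
    case 0
    then have "x = y" using zero T by blast
    then show ?case using cl by blast
  next
    case (Suc n)
    then have "x \<noteq> y" using zero[of y y] T by auto
    define x' where "x' = par y x"
    have x': "x' \<in> T" "x' \<in> V" "x \<in> V" "d x x' = 1" "d y x = Suc (d y x')"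
      using par[of y x] T Suc cl \<open>x \<noteq> y\<close> by (auto simp: x'_def)
    then have IH: "\<forall>c\<in>T. par x' c \<in> T" using Suc by simp
    show ?case
    proof
      fix c assume "c \<in> T"
      then show "par x c \<in> T"
        using par_adjacent[OF x'(3,2,4)] par_adjacent_eq[OF x'(3,2,4), of c] IH T Suc(2)
        by (cases "c = x"; cases "c = x'") auto
    qed
  qed
  then show ?thesis using T c by blast
qed

text \<open>As the root belongs to \<open>A\<close>, the iterated parents of \<open>A\<close> form
  its convex hull, a notion free of roots. It is enough that the set formed with one root is closed
  under the parents of the other.\<close>

lemma hull_root_change:
  assumes A: "A \<subseteq> V" "x \<in> A" "y \<in> A"
  shows "{(par x ^^ n) c | n c. c \<in> A} = {(par y ^^ n) c | n c. c \<in> A}"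
proof -
  have "{(par x ^^ n) c | n c. c \<in> A} \<subseteq> {(par y ^^ n) c | n c. c \<in> A}" (is "_ \<subseteq> ?T")
    if "x \<in> A" "y \<in> A" for x y
  proof -
    have A_sub: "A \<subseteq> ?T"
    proof
      fix c assume "c \<in> A"
      then have "(par y ^^ 0) c \<in> ?T" by blast
      then show "c \<in> ?T" by simp
    qed
    have TV: "?T \<subseteq> V" using A that par_pow_in[of y] by (auto simp: subset_iff)
    have cl: "par y c \<in> ?T" if "c \<in> ?T" for c
    proof -
      obtain n c' where "c = (par y ^^ n) c'" "c' \<in> A" using \<open>c \<in> ?T\<close> by blast
      then have "par y c = (par y ^^ Suc n) c'" "c' \<in> A" by simp_all
      then show ?thesis by blast
    qed
    have clx: "par x c \<in> ?T" if "c \<in> ?T" for c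
      using closed_root_change[OF TV _ _ cl that, of x] A_sub \<open>x \<in> A\<close> \<open>y \<in> A\<close> by blast
    have "(par x ^^ n) c \<in> ?T" if "c \<in> A" for n c
      by (induction n) (use that A_sub clx in auto)
    then show ?thesis by blast
  qed
  then show ?thesis using A by blast
qed

end

subsection \<open>The isometry between \<open>\<ell>\<^sup>2\<close> of a rooted tree and the space of the kernel \<open>\<lambda>\<^sup>d\<close>\<close>

text \<open>For a rooted tree with parent map \<open>p\<close>, the vectors \<open>u c\<close> defined by \<open>u r = e r\<close> and
  \<open>u c = \<lambda> u (p c) + sqrt (1 - \<lambda>\<^sup>2) e c\<close> have inner products \<open>\<lambda>\<^bsup>d c c'\<^esup>\<close>. The map \<open>tint\<close> sends
  \<open>v\<close> to the function \<open>c \<mapsto> \<langle>v, u c\<rangle>\<close>, and \<open>tdiff\<close> is its inverse; \<open>n\<close> is the depth of \<open>c\<close>.\<close>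

definition tdiff :: "real \<Rightarrow> ('a \<Rightarrow> 'a) \<Rightarrow> 'a \<Rightarrow> ('a \<Rightarrow> complex) \<Rightarrow> 'a \<Rightarrow> complex" where
  "tdiff l p r f c = (if c = r then f c else (f c - of_real l * f (p c)) / of_real (sqrt (1 - l\<^sup>2)))"

definition tint :: "real \<Rightarrow> ('a \<Rightarrow> 'a) \<Rightarrow> 'a \<Rightarrow> nat \<Rightarrow> ('a \<Rightarrow> complex) \<Rightarrow> 'a \<Rightarrow> complex" where
  "tint l p r n v c =
     (\<Sum>i<n. of_real (l ^ i * sqrt (1 - l\<^sup>2)) * v ((p ^^ i) c)) + of_real (l ^ n) * v r"

lemma tint_0: "tint l p r 0 v c = v r"
  by (simp add: tint_def)

lemma tint_Suc: "tint l p r (Suc n) v c = of_real (sqrt (1 - l\<^sup>2)) * v c + of_real l * tint l p r n v (p c)"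
  by (simp add: tint_def sum.lessThan_Suc_shift sum_distrib_left algebra_simps funpow_swap1 del: sum.lessThan_Suc)

lemma tint_add: "tint l p r n (\<lambda>c. v c + w c) c = tint l p r n v c + tint l p r n w c"
  by (simp add: tint_def sum.distrib algebra_simps)

lemma tint_mult: "tint l p r n (\<lambda>c. a * v c) c = a * tint l p r n v c"
  by (simp add: tint_def sum_distrib_left algebra_simps)

lemma tdiff_add: "tdiff l p r (\<lambda>c. v c + w c) c = tdiff l p r v c + tdiff l p r w c"
  by (simp add: tdiff_def algebra_simps add_divide_distrib diff_divide_distrib)

lemma tdiff_mult: "tdiff l p r (\<lambda>c. a * v c) c = a * tdiff l p r v c"
  by (simp add: tdiff_def algebra_simps)

text \<open>Both sides equal (|a|^2 + |b|^2 - 2 l Re (a cnj b)) / (1 - l^2), an expression symmetric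
  in the two ends of the edge.\<close>

lemma tdiff_edge_identity:
  fixes a b :: complex
  assumes l: "0 < l" "l < (1::real)"
  shows "(cmod a)\<^sup>2 + (cmod ((b - of_real l * a) / of_real (sqrt (1 - l\<^sup>2))))\<^sup>2 =
         (cmod b)\<^sup>2 + (cmod ((a - of_real l * b) / of_real (sqrt (1 - l\<^sup>2))))\<^sup>2"
proof -
  have s: "1 - l\<^sup>2 > 0" using l by (simp add: power_less_one_iff)
  have *: "(cmod ((b - of_real l * a) / of_real (sqrt (1 - l\<^sup>2))))\<^sup>2 =
     ((Re b - l * Re a)\<^sup>2 + (Im b - l * Im a)\<^sup>2) / (1 - l\<^sup>2)" for a b
    using s by (simp add: norm_divide power_divide cmod_power2)
  show ?thesis unfolding * cmod_power2[of a] cmod_power2[of b]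
    using s by (simp add: field_simps) (simp add: power2_eq_square algebra_simps)
qed

section \<open>Functions of finite energy on a tree\<close>

context tree_metric
begin

lemma tdiff_tint:
  assumes l: "0 < l" "l < 1" and xc: "x \<in> V" "c \<in> V"
  shows "tdiff l (par x) x (\<lambda>c. tint l (par x) x (d x c) v c) c = v c"
proof (cases "c = x")
  case True
  then show ?thesis using zero[of x x] xc by (simp add: tdiff_def tint_0)
next
  case False
  have "1 - l\<^sup>2 > 0" using l by (simp add: power_less_one_iff)
  then show ?thesis using False par[OF xc False] by (simp add: tdiff_def tint_Suc)
qed

lemma tint_tdiff:
  assumes l: "0 < l" "l < 1" and x: "x \<in> V" and c: "c \<in> V"
  shows "tint l (par x) x (d x c) (tdiff l (par x) x f) c = f c"
  using c
proof (induction "d x c" arbitrary: c)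
  case 0
  then have "c = x" using zero[of x c] x by simp
  moreover have "d x x = 0" using zero[of x x] x by simp
  ultimately show ?case by (simp add: tint_0 tdiff_def)
next
  case (Suc n)
  then have cx: "c \<noteq> x" using zero[of x x] x by auto
  have "1 - l\<^sup>2 > 0" using l by (simp add: power_less_one_iff)
  moreover have "tint l (par x) x n (tdiff l (par x) x f) (par x c) = f (par x c)"
    using Suc par[OF x Suc.prems cx] by auto
  ultimately show ?case using cx unfolding Suc(2)[symmetric] tint_Suc
    by (simp add: tdiff_def)
qed

text \<open>If the root moves along an edge, the parents of all other vertices stay the same, so
  only two terms change, and \<open>tdiff_edge_identity\<close> preserves their sum. Thus the energy
  belongs to the kernel and not to the root.\<close>

lemma energy_root_change:
  assumes l: "0 < l" "l < 1" and T: "T \<subseteq> V" "x \<in> T" "y \<in> T" and cl: "\<And>c. c \<in> T \<Longrightarrow> par y c \<in> T"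
  shows "(\<integral>\<^sup>+c. ennreal ((cmod (tdiff l (par x) x f c))\<^sup>2) \<partial>count_space T) =
         (\<integral>\<^sup>+c. ennreal ((cmod (tdiff l (par y) y f c))\<^sup>2) \<partial>count_space T)"
  using T(2)
proof (induction "d y x" arbitrary: x)
  case 0
  then have "x = y" using zero[of y x] T by auto
  then show ?case by simp
next
  case (Suc n)
  have xV: "x \<in> V" "y \<in> V" using Suc T by auto
  then have xy: "x \<noteq> y" using Suc(2) zero[of y y] by auto
  define x' where "x' = par y x"
  have x': "x' \<in> T" "x' \<in> V" "d x x' = 1" "d y x = Suc (d y x')"
    using par[of y x] xV cl Suc(3) xy by (auto simp: x'_def)
  have neq: "x \<noteq> x'" using x'(3) zero[of x x] xV by auto
  define e where "e z c = ennreal ((cmod (tdiff l (par z) z f c))\<^sup>2)" for z c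
  have split: "(\<integral>\<^sup>+c. e z c \<partial>count_space T) =
      (e z x + e z x') + (\<integral>\<^sup>+c. e z c * indicator (- {x, x'}) c \<partial>count_space T)" for z
  proof -
    have "(\<integral>\<^sup>+c. e z c \<partial>count_space T) =
      (\<integral>\<^sup>+c. e z c * indicator {x, x'} c + e z c * indicator (- {x, x'}) c \<partial>count_space T)"
      by (intro nn_integral_cong) (auto split: split_indicator)
    also have "\<dots> = (\<integral>\<^sup>+c. e z c * indicator {x, x'} c \<partial>count_space T) +
       (\<integral>\<^sup>+c. e z c * indicator (- {x, x'}) c \<partial>count_space T)"
      by (intro nn_integral_add) auto
    also have "(\<integral>\<^sup>+c. e z c * indicator {x, x'} c \<partial>count_space T) =
       (\<Sum>c\<in>{x, x'}. e z c * indicator {x, x'} c)"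
      using Suc(3) x' by (intro nn_integral_count_space') auto
    also have "\<dots> = e z x + e z x'" using neq by simp
    finally show ?thesis .
  qed
  have off: "(\<integral>\<^sup>+c. e x c * indicator (- {x, x'}) c \<partial>count_space T) =
     (\<integral>\<^sup>+c. e x' c * indicator (- {x, x'}) c \<partial>count_space T)"
  proof (intro nn_integral_cong)
    fix c assume c: "c \<in> space (count_space T)"
    show "e x c * indicator (- {x, x'}) c = e x' c * indicator (- {x, x'}) c"
    proof (cases "c \<in> {x, x'}")
      case False
      then have "par x c = par x' c" using par_adjacent_eq[OF xV(1) x'(2,3), of c] c T by auto
      then show ?thesis using False by (simp add: e_def tdiff_def)
    qed auto
  qed
  have p: "par x x' = x" "par x' x = x'" using par_adjacent[OF xV(1) x'(2,3)] by auto
  have "e x x + e x x' = e x' x + e x' x'"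
    using tdiff_edge_identity[OF l, of "f x" "f x'"] neq
    by (simp add: e_def tdiff_def p ennreal_plus[symmetric] add.commute del: ennreal_plus)
  then have "(\<integral>\<^sup>+c. e x c \<partial>count_space T) = (\<integral>\<^sup>+c. e x' c \<partial>count_space T)"
    unfolding split off by simp
  then show ?case using Suc(1)[of x'] Suc(2) x' by (simp add: e_def)
qed

text \<open>Chebyshev's inequality: n elements of the set contribute at least n e^2 to the
  integral.\<close>

lemma finite_level_sets:
  fixes w :: "'b \<Rightarrow> complex"
  assumes fin: "(\<integral>\<^sup>+c. ennreal ((cmod (w c))\<^sup>2) \<partial>count_space T) < \<infinity>" and e: "e > 0"
  shows "finite {c\<in>T. e \<le> cmod (w c)}"
proof (rule ccontr)
  assume inf: "\<not> ?thesis"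
  define K where "K = enn2real (\<integral>\<^sup>+c. ennreal ((cmod (w c))\<^sup>2) \<partial>count_space T)"
  obtain n :: nat where n: "K < of_nat n * e\<^sup>2" using ex_less_of_nat_mult[of "e\<^sup>2" K] e by auto
  obtain F where F: "finite F" "card F = n" "F \<subseteq> {c\<in>T. e \<le> cmod (w c)}"
    using infinite_arbitrarily_large[OF inf] by blast
  have "ennreal (of_nat n * e\<^sup>2) = (\<Sum>c\<in>F. ennreal (e\<^sup>2))" by (simp add: F ennreal_of_nat_eq_real_of_nat ennreal_mult)
  also have "\<dots> \<le> (\<Sum>c\<in>F. ennreal ((cmod (w c))\<^sup>2))"
    using F(3) e by (intro sum_mono ennreal_leI power_mono) auto
  also have "\<dots> = (\<integral>\<^sup>+c. ennreal ((cmod (w c))\<^sup>2) * indicator F c \<partial>count_space T)"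
    using F by (subst nn_integral_count_space'[of F]) auto
  also have "\<dots> \<le> (\<integral>\<^sup>+c. ennreal ((cmod (w c))\<^sup>2) \<partial>count_space T)"
    by (intro nn_integral_mono) (auto split: split_indicator)
  also have "\<dots> = ennreal K" unfolding K_def using fin by simp
  finally have "of_nat n * e\<^sup>2 \<le> K" by (simp add: K_def)
  then show False using n by simp
qed

text \<open>With w the \<open>tdiff\<close> of \<open>f\<close> and s = sqrt (1 - l^2), one has f c
  = s w c + l f (par x c) off the root. As w is bounded and \<open>l < 1\<close>, \<open>f\<close>
  is bounded. Let M > 0 be the supremum of |f|. For t > l, a vertex other than the root with |f c| >
  t M satisfies s |w c| >= (t - l) M, and there are finitely many of these; so M is attained, and
  finitely often.\<close>

lemma finite_argmax:
  assumes l: "0 < l" "l < 1" and T: "T \<subseteq> V" "x \<in> T" and cl: "\<And>c. c \<in> T \<Longrightarrow> par x c \<in> T"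
    and fin: "(\<integral>\<^sup>+c. ennreal ((cmod (tdiff l (par x) x f c))\<^sup>2) \<partial>count_space T) < \<infinity>"
    and nz: "c\<^sub>0 \<in> T" "f c\<^sub>0 \<noteq> 0"
  shows "finite {c\<in>T. \<forall>c'\<in>T. cmod (f c') \<le> cmod (f c)}" "{c\<in>T. \<forall>c'\<in>T. cmod (f c') \<le> cmod (f c)} \<noteq> {}"
proof -
  define s where "s = sqrt (1 - l\<^sup>2)"
  have s: "s > 0" using l by (simp add: power_less_one_iff s_def)
  have xV: "x \<in> V" using T by auto
  let ?w = "tdiff l (par x) x f"
  define B where "B = Max (insert 1 ((\<lambda>c. cmod (?w c)) ` {c\<in>T. 1 \<le> cmod (?w c)}))"
  have finL: "finite {c\<in>T. e \<le> cmod (?w c)}" if "e > 0" for e using finite_level_sets[OF fin that] .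
  have wB: "cmod (?w c) \<le> B" if "c \<in> T" for c
  proof (cases "1 \<le> cmod (?w c)")
    case True
    then show ?thesis unfolding B_def using finL[of 1] that by (intro Max_ge) auto
  next
    case False
    have "1 \<le> B" unfolding B_def using finL[of 1] by (intro Max_ge) auto
    then show ?thesis using False by simp
  qed
  \<comment> \<open>Chosen so that s B + l D <= D: the bound passes from a parent to its
    children.\<close>
  define D where "D = cmod (f x) + s * B / (1 - l)"
  have B0: "0 \<le> B" using wB[OF T(2)] norm_ge_zero order_trans by blast
  have D0: "cmod (f x) \<le> D" unfolding D_def using l s B0 by simp
  have rec: "f c = of_real s * ?w c + of_real l * f (par x c)" if "c \<in> T" "c \<noteq> x" for c
    using that s by (simp add: tdiff_def s_def[symmetric])
  have bound: "cmod (f c) \<le> D" if "c \<in> T" for c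
    using that
  proof (induction "d x c" arbitrary: c)
    case 0
    then have "c = x" using zero[of x c] xV T by auto
    then show ?case using D0 by simp
  next
    case (Suc n)
    then have cx: "c \<noteq> x" using zero[of x x] xV by auto
    have "cmod (f (par x c)) \<le> D" using Suc par[OF xV _ cx] T cl by auto
    then have "cmod (f c) \<le> s * B + l * D"
      unfolding rec[OF Suc(3) cx] using wB[OF Suc(3)] s l
      by (intro norm_triangle_le add_mono) (simp_all add: norm_mult mult_left_mono)
    also have "\<dots> \<le> D"
    proof -
      have "(1 - l) * D = (1 - l) * cmod (f x) + s * B" using l by (simp add: D_def field_simps)
      moreover have "0 \<le> (1 - l) * cmod (f x)" using l by simp
      ultimately show ?thesis by (simp add: algebra_simps)
    qed
    finally show ?case .
  qed
  define M where "M = (SUP c\<in>T. cmod (f c))"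
  have bdd: "bdd_above ((\<lambda>c. cmod (f c)) ` T)" using bound by (intro bdd_aboveI2) auto
  have leM: "cmod (f c) \<le> M" if "c \<in> T" for c unfolding M_def using that bdd by (rule cSUP_upper)
  have M0: "M > 0" using leM[OF nz(1)] nz(2) by (meson norm_ge_zero order_less_le_trans zero_less_norm_iff)
  \<comment> \<open>Any number strictly between \<open>l\<close> and 1 would do.\<close>
  define t where "t = (1 + l) / 2"
  have t: "l < t" "t < 1" "t * M < M" using l M0 by (auto simp: t_def)
  define Big where "Big = {c\<in>T. t * M < cmod (f c)}"
  have "Big \<subseteq> insert x {c\<in>T. (t - l) * M / s \<le> cmod (?w c)}"
  proof
    fix c assume c: "c \<in> Big"
    have "(t - l) * M / s \<le> cmod (?w c)" if "c \<noteq> x"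
    proof -
      have cT: "c \<in> T" "t * M < cmod (f c)" using c by (auto simp: Big_def)
      have "t * M < cmod (of_real s * ?w c) + cmod (of_real l * f (par x c))"
        using cT(2) norm_triangle_ineq[of "of_real s * ?w c" "of_real l * f (par x c)"]
        unfolding rec[OF cT(1) that, symmetric] by linarith
      also have "\<dots> = s * cmod (?w c) + l * cmod (f (par x c))" using s l by (simp add: norm_mult)
      also have "\<dots> \<le> s * cmod (?w c) + l * M" using leM[OF cl[OF cT(1)]] l by (simp add: mult_left_mono)
      finally show ?thesis using s by (simp add: field_simps)
    qed
    then show "c \<in> insert x {c\<in>T. (t - l) * M / s \<le> cmod (?w c)}" using c by (auto simp: Big_def)
  qed
  then have finB: "finite Big"
    using finL[of "(t - l) * M / s"] t M0 s by (meson diff_gt_0_iff_gt divide_pos_pos finite_insert finite_subset mult_pos_pos)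
  have "\<exists>c\<in>T. t * M < cmod (f c)"
    using less_cSUP_iff[OF _ bdd, of "t * M"] t T(2) unfolding M_def by auto
  then have neB: "Big \<noteq> {}" by (auto simp: Big_def)
  define m where "m = Max ((\<lambda>c. cmod (f c)) ` Big)"
  have "m \<in> (\<lambda>c. cmod (f c)) ` Big" unfolding m_def using finB neB by (intro Max_in) auto
  then obtain c\<^sub>1 where c1: "c\<^sub>1 \<in> Big" "cmod (f c\<^sub>1) = m" by auto
  have top: "cmod (f c) \<le> cmod (f c\<^sub>1)" if "c \<in> T" for c
  proof (cases "c \<in> Big")
    case True
    then show ?thesis unfolding c1(2) m_def using finB by (intro Max_ge) auto
  next
    case False
    then have "cmod (f c) \<le> t * M" using that by (simp add: Big_def)
    also have "\<dots> \<le> cmod (f c\<^sub>1)" using c1(1) by (simp add: Big_def)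
    finally show ?thesis .
  qed
  have "c\<^sub>1 \<in> T" using c1 by (simp add: Big_def)
  then show "{c\<in>T. \<forall>c'\<in>T. cmod (f c') \<le> cmod (f c)} \<noteq> {}" using top by auto
  have "{c\<in>T. \<forall>c'\<in>T. cmod (f c') \<le> cmod (f c)} \<subseteq> Big"
    using c1(1) \<open>c\<^sub>1 \<in> T\<close> unfolding Big_def by force
  then show "finite {c\<in>T. \<forall>c'\<in>T. cmod (f c') \<le> cmod (f c)}" using finB by (rule finite_subset)
qed

end

subsection \<open>The Hilbert space \<open>\<ell>\<^sup>2\<close>\<close>

definition l2 :: "(nat \<Rightarrow> complex) ip_space" where
  "l2 = \<lparr>carrier = {f. summable (\<lambda>i. (cmod (f i))\<^sup>2)}, monoid.mult = (\<lambda>_ _ _. 0), one = (\<lambda>_. 0),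
     zero = (\<lambda>_. 0), add = (\<lambda>f g i. f i + g i), smult = (\<lambda>a f i. a * f i),
     ip = (\<lambda>f g. \<Sum>i. f i * cnj (g i))\<rparr>"

definition unit_vec :: "nat \<Rightarrow> nat \<Rightarrow> complex" where
  "unit_vec n = (\<lambda>i. if i = n then 1 else 0)"

definition sqnorm :: "(nat \<Rightarrow> complex) \<Rightarrow> real" where
  "sqnorm f = (\<Sum>i. (cmod (f i))\<^sup>2)"

lemma l2_simps [simp]:
  "f \<in> carrier l2 \<longleftrightarrow> summable (\<lambda>i. (cmod (f i))\<^sup>2)" "\<zero>\<^bsub>l2\<^esub> = (\<lambda>_. 0)"
  "f \<oplus>\<^bsub>l2\<^esub> g = (\<lambda>i. f i + g i)" "a \<odot>\<^bsub>l2\<^esub> f = (\<lambda>i. a * f i)" "ip l2 f g = (\<Sum>i. f i * cnj (g i))"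
  by (simp_all add: l2_def)

lemma l2_mult: "summable (\<lambda>i. (cmod (f i))\<^sup>2) \<Longrightarrow> summable (\<lambda>i. (cmod (a * f i))\<^sup>2)"
  by (simp add: norm_mult power_mult_distrib summable_mult)

lemma l2_add:
  assumes "summable (\<lambda>i. (cmod (f i))\<^sup>2)" "summable (\<lambda>i. (cmod (g i))\<^sup>2)"
  shows "summable (\<lambda>i. (cmod (f i + g i))\<^sup>2)"
proof (rule summable_comparison_test')
  show "summable (\<lambda>i. 2 * (cmod (f i))\<^sup>2 + 2 * (cmod (g i))\<^sup>2)"
    using assms by (intro summable_add summable_mult)
  fix i
  have "(cmod (f i + g i))\<^sup>2 \<le> (cmod (f i) + cmod (g i))\<^sup>2" by (intro power_mono norm_triangle_ineq) simp
  also have "\<dots> \<le> 2 * (cmod (f i))\<^sup>2 + 2 * (cmod (g i))\<^sup>2"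
    using sum_squares_bound[of "cmod (f i)" "cmod (g i)"] by (simp add: power2_sum)
  finally show "norm ((cmod (f i + g i))\<^sup>2) \<le> 2 * (cmod (f i))\<^sup>2 + 2 * (cmod (g i))\<^sup>2" by simp
qed

lemma l2_diff:
  assumes "summable (\<lambda>i. (cmod (f i))\<^sup>2)" "summable (\<lambda>i. (cmod (g i))\<^sup>2)"
  shows "summable (\<lambda>i. (cmod (f i - g i))\<^sup>2)"
  using l2_add[OF assms(1) l2_mult[OF assms(2), of "-1"]] by simp

lemma l2_summable_ip:
  assumes "summable (\<lambda>i. (cmod (f i))\<^sup>2)" "summable (\<lambda>i. (cmod (g i))\<^sup>2)"
  shows "summable (\<lambda>i. f i * cnj (g i))"
proof (rule summable_comparison_test')
  show "summable (\<lambda>i. (cmod (f i))\<^sup>2 + (cmod (g i))\<^sup>2)" using assms by (intro summable_add)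
  fix i
  have "2 * (cmod (f i) * cmod (g i)) \<le> (cmod (f i))\<^sup>2 + (cmod (g i))\<^sup>2"
    using sum_squares_bound[of "cmod (f i)" "cmod (g i)"] by simp
  moreover have "0 \<le> cmod (f i) * cmod (g i)" by simp
  ultimately have "cmod (f i) * cmod (g i) \<le> (cmod (f i))\<^sup>2 + (cmod (g i))\<^sup>2" by linarith
  then show "norm (f i * cnj (g i)) \<le> (cmod (f i))\<^sup>2 + (cmod (g i))\<^sup>2"
    by (simp add: norm_mult)
qed

lemma unit_vec_l2 [simp]: "summable (\<lambda>i. (cmod (unit_vec n i))\<^sup>2)"
  by (rule summable_finite[of "{n}"]) (auto simp: unit_vec_def)

lemma ip_unit_vec: "(\<Sum>i. f i * cnj (unit_vec n i)) = f n"
  by (subst suminf_finite[of "{n}"]) (auto simp: unit_vec_def)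

lemma sqnorm_unit_vec [simp]: "sqnorm (unit_vec n) = 1"
  unfolding sqnorm_def by (subst suminf_finite[of "{n}"]) (auto simp: unit_vec_def)

lemma ip_self: "summable (\<lambda>i. (cmod (f i))\<^sup>2) \<Longrightarrow> (\<Sum>i. f i * cnj (f i)) = of_real (sqnorm f)"
  by (simp add: sqnorm_def complex_norm_square[symmetric] suminf_of_real[symmetric] del: of_real_power)

lemma hnorm_l2: "summable (\<lambda>i. (cmod (f i))\<^sup>2) \<Longrightarrow> hnorm l2 f = sqrt (sqnorm f)"
  by (simp add: hnorm_def ip_self)

lemma sqnorm_nonneg [simp]: "summable (\<lambda>i. (cmod (f i))\<^sup>2) \<Longrightarrow> 0 \<le> sqnorm f"
  unfolding sqnorm_def by (rule suminf_nonneg) auto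

lemma sqnorm_eq_0: "summable (\<lambda>i. (cmod (f i))\<^sup>2) \<Longrightarrow> sqnorm f = 0 \<longleftrightarrow> f = (\<lambda>_. 0)"
  unfolding sqnorm_def by (subst suminf_eq_zero_iff) (auto simp: fun_eq_iff)

text \<open>Minkowski's inequality for the initial segments, in the limit.\<close>

lemma l2_triangle:
  assumes f: "summable (\<lambda>i. (cmod (f i))\<^sup>2)" and g: "summable (\<lambda>i. (cmod (g i))\<^sup>2)"
  shows "sqrt (sqnorm (\<lambda>i. f i + g i)) \<le> sqrt (sqnorm f) + sqrt (sqnorm g)"
proof (rule LIMSEQ_le)
  have lim: "(\<lambda>n. L2_set (\<lambda>i. cmod (h i)) {..<n}) \<longlonglongrightarrow> sqrt (sqnorm h)"
    if "summable (\<lambda>i. (cmod (h i))\<^sup>2)" for h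
    unfolding L2_set_def sqnorm_def by (intro tendsto_real_sqrt summable_LIMSEQ that)
  show "(\<lambda>n. L2_set (\<lambda>i. cmod (f i + g i)) {..<n}) \<longlonglongrightarrow> sqrt (sqnorm (\<lambda>i. f i + g i))"
    by (rule lim[OF l2_add[OF f g]])
  show "(\<lambda>n. L2_set (\<lambda>i. cmod (f i)) {..<n} + L2_set (\<lambda>i. cmod (g i)) {..<n}) \<longlonglongrightarrow>
      sqrt (sqnorm f) + sqrt (sqnorm g)"
    by (intro tendsto_add lim f g)
  have "L2_set (\<lambda>i. cmod (f i + g i)) {..<n} \<le> L2_set (\<lambda>i. cmod (f i)) {..<n} + L2_set (\<lambda>i. cmod (g i)) {..<n}" for n
    by (rule order_trans[OF L2_set_mono L2_set_triangle_ineq]) (auto intro: norm_triangle_ineq)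
  then show "\<exists>N. \<forall>n\<ge>N. L2_set (\<lambda>i. cmod (f i + g i)) {..<n} \<le>
      L2_set (\<lambda>i. cmod (f i)) {..<n} + L2_set (\<lambda>i. cmod (g i)) {..<n}" by blast
qed

lemma module_l2: "Module.module complex_ring l2"
proof -
  have "cring complex_ring"
    by unfold_locales (auto simp: complex_ring_def Units_def algebra_simps intro: exI[of _ "- _"])
  moreover have "abelian_group l2"
  proof (rule abelian_groupI)
    fix x assume "x \<in> carrier l2"
    then show "\<exists>y\<in>carrier l2. y \<oplus>\<^bsub>l2\<^esub> x = \<zero>\<^bsub>l2\<^esub>"
      using l2_mult[of x "-1"] by (intro bexI[of _ "\<lambda>i. - x i"]) auto
  qed (auto simp: l2_add add_ac)
  ultimately show ?thesis
    unfolding module_def module_axioms_def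
    by (auto simp: complex_ring_def l2_mult[simplified norm_mult] l2_mult algebra_simps)
qed

lemma l2_minus:
  assumes "summable (\<lambda>i. (cmod (f i))\<^sup>2)" "summable (\<lambda>i. (cmod (g i))\<^sup>2)"
  shows "f \<ominus>\<^bsub>l2\<^esub> g = (\<lambda>i. f i - g i)"
proof -
  interpret Module.module complex_ring l2 by (rule module_l2)
  have "\<ominus>\<^bsub>l2\<^esub> g = (\<lambda>i. - g i)"
    using assms l2_mult[of g "-1"] by (intro minus_equality) auto
  then show ?thesis by (simp add: a_minus_def)
qed

lemma l2_finsum:
  assumes "\<And>n. summable (\<lambda>i. (cmod (f n i))\<^sup>2)"
  shows "finsum l2 f {..<N :: nat} = (\<lambda>i. \<Sum>n<N. f n i)"
proof (induction N)
  interpret Module.module complex_ring l2 by (rule module_l2)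
  {
    case 0
    show ?case by simp
  next
    case (Suc N)
    have "finsum l2 f (insert N {..<N}) = f N \<oplus>\<^bsub>l2\<^esub> finsum l2 f {..<N}"
      using assms by (intro finsum_insert) auto
    then show ?case using Suc by (simp add: lessThan_Suc fun_eq_iff add.commute)
  }
qed

lemma hdist_l2:
  assumes "summable (\<lambda>i. (cmod (f i))\<^sup>2)" "summable (\<lambda>i. (cmod (g i))\<^sup>2)"
  shows "hdist l2 f g = sqrt (sqnorm (\<lambda>i. f i - g i))"
  using assms by (simp add: hdist_def l2_minus hnorm_l2 l2_diff)

lemma Metric_space_l2: "Metric_space (carrier l2) (hdist l2)"
proof
  fix x y z
  show "0 \<le> hdist l2 x y"
    by (auto simp: hdist_def hnorm_l2 l2_minus l2_diff)
  show "hdist l2 x y = hdist l2 y x"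
    by (auto simp: hdist_def hnorm_l2 l2_minus l2_diff sqnorm_def norm_minus_commute)
  assume xy: "x \<in> carrier l2" "y \<in> carrier l2"
  then show "hdist l2 x y = 0 \<longleftrightarrow> x = y"
    by (simp add: hdist_l2 sqnorm_eq_0 l2_diff) (auto simp: fun_eq_iff)
  assume z: "z \<in> carrier l2"
  show "hdist l2 x z \<le> hdist l2 x y + hdist l2 y z"
    using l2_triangle[of "\<lambda>i. x i - y i" "\<lambda>i. y i - z i"] xy z by (simp add: hdist_l2 l2_diff)
qed

lemma mcomplete_l2: "Metric_space.mcomplete (carrier l2) (hdist l2)"
proof -
  interpret M: Metric_space "carrier l2" "hdist l2" by (rule Metric_space_l2)
  show ?thesis unfolding M.mcomplete_def
  proof (intro allI impI)
    fix \<sigma> assume C: "M.MCauchy \<sigma>"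
    have s: "summable (\<lambda>i. (cmod (\<sigma> n i))\<^sup>2)" for n
    proof -
      have "\<sigma> n \<in> carrier l2" using C unfolding M.MCauchy_def by blast
      then show ?thesis by simp
    qed
    have coord: "cmod (f i) \<le> sqrt (sqnorm f)" if f: "summable (\<lambda>i. (cmod (f i))\<^sup>2)" for f i
    proof -
      have "(\<Sum>i\<in>{i}. (cmod (f i))\<^sup>2) \<le> sqnorm f" unfolding sqnorm_def by (intro sum_le_suminf f) auto
      then show ?thesis by (simp add: real_le_rsqrt)
    qed
    have "Cauchy (\<lambda>n. \<sigma> n i)" for i
    proof (rule metric_CauchyI)
      fix e :: real assume "e > 0"
      then obtain N where N: "\<And>n m. N \<le> n \<Longrightarrow> N \<le> m \<Longrightarrow> hdist l2 (\<sigma> n) (\<sigma> m) < e"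
        using C unfolding M.MCauchy_def by meson
      have "dist (\<sigma> n i) (\<sigma> m i) < e" if "N \<le> n" "N \<le> m" for n m
        using N[OF that] coord[OF l2_diff[OF s[of n] s[of m]], of i] by (simp add: hdist_l2 s dist_norm)
      then show "\<exists>M. \<forall>m\<ge>M. \<forall>n\<ge>M. dist (\<sigma> m i) (\<sigma> n i) < e" by blast
    qed
    then have "\<forall>i. \<exists>x. (\<lambda>n. \<sigma> n i) \<longlonglongrightarrow> x" using Cauchy_convergent convergent_def by blast
    then obtain x where x: "\<And>i. (\<lambda>n. \<sigma> n i) \<longlonglongrightarrow> x i" by metis
    \<comment> \<open>The Cauchy bound on each partial sum survives the limit in \<open>m\<close>;
      as it is uniform in \<open>K\<close>, it gives summability and the norm estimate
      together.\<close>
    have key: "\<exists>N. \<forall>n\<ge>N. summable (\<lambda>i. (cmod (\<sigma> n i - x i))\<^sup>2) \<and> sqrt (sqnorm (\<lambda>i. \<sigma> n i - x i)) \<le> e"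
      if e: "e > 0" for e
    proof -
      obtain N where N: "\<And>n m. N \<le> n \<Longrightarrow> N \<le> m \<Longrightarrow> hdist l2 (\<sigma> n) (\<sigma> m) < e"
        using C e unfolding M.MCauchy_def by meson
      have "summable (\<lambda>i. (cmod (\<sigma> n i - x i))\<^sup>2) \<and> sqrt (sqnorm (\<lambda>i. \<sigma> n i - x i)) \<le> e" if n: "n \<ge> N" for n
      proof -
        have part: "(\<Sum>i<K. (cmod (\<sigma> n i - x i))\<^sup>2) \<le> e\<^sup>2" for K
        proof (rule LIMSEQ_le_const2)
          show "(\<lambda>m. \<Sum>i<K. (cmod (\<sigma> n i - \<sigma> m i))\<^sup>2) \<longlonglongrightarrow> (\<Sum>i<K. (cmod (\<sigma> n i - x i))\<^sup>2)"
            by (intro tendsto_intros x)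
          have "(\<Sum>i<K. (cmod (\<sigma> n i - \<sigma> m i))\<^sup>2) \<le> e\<^sup>2" if "m \<ge> N" for m
          proof -
            have "(\<Sum>i<K. (cmod (\<sigma> n i - \<sigma> m i))\<^sup>2) \<le> sqnorm (\<lambda>i. \<sigma> n i - \<sigma> m i)"
              unfolding sqnorm_def by (intro sum_le_suminf l2_diff s) auto
            moreover have "sqrt (sqnorm (\<lambda>i. \<sigma> n i - \<sigma> m i)) \<le> e"
              using N[OF n that] by (simp add: hdist_l2 s)
            then have "sqnorm (\<lambda>i. \<sigma> n i - \<sigma> m i) \<le> e\<^sup>2" using sqrt_le_D by blast
            ultimately show ?thesis by simp
          qed
          then show "\<exists>N. \<forall>m\<ge>N. (\<Sum>i<K. (cmod (\<sigma> n i - \<sigma> m i))\<^sup>2) \<le> e\<^sup>2" by blast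
        qed
        have sm: "summable (\<lambda>i. (cmod (\<sigma> n i - x i))\<^sup>2)"
          using part by (intro summableI_nonneg_bounded) auto
        have "sqnorm (\<lambda>i. \<sigma> n i - x i) \<le> e\<^sup>2" unfolding sqnorm_def by (rule suminf_le_const[OF sm part])
        then have "sqrt (sqnorm (\<lambda>i. \<sigma> n i - x i)) \<le> e" using e by (simp add: real_le_lsqrt)
        then show ?thesis using sm by simp
      qed
      then show ?thesis by blast
    qed
    obtain N where "\<forall>n\<ge>N. summable (\<lambda>i. (cmod (\<sigma> n i - x i))\<^sup>2) \<and> sqrt (sqnorm (\<lambda>i. \<sigma> n i - x i)) \<le> 1"
      using key[of 1] by auto
    then have "summable (\<lambda>i. (cmod (\<sigma> N i - x i))\<^sup>2)" by blast
    from l2_diff[OF s[of N] this] have xl: "summable (\<lambda>i. (cmod (x i))\<^sup>2)" by simp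
    have "limitin M.mtopology \<sigma> x sequentially"
      unfolding M.limitin_metric
    proof (intro conjI allI impI)
      fix e :: real assume "e > 0"
      then obtain N where N: "\<forall>n\<ge>N. sqrt (sqnorm (\<lambda>i. \<sigma> n i - x i)) \<le> e / 2" using key[of "e/2"] by auto
      then have "\<forall>n\<ge>N. \<sigma> n \<in> carrier l2 \<and> hdist l2 (\<sigma> n) x < e"
        using \<open>e > 0\<close> s xl by (fastforce simp: hdist_l2)
      then show "\<forall>\<^sub>F n in sequentially. \<sigma> n \<in> carrier l2 \<and> hdist l2 (\<sigma> n) x < e"
        unfolding eventually_sequentially by blast
    qed (use xl in simp)
    then show "\<exists>x. limitin M.mtopology \<sigma> x sequentially" by blast
  qed
qed

lemma hilbert_space_l2: "hilbert_space l2"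
  unfolding hilbert_space_def
proof (intro conjI ballI allI impI)
  show "Module.module complex_ring l2" by (rule module_l2)
  show "Metric_space.mcomplete (carrier l2) (hdist l2)" by (rule mcomplete_l2)
  fix u v assume u: "u \<in> carrier l2" and v: "v \<in> carrier l2"
  then show "ip l2 v u = cnj (ip l2 u v)"
    using bounded_linear.suminf[OF bounded_linear_cnj l2_summable_ip, of u v] by (simp add: mult.commute)
  show "ip l2 (a \<odot>\<^bsub>l2\<^esub> u) v = a * ip l2 u v" for a
    using suminf_mult[OF l2_summable_ip, of u v a] u v by (simp add: mult_ac)
  show "0 \<le> Re (ip l2 u u)" "ip l2 u u = 0 \<Longrightarrow> u = \<zero>\<^bsub>l2\<^esub>"
    using u by (simp_all add: ip_self sqnorm_eq_0)
  fix w assume w: "w \<in> carrier l2"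
  show "ip l2 (u \<oplus>\<^bsub>l2\<^esub> v) w = ip l2 u w + ip l2 v w"
    using suminf_add[OF l2_summable_ip l2_summable_ip, of u w v w] u v w by (simp add: algebra_simps)
qed

lemma total_unit_vec: "total_in l2 unit_vec"
  unfolding total_in_def
proof (intro ballI allI impI)
  fix v and e :: real assume v: "v \<in> carrier l2" and e: "e > 0"
  have vs: "summable (\<lambda>i. (cmod (v i))\<^sup>2)" using v by simp
  have "(\<lambda>N. \<Sum>i. (cmod (v (i + N)))\<^sup>2) \<longlonglongrightarrow> 0" by (rule suminf_exist_split2[OF vs])
  then have "\<forall>\<^sub>F N in sequentially. (\<Sum>i. (cmod (v (i + N)))\<^sup>2) < e\<^sup>2" using e by (intro order_tendstoD) auto
  then obtain N where N: "(\<Sum>i. (cmod (v (i + N)))\<^sup>2) < e\<^sup>2" unfolding eventually_sequentially by blast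
  define t where "t = (\<lambda>i. if i < N then v i else 0)"
  have ts: "summable (\<lambda>i. (cmod (t i))\<^sup>2)" by (rule summable_finite[of "{..<N}"]) (auto simp: t_def)
  have "finsum l2 (\<lambda>n. v n \<odot>\<^bsub>l2\<^esub> unit_vec n) {..<N} = t"
  proof -
    have "finsum l2 (\<lambda>n. v n \<odot>\<^bsub>l2\<^esub> unit_vec n) {..<N} = (\<lambda>i. \<Sum>n<N. v n * unit_vec n i)"
      unfolding l2_simps by (rule l2_finsum[OF l2_mult[OF unit_vec_l2]])
    also have "\<dots> = t" by (auto simp: t_def unit_vec_def fun_eq_iff if_distrib cong: if_cong)
    finally show ?thesis .
  qed
  moreover have "hdist l2 v t < e"
  proof -
    have "sqnorm (\<lambda>i. v i - t i) = (\<Sum>i. (cmod (v (i + N) - t (i + N)))\<^sup>2) + (\<Sum>i<N. (cmod (v i - t i))\<^sup>2)"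
      unfolding sqnorm_def by (rule suminf_split_initial_segment[OF l2_diff[OF vs ts]])
    also have "\<dots> = (\<Sum>i. (cmod (v (i + N)))\<^sup>2)" by (simp add: t_def)
    finally show ?thesis using N e vs ts by (simp add: hdist_l2 real_less_lsqrt)
  qed
  ultimately show "\<exists>N c. hdist l2 v (\<Oplus>\<^bsub>l2\<^esub>n\<in>{..<N}. c n \<odot>\<^bsub>l2\<^esub> unit_vec n) < e" by metis
qed

section \<open>Isometries of the sequence space\<close>

lemma ip_polarization:
  assumes u: "summable (\<lambda>i. (cmod (u i))\<^sup>2)" and v: "summable (\<lambda>i. (cmod (v i))\<^sup>2)"
  shows "(\<Sum>i. u i * cnj (v i)) = Complex ((sqnorm (\<lambda>i. u i + v i) - sqnorm u - sqnorm v) / 2)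
     ((sqnorm (\<lambda>i. u i + \<i> * v i) - sqnorm u - sqnorm v) / 2)"
proof -
  have *: "sqnorm (\<lambda>i. u i + w i) = sqnorm u + sqnorm w + 2 * Re (\<Sum>i. u i * cnj (w i))"
    if w: "summable (\<lambda>i. (cmod (w i))\<^sup>2)" for w
  proof -
    have sr: "summable (\<lambda>i. Re (u i * cnj (w i)))" using l2_summable_ip[OF u w] by (rule summable_Re)
    have "(cmod (u i + w i))\<^sup>2 = ((cmod (u i))\<^sup>2 + (cmod (w i))\<^sup>2) + 2 * Re (u i * cnj (w i))" for i
      by (simp add: cmod_power2) (simp add: power2_eq_square algebra_simps)
    then have "sqnorm (\<lambda>i. u i + w i) = (\<Sum>i. ((cmod (u i))\<^sup>2 + (cmod (w i))\<^sup>2) + 2 * Re (u i * cnj (w i)))"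
      unfolding sqnorm_def by simp
    also have "\<dots> = (\<Sum>i. (cmod (u i))\<^sup>2 + (cmod (w i))\<^sup>2) + (\<Sum>i. 2 * Re (u i * cnj (w i)))"
      by (intro suminf_add[symmetric] summable_add u w summable_mult sr)
    also have "(\<Sum>i. (cmod (u i))\<^sup>2 + (cmod (w i))\<^sup>2) = sqnorm u + sqnorm w"
      unfolding sqnorm_def by (intro suminf_add[symmetric] u w)
    also have "(\<Sum>i. 2 * Re (u i * cnj (w i))) = 2 * (\<Sum>i. Re (u i * cnj (w i)))" by (rule suminf_mult[OF sr])
    also have "(\<Sum>i. Re (u i * cnj (w i))) = Re (\<Sum>i. u i * cnj (w i))" by (rule Re_suminf[OF l2_summable_ip[OF u w], symmetric])
    finally show ?thesis .
  qed
  have iv: "sqnorm (\<lambda>i. \<i> * v i) = sqnorm v" by (simp add: sqnorm_def norm_mult)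
  have "(\<Sum>i. u i * cnj (\<i> * v i)) = - \<i> * (\<Sum>i. u i * cnj (v i))"
    using suminf_mult[OF l2_summable_ip[OF u v], of "- \<i>"] by (simp add: algebra_simps)
  then show ?thesis using *[OF v] *[OF l2_mult[OF v, of \<i>]] iv by (simp add: complex_eq_iff)
qed

text \<open>By polarization a linear bijection that preserves norms preserves inner products, so
  only energies have to be compared.\<close>

lemma hilbert_iso_l2I:
  assumes bij: "bij_betw T (carrier l2) (carrier l2)"
    and add: "\<And>u v. u \<in> carrier l2 \<Longrightarrow> v \<in> carrier l2 \<Longrightarrow> T (\<lambda>i. u i + v i) = (\<lambda>i. T u i + T v i)"
    and mult: "\<And>a u. u \<in> carrier l2 \<Longrightarrow> T (\<lambda>i. a * u i) = (\<lambda>i. a * T u i)"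
    and isom: "\<And>u. u \<in> carrier l2 \<Longrightarrow> sqnorm (T u) = sqnorm u"
  shows "hilbert_iso l2 l2 T"
  unfolding hilbert_iso_def
proof (intro conjI ballI allI)
  fix u v assume u: "u \<in> carrier l2" and v: "v \<in> carrier l2"
  have Tu: "T u \<in> carrier l2" "T v \<in> carrier l2" using bij u v by (auto dest: bij_betw_apply)
  show "ip l2 (T u) (T v) = ip l2 u v"
    using ip_polarization[of "T u" "T v"] ip_polarization[of u v] Tu u v
      isom[of "\<lambda>i. u i + v i"] isom[of "\<lambda>i. u i + \<i> * v i"] add[of u v] add[of u "\<lambda>i. \<i> * v i"]
      mult[of v \<i>] isom[of u] isom[of v] l2_add[of u v] l2_mult[of v \<i>] l2_add[of u "\<lambda>i. \<i> * v i"]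
    by simp
qed (use bij add mult in simp_all)

text \<open>Norms are computed as integrals over counting measures, which may be reindexed by
  bijections and split over pairs even where they are infinite; this lemma translates the results
  back.\<close>

lemma l2_nn_integral:
  "summable (\<lambda>i. (cmod (f i))\<^sup>2) \<longleftrightarrow> (\<integral>\<^sup>+i. ennreal ((cmod (f i))\<^sup>2) \<partial>count_space UNIV) < \<infinity>"
  "summable (\<lambda>i. (cmod (f i))\<^sup>2) \<Longrightarrow> (\<integral>\<^sup>+i. ennreal ((cmod (f i))\<^sup>2) \<partial>count_space UNIV) = ennreal (sqnorm f)"
proof -
  show 2: "(\<integral>\<^sup>+i. ennreal ((cmod (f i))\<^sup>2) \<partial>count_space UNIV) = ennreal (sqnorm f)"
    if "summable (\<lambda>i. (cmod (f i))\<^sup>2)"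
    unfolding nn_integral_count_space_nat sqnorm_def by (rule suminf_ennreal2[OF _ that]) simp
  show "summable (\<lambda>i. (cmod (f i))\<^sup>2) \<longleftrightarrow> (\<integral>\<^sup>+i. ennreal ((cmod (f i))\<^sup>2) \<partial>count_space UNIV) < \<infinity>"
  proof
    assume "(\<integral>\<^sup>+i. ennreal ((cmod (f i))\<^sup>2) \<partial>count_space UNIV) < \<infinity>"
    then show "summable (\<lambda>i. (cmod (f i))\<^sup>2)"
      unfolding nn_integral_count_space_nat by (intro summable_suminf_not_top) auto
  qed (simp add: 2)
qed

subsection \<open>Borel groupoids\<close>

context borel_groupoid
begin

abbreviation arr :: "'a set" where "arr \<equiv> space (arrows G)"
abbreviation units :: "'a set" where "units \<equiv> {x \<in> arr. rge G x = x}"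

lemma space_unit_space: "space (unit_space G) = units"
  by (auto simp: unit_space_def space_restrict_space)

lemma space_fibre: "space (fibre G x) = {\<gamma> \<in> arr. rge G \<gamma> = x}"
  by (auto simp: fibre_def space_restrict_space)

lemma space_reduction: "space (arrows (reduction G U)) = {\<gamma> \<in> arr. rge G \<gamma> \<in> U \<and> src G \<gamma> \<in> U}"
  by (auto simp: reduction_def space_restrict_space)

lemma rge_unit: "\<gamma> \<in> arr \<Longrightarrow> rge G \<gamma> \<in> units"
  by (simp add: rge_closed rge_rge)

lemma src_unit: "\<gamma> \<in> arr \<Longrightarrow> src G \<gamma> \<in> units"
  by (simp add: src_closed rge_src)

lemma src_of_unit: "x \<in> units \<Longrightarrow> src G x = x"
  using src_rge[of x] by simp

lemma measurable_rge [measurable]: "rge G \<in> arrows G \<rightarrow>\<^sub>M arrows G"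
  using rge_borel unfolding unit_space_def by (simp add: measurable_restrict_space2_iff)

lemma measurable_src [measurable]: "src G \<in> arrows G \<rightarrow>\<^sub>M arrows G"
  using src_borel unfolding unit_space_def by (simp add: measurable_restrict_space2_iff)

text \<open>The set is the preimage of the diagonal, which is Borel because \<open>arrows G\<close>
  is standard.\<close>

lemma sets_eq_graph:
  assumes "f \<in> M \<rightarrow>\<^sub>M arrows G" "g \<in> M \<rightarrow>\<^sub>M arrows G"
  shows "{x \<in> space M. f x = g x} \<in> sets M"
proof -
  have "(\<lambda>x. (f x, g x)) -` {(x, y) \<in> arr \<times> arr. x = y} \<inter> space M \<in> sets M"
    by (rule measurable_sets[OF measurable_Pair[OF assms] standard_borel_diagonal[OF standard]])
  also have "(\<lambda>x. (f x, g x)) -` {(x, y) \<in> arr \<times> arr. x = y} \<inter> space M = {x \<in> space M. f x = g x}"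
    using assms[THEN measurable_space] by auto
  finally show ?thesis .
qed

lemma sets_singleton: "x \<in> arr \<Longrightarrow> {x} \<in> sets (arrows G)"
proof -
  assume "x \<in> arr"
  then have "{y \<in> arr. y = x} = {x}" by auto
  then show ?thesis using sets_eq_graph[OF measurable_ident_sets[OF refl] measurable_const[OF \<open>x \<in> arr\<close>]] by simp
qed

lemma sets_units: "units \<in> sets (arrows G)"
  by (rule sets_eq_graph[OF measurable_rge measurable_ident_sets[OF refl]])

lemma sets_restrict_iff:
  assumes "{x \<in> space M. P x} \<in> sets M"
  shows "S \<in> sets (restrict_space M {x. P x}) \<longleftrightarrow> S \<in> sets M \<and> S \<subseteq> {x \<in> space M. P x}"
proof
  assume "S \<in> sets (restrict_space M {x. P x})"
  then obtain B where B: "S = {x. P x} \<inter> B" "B \<in> sets M" unfolding sets_restrict_space by blast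
  have "B \<subseteq> space M" using B(2) by (rule sets.sets_into_space)
  then have "S = {x \<in> space M. P x} \<inter> B" unfolding B(1) by blast
  then show "S \<in> sets M \<and> S \<subseteq> {x \<in> space M. P x}" using assms B(2) by auto
next
  assume *: "S \<in> sets M \<and> S \<subseteq> {x \<in> space M. P x}"
  then have "S = {x. P x} \<inter> S" by blast
  then show "S \<in> sets (restrict_space M {x. P x})" unfolding sets_restrict_space using * by (intro image_eqI[of _ _ S]) simp_all
qed

lemma sets_unit_space_iff: "S \<in> sets (unit_space G) \<longleftrightarrow> S \<in> sets (arrows G) \<and> S \<subseteq> units"
  unfolding unit_space_def by (rule sets_restrict_iff[OF sets_units])

lemma measurable_unit_space_inclusion [measurable]: "(\<lambda>x. x) \<in> unit_space G \<rightarrow>\<^sub>M arrows G"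
  unfolding unit_space_def by (rule measurable_restrict_space1) simp

lemma sets_fibre_set: "x \<in> units \<Longrightarrow> {\<gamma> \<in> arr. rge G \<gamma> = x} \<in> sets (arrows G)"
  by (rule sets_eq_graph[OF measurable_rge measurable_const]) simp

lemma sets_fibre_iff: "x \<in> units \<Longrightarrow> S \<in> sets (fibre G x) \<longleftrightarrow> S \<in> sets (arrows G) \<and> S \<subseteq> {\<gamma> \<in> arr. rge G \<gamma> = x}"
  unfolding fibre_def by (rule sets_restrict_iff[OF sets_fibre_set])

lemma sets_full: "U \<in> sets (unit_space G) \<Longrightarrow> {\<gamma> \<in> arr. rge G \<gamma> \<in> U \<and> src G \<gamma> \<in> U} \<in> sets (arrows G)"
proof -
  assume "U \<in> sets (unit_space G)"
  then have U: "U \<in> sets (arrows G)" by (simp add: sets_unit_space_iff)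
  have "(rge G -` U \<inter> arr) \<inter> (src G -` U \<inter> arr) \<in> sets (arrows G)"
    by (intro sets.Int measurable_sets[OF measurable_rge U] measurable_sets[OF measurable_src U])
  moreover have "(rge G -` U \<inter> arr) \<inter> (src G -` U \<inter> arr) = {\<gamma> \<in> arr. rge G \<gamma> \<in> U \<and> src G \<gamma> \<in> U}" by auto
  ultimately show ?thesis by simp
qed

lemma measurable_mul_fibre:
  assumes g: "\<gamma> \<in> arr"
  shows "mul G \<gamma> \<in> fibre G (src G \<gamma>) \<rightarrow>\<^sub>M fibre G (rge G \<gamma>)"
proof -
  have "(\<lambda>c. (\<gamma>, c)) \<in> fibre G (src G \<gamma>) \<rightarrow>\<^sub>M
      restrict_space (arrows G \<Otimes>\<^sub>M arrows G) {(\<gamma>, \<gamma>'). src G \<gamma> = rge G \<gamma>'}"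
    using g unfolding fibre_def
    by (intro measurable_restrict_space2 measurable_restrict_space1) (auto simp: space_restrict_space)
  from measurable_compose[OF this mul_borel]
  have "mul G \<gamma> \<in> fibre G (src G \<gamma>) \<rightarrow>\<^sub>M arrows G" by simp
  then show ?thesis unfolding fibre_def[of G "rge G \<gamma>"]
    by (rule measurable_restrict_space2[rotated]) (use g rge_mul in \<open>auto simp: space_fibre\<close>)
qed

lemma mul_ginv_cancel:
  assumes "\<gamma> \<in> arr" "c \<in> arr"
  shows "src G \<gamma> = rge G c \<Longrightarrow> mul G (ginv G \<gamma>) (mul G \<gamma> c) = c"
    and "rge G \<gamma> = rge G c \<Longrightarrow> mul G \<gamma> (mul G (ginv G \<gamma>) c) = c"
proof -
  assume *: "src G \<gamma> = rge G c"
  have "mul G (ginv G \<gamma>) (mul G \<gamma> c) = mul G (mul G (ginv G \<gamma>) \<gamma>) c"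
    using assms * by (intro mul_assoc[symmetric]) (auto simp: ginv_closed src_ginv)
  then show "mul G (ginv G \<gamma>) (mul G \<gamma> c) = c" using assms * by (simp add: ginv_mul mul_rge)
next
  assume *: "rge G \<gamma> = rge G c"
  have "mul G \<gamma> (mul G (ginv G \<gamma>) c) = mul G (mul G \<gamma> (ginv G \<gamma>)) c"
    using assms * by (intro mul_assoc[symmetric]) (auto simp: ginv_closed src_ginv rge_ginv)
  then show "mul G \<gamma> (mul G (ginv G \<gamma>) c) = c" using assms * by (simp add: mul_ginv mul_rge)
qed

lemma mul_left_cancel:
  assumes "\<gamma> \<in> arr" "c \<in> arr" "c' \<in> arr" "src G \<gamma> = rge G c" "src G \<gamma> = rge G c'"
    and "mul G \<gamma> c = mul G \<gamma> c'"
  shows "c = c'"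
proof -
  have "c = mul G (ginv G \<gamma>) (mul G \<gamma> c)" by (rule mul_ginv_cancel(1)[OF assms(1,2,4), symmetric])
  also have "\<dots> = c'" unfolding assms(6) by (rule mul_ginv_cancel(1)[OF assms(1,3,5)])
  finally show ?thesis .
qed

lemma ginv_mul_eq:
  assumes "\<gamma> \<in> arr" "\<gamma>' \<in> arr" "src G \<gamma> = rge G \<gamma>'"
  shows "ginv G (mul G \<gamma> \<gamma>') = mul G (ginv G \<gamma>') (ginv G \<gamma>)"
proof -
  let ?m = "mul G \<gamma> \<gamma>'"
  have m: "?m \<in> arr" "rge G ?m = rge G \<gamma>" "src G ?m = src G \<gamma>'"
    using assms mul_closed rge_mul src_mul by auto
  have i: "ginv G \<gamma>' \<in> arr" "ginv G \<gamma> \<in> arr" "ginv G ?m \<in> arr" using assms m ginv_closed by auto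
  have "mul G ?m (mul G (ginv G \<gamma>') (ginv G \<gamma>)) = mul G \<gamma> (mul G \<gamma>' (mul G (ginv G \<gamma>') (ginv G \<gamma>)))"
    using assms i by (intro mul_assoc) (auto simp: rge_ginv src_ginv mul_closed rge_mul)
  also have "\<dots> = rge G \<gamma>"
    using assms i by (simp add: mul_ginv_cancel rge_ginv mul_ginv)
  also have "\<dots> = mul G ?m (ginv G ?m)" using m by (simp add: mul_ginv)
  finally have "mul G ?m (mul G (ginv G \<gamma>') (ginv G \<gamma>)) = mul G ?m (ginv G ?m)" .
  moreover have "src G ?m = rge G (ginv G ?m)" using m rge_ginv by simp
  moreover have "mul G (ginv G \<gamma>') (ginv G \<gamma>) \<in> arr" "src G ?m = rge G (mul G (ginv G \<gamma>') (ginv G \<gamma>))"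
    using mul_closed[OF i(1,2)] rge_mul[OF i(1,2)] assms m rge_ginv src_ginv by simp_all
  ultimately show ?thesis using mul_left_cancel[OF m(1) _ i(3)] by metis
qed

end

lemma restrict_equiv_AE:
  assumes "equiv_measure M N" shows "(AE x in M. P x) \<longleftrightarrow> (AE x in N. P x)"
  using assms absolutely_continuous_AE[of N M P] absolutely_continuous_AE[of M N P]
  unfolding equiv_measure_def by metis

subsection \<open>Disintegrations of the measure class\<close>

text \<open>Fixes one witness of the invariance axiom. As all measures of a class are equivalent,
  almost-everywhere statements can be tested on \<open>\<nu>\<close> and, for units, on its image
  \<open>\<mu>\<close>.\<close>

locale disintegrated_groupoid = measured_groupoid G C for G :: "'g borel_gpd" and C +
  fixes \<nu> :: "'g measure" and \<kappa> :: "'g \<Rightarrow> 'g measure" and U :: "'g set"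
  assumes \<nu>_in: "\<nu> \<in> C" and \<nu>_prob: "prob_space \<nu>" and dis: "disintegration G \<nu> \<kappa>"
    and U_iness: "inessential G C U"
    and quasi_inv: "\<gamma> \<in> arr \<Longrightarrow> rge G \<gamma> \<in> U \<Longrightarrow> src G \<gamma> \<in> U \<Longrightarrow>
        equiv_measure (translate G \<kappa> \<gamma>) (\<kappa> (rge G \<gamma>))"
begin

definition \<mu> :: "'g measure" where "\<mu> = distr \<nu> (unit_space G) (rge G)"

lemma class_equiv: "\<nu>' \<in> C \<Longrightarrow> equiv_measure \<nu> \<nu>'"
proof -
  assume *: "\<nu>' \<in> C"
  obtain \<nu>\<^sub>0 where \<nu>\<^sub>0: "C = {\<nu>. sigma_finite_measure \<nu> \<and> equiv_measure \<nu>\<^sub>0 \<nu>}"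
    using measure_class unfolding measure_class_def by blast
  have "equiv_measure \<nu>\<^sub>0 \<nu>" "equiv_measure \<nu>\<^sub>0 \<nu>'" using \<nu>_in * \<nu>\<^sub>0 by auto
  then show ?thesis unfolding equiv_measure_def absolutely_continuous_def by auto
qed

lemma sets_\<nu>: "sets \<nu> = sets (arrows G)"
proof -
  obtain \<nu>\<^sub>0 where "sets \<nu>\<^sub>0 = sets (arrows G)" "C = {\<nu>. sigma_finite_measure \<nu> \<and> equiv_measure \<nu>\<^sub>0 \<nu>}"
    using measure_class unfolding measure_class_def by blast
  then show ?thesis using \<nu>_in by (auto simp: equiv_measure_def)
qed

lemma space_\<nu> [simp]: "space \<nu> = arr"
  using sets_eq_imp_space_eq[OF sets_\<nu>] .

lemma measurable_\<nu>: "measurable \<nu> N = measurable (arrows G) N"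
  by (rule measurable_cong_sets[OF sets_\<nu> refl])

lemma rge_\<nu>: "rge G \<in> \<nu> \<rightarrow>\<^sub>M unit_space G"
  unfolding measurable_\<nu> by (rule rge_borel)

lemma sets_\<mu> [simp]: "sets \<mu> = sets (unit_space G)" and space_\<mu> [simp]: "space \<mu> = units"
  by (simp_all add: \<mu>_def space_unit_space)

lemma prob_\<mu>: "prob_space \<mu>"
  unfolding \<mu>_def by (rule prob_space.prob_space_distr[OF \<nu>_prob rge_\<nu>])

lemma AE_class_iff: "AE_class C P \<longleftrightarrow> (AE \<gamma> in \<nu>. P \<gamma>)"
  unfolding AE_class_def using restrict_equiv_AE[OF class_equiv, of _ P] \<nu>_in by blast

lemma distr_rge_equiv:
  assumes "\<nu>' \<in> C"
  shows "equiv_measure \<mu> (distr \<nu>' (unit_space G) (rge G))"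
proof -
  have e: "equiv_measure \<nu> \<nu>'" by (rule class_equiv[OF assms])
  then have s: "sets \<nu>' = sets (arrows G)" using sets_\<nu> by (simp add: equiv_measure_def)
  have "null_sets (distr \<nu>' (unit_space G) (rge G)) = null_sets \<mu>"
  proof -
    have n: "null_sets \<nu> = null_sets \<nu>'" using e by (auto simp: equiv_measure_def absolutely_continuous_def)
    have m: "rge G \<in> \<nu>' \<rightarrow>\<^sub>M unit_space G" unfolding measurable_cong_sets[OF s refl] by (rule rge_borel)
    have sp: "space \<nu>' = arr" using sets_eq_imp_space_eq[OF s] .
    show ?thesis unfolding \<mu>_def
      using n by (auto simp: null_sets_distr_iff[OF m] null_sets_distr_iff[OF rge_\<nu>] sp)
  qed
  then show ?thesis unfolding equiv_measure_def absolutely_continuous_def by (simp add: \<mu>_def)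
qed

lemma unit_class_iff:
  assumes "\<mu>' \<in> unit_class G C" shows "equiv_measure \<mu> \<mu>'"
  using assms distr_rge_equiv unfolding unit_class_def equiv_measure_def absolutely_continuous_def by force

lemma \<mu>_unit_class: "\<mu> \<in> unit_class G C"
proof -
  interpret prob_space \<mu> by (rule prob_\<mu>)
  have "sigma_finite_measure \<mu>" ..
  moreover have "equiv_measure (distr \<nu> (unit_space G) (rge G)) \<mu>"
    unfolding \<mu>_def equiv_measure_def absolutely_continuous_def by simp
  ultimately show ?thesis unfolding unit_class_def using \<nu>_in \<nu>_prob by blast
qed

lemma AE_unit_class_iff: "AE_class (unit_class G C) P \<longleftrightarrow> (AE x in \<mu>. P x)"
  unfolding AE_class_def using restrict_equiv_AE[OF unit_class_iff, of _ P] \<mu>_unit_class by blast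

lemma conull_iff: "conull_units G C S \<longleftrightarrow> (AE x in \<mu>. x \<in> S)"
  unfolding conull_units_def by (rule AE_unit_class_iff)

lemma null_iff: "null_units G C S \<longleftrightarrow> (AE x in \<mu>. x \<notin> S)"
  unfolding null_units_def by (rule AE_unit_class_iff)

lemma AE_rge: "AE x in \<mu>. P x \<Longrightarrow> AE \<gamma> in \<nu>. P (rge G \<gamma>)"
  unfolding \<mu>_def by (rule AE_distrD[OF rge_\<nu>])

lemma AE_ginv:
  assumes "AE \<gamma> in \<nu>. P \<gamma>" shows "AE \<gamma> in \<nu>. P (ginv G \<gamma>)"
proof -
  have "AE \<gamma> in distr \<nu> (arrows G) (ginv G). P \<gamma>"
    using restrict_equiv_AE[OF symmetric[OF \<nu>_in], of P] assms by blast
  then show ?thesis by (rule AE_distrD[rotated]) (simp add: measurable_\<nu> ginv_borel)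
qed

text \<open>Sources are ranges of inverses, and inversion preserves the class of
  \<open>\<nu>\<close>.\<close>

lemma AE_src:
  assumes "AE x in \<mu>. P x" shows "AE \<gamma> in \<nu>. P (src G \<gamma>)"
  using AE_ginv[OF AE_rge[OF assms]] AE_space by eventually_elim (simp add: rge_ginv)

lemma AE_full:
  assumes "AE x in \<mu>. x \<in> S" shows "AE \<gamma> in \<nu>. rge G \<gamma> \<in> S \<and> src G \<gamma> \<in> S"
  using AE_rge[OF assms] AE_src[OF assms] by eventually_elim simp

text \<open>\<open>\<kappa> x\<close> lives on the sigma algebra of the fibre, which varies with
  \<open>x\<close>; pushed forward to all arrows it becomes a kernel into one measurable
  space.\<close>

definition K :: "'g \<Rightarrow> 'g measure" where "K x = distr (\<kappa> x) (arrows G) (\<lambda>\<gamma>. \<gamma>)"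

lemma fibre_probs: "fibre_probs G \<kappa>"
  using dis unfolding disintegration_def by blast

lemma \<kappa>: assumes "x \<in> units" shows "sets (\<kappa> x) = sets (fibre G x)" "prob_space (\<kappa> x)"
  "space (\<kappa> x) = {\<gamma> \<in> arr. rge G \<gamma> = x}" "(\<lambda>\<gamma>. \<gamma>) \<in> \<kappa> x \<rightarrow>\<^sub>M arrows G"
proof -
  show *: "sets (\<kappa> x) = sets (fibre G x)" "prob_space (\<kappa> x)"
    using fibre_probs assms unfolding fibre_probs_def space_unit_space by blast+
  show "space (\<kappa> x) = {\<gamma> \<in> arr. rge G \<gamma> = x}"
    using sets_eq_imp_space_eq[OF *(1)] by (simp add: space_fibre)
  have "(\<lambda>\<gamma>. \<gamma>) \<in> fibre G x \<rightarrow>\<^sub>M arrows G" unfolding fibre_def by (rule measurable_restrict_space1) simp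
  then show "(\<lambda>\<gamma>. \<gamma>) \<in> \<kappa> x \<rightarrow>\<^sub>M arrows G" using measurable_cong_sets[OF *(1) refl] by blast
qed

lemma sets_K [simp]: "sets (K x) = sets (arrows G)" and space_K [simp]: "space (K x) = arr"
  by (simp_all add: K_def)

lemma nn_integral_K:
  assumes "x \<in> units" "f \<in> borel_measurable (arrows G)"
  shows "(\<integral>\<^sup>+\<gamma>. f \<gamma> \<partial>K x) = (\<integral>\<^sup>+\<gamma>. f \<gamma> \<partial>\<kappa> x)"
  unfolding K_def by (rule nn_integral_distr[OF \<kappa>(4)[OF assms(1)]]) (use assms(2) in simp)

lemma emeasure_K:
  assumes "x \<in> units" "B \<in> sets (arrows G)"
  shows "emeasure (K x) B = emeasure (\<kappa> x) (B \<inter> {\<gamma> \<in> arr. rge G \<gamma> = x})"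
  unfolding K_def using \<kappa>[OF assms(1)] assms(2) by (subst emeasure_distr) auto

lemma prob_K: "x \<in> units \<Longrightarrow> prob_space (K x)"
  unfolding K_def by (rule prob_space.prob_space_distr[OF \<kappa>(2) \<kappa>(4)])

lemma measurable_K: "K \<in> unit_space G \<rightarrow>\<^sub>M subprob_algebra (arrows G)"
proof (rule measurable_subprob_algebra)
  fix x assume "x \<in> space (unit_space G)"
  then show "subprob_space (K x)" using prob_K by (simp add: space_unit_space prob_space_imp_subprob_space)
next
  fix B assume B: "B \<in> sets (arrows G)"
  have m: "(\<lambda>x. \<integral>\<^sup>+\<gamma>. indicator B \<gamma> \<partial>\<kappa> x) \<in> borel_measurable (unit_space G)"
    using fibre_probs[unfolded fibre_probs_def, THEN conjunct2, rule_format, of "indicator B"] B by simp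
  have eq: "(\<integral>\<^sup>+\<gamma>. indicator B \<gamma> \<partial>\<kappa> x) = emeasure (K x) B" if "x \<in> space (unit_space G)" for x
    using nn_integral_K[of x "indicator B"] that B by (simp add: space_unit_space)
  show "(\<lambda>x. emeasure (K x) B) \<in> borel_measurable (unit_space G)"
    by (rule measurable_cong[THEN iffD1, OF eq m])
qed simp

lemma disintegrate:
  assumes "B \<in> sets (arrows G)"
  shows "emeasure \<nu> B = (\<integral>\<^sup>+x. emeasure (K x) B \<partial>\<mu>)"
proof -
  have "(\<integral>\<^sup>+\<gamma>. indicator B \<gamma> \<partial>\<nu>) = (\<integral>\<^sup>+x. (\<integral>\<^sup>+\<gamma>. indicator B \<gamma> \<partial>\<kappa> x) \<partial>\<mu>)"
    using dis assms unfolding disintegration_def \<mu>_def by auto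
  also have "\<dots> = (\<integral>\<^sup>+x. emeasure (K x) B \<partial>\<mu>)"
  proof (intro nn_integral_cong)
    fix x assume "x \<in> space \<mu>"
    then show "(\<integral>\<^sup>+\<gamma>. indicator B \<gamma> \<partial>\<kappa> x) = emeasure (K x) B"
      using nn_integral_K[of x "indicator B"] assms by simp
  qed
  finally show ?thesis using assms sets_\<nu> by simp
qed

lemma measurable_K_\<mu>: "B \<in> sets (arrows G) \<Longrightarrow> (\<lambda>x. emeasure (K x) B) \<in> borel_measurable \<mu>"
  using measurable_emeasure_kernel[OF measurable_K, of B] measurable_cong_sets[OF sets_\<mu> refl] by blast

lemma AE_disintegrate:
  assumes "B \<in> sets (arrows G)"
  shows "(AE \<gamma> in \<nu>. \<gamma> \<notin> B) \<longleftrightarrow> (AE x in \<mu>. emeasure (K x) B = 0)"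
proof -
  have "(AE \<gamma> in \<nu>. \<gamma> \<notin> B) \<longleftrightarrow> emeasure \<nu> B = 0"
    using assms sets_\<nu> AE_iff_measurable[of B \<nu> "\<lambda>\<gamma>. \<gamma> \<notin> B"] sets.sets_into_space[OF assms] by auto
  also have "\<dots> \<longleftrightarrow> (AE x in \<mu>. emeasure (K x) B = 0)"
    unfolding disintegrate[OF assms] by (rule nn_integral_0_iff_AE[OF measurable_K_\<mu>[OF assms]])
  finally show ?thesis .
qed

section \<open>Atoms of the fibre measures\<close>

definition w :: "'g \<Rightarrow> ennreal" where "w \<gamma> = emeasure (K (rge G \<gamma>)) {\<gamma>}"

lemma measurable_w [measurable]: "w \<in> borel_measurable (arrows G)"
  unfolding w_def
proof (rule emeasure_measurable_subprob_algebra2)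
  show "(\<lambda>\<gamma>. K (rge G \<gamma>)) \<in> arrows G \<rightarrow>\<^sub>M subprob_algebra (arrows G)"
    by (rule measurable_compose[OF rge_borel measurable_K])
  have "(SIGMA x:arr. {x}) = {(x, y) \<in> arr \<times> arr. x = y}" by auto
  then show "(SIGMA x:arr. {x}) \<in> sets (arrows G \<Otimes>\<^sub>M arrows G)"
    using standard_borel_diagonal[OF standard] by simp
qed

lemma emeasure_K_le_w: "\<gamma> \<in> arr \<Longrightarrow> B \<in> sets (arrows G) \<Longrightarrow> \<gamma> \<in> B \<Longrightarrow> w \<gamma> \<le> emeasure (K (rge G \<gamma>)) B"
  unfolding w_def by (intro emeasure_mono) auto

text \<open>Translation by \<open>\<gamma>\<close> carries the singleton of \<open>c\<close> to that
  of \<open>mul G \<gamma> c\<close>, and equivalent measures have the same null singletons: masses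
  may change, but atoms go to atoms.\<close>

lemma w_mul:
  assumes \<gamma>: "\<gamma> \<in> arr" "rge G \<gamma> \<in> U" "src G \<gamma> \<in> U" and c: "c \<in> arr" "rge G c = src G \<gamma>"
  shows "w (mul G \<gamma> c) > 0 \<longleftrightarrow> w c > 0"
proof -
  let ?m = "mul G \<gamma> c"
  have m: "?m \<in> arr" "rge G ?m = rge G \<gamma>" using mul_closed rge_mul \<gamma> c by auto
  note u = rge_unit[OF \<gamma>(1)] src_unit[OF \<gamma>(1)]
  have s1: "{?m} \<in> sets (fibre G (rge G \<gamma>))" "{c} \<in> sets (fibre G (src G \<gamma>))"
    using sets_fibre_iff[OF u(1)] sets_fibre_iff[OF u(2)] sets_singleton m c by auto
  have "w ?m = emeasure (\<kappa> (rge G \<gamma>)) {?m}"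
    unfolding w_def m(2) using emeasure_K[OF u(1) sets_singleton[OF m(1)]] m by (simp add: Int_insert_left)
  moreover have "w c = emeasure (\<kappa> (src G \<gamma>)) {c}"
    unfolding w_def c(2) using emeasure_K[OF u(2) sets_singleton[OF c(1)]] c by (simp add: Int_insert_left)
  moreover have "emeasure (translate G \<kappa> \<gamma>) {?m} = emeasure (\<kappa> (src G \<gamma>)) {c}"
  proof -
    have "mul G \<gamma> \<in> \<kappa> (src G \<gamma>) \<rightarrow>\<^sub>M fibre G (rge G \<gamma>)"
      using measurable_mul_fibre[OF \<gamma>(1)] measurable_cong_sets[OF \<kappa>(1)[OF u(2)] refl] by blast
    then have "emeasure (translate G \<kappa> \<gamma>) {?m} = emeasure (\<kappa> (src G \<gamma>)) (mul G \<gamma> -` {?m} \<inter> space (\<kappa> (src G \<gamma>)))"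
      unfolding translate_def by (rule emeasure_distr[OF _ s1(1)])
    also have "mul G \<gamma> -` {?m} \<inter> space (\<kappa> (src G \<gamma>)) = {c}"
    proof (intro equalityI subsetI)
      fix d assume "d \<in> mul G \<gamma> -` {?m} \<inter> space (\<kappa> (src G \<gamma>))"
      then have d: "mul G \<gamma> d = ?m" "d \<in> arr" "rge G d = src G \<gamma>" unfolding \<kappa>(3)[OF u(2)] by simp_all
      have "d = c" by (rule mul_left_cancel[OF \<gamma>(1) d(2) c(1) _ _ d(1)]) (use d c in simp_all)
      then show "d \<in> {c}" by simp
    next
      fix d assume "d \<in> {c}"
      then show "d \<in> mul G \<gamma> -` {?m} \<inter> space (\<kappa> (src G \<gamma>))" unfolding \<kappa>(3)[OF u(2)] using c by simp
    qed
    finally show ?thesis .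
  qed
  moreover have "emeasure (translate G \<kappa> \<gamma>) {?m} = 0 \<longleftrightarrow> emeasure (\<kappa> (rge G \<gamma>)) {?m} = 0"
  proof -
    have e: "equiv_measure (translate G \<kappa> \<gamma>) (\<kappa> (rge G \<gamma>))" using quasi_inv \<gamma> by blast
    have "{?m} \<in> sets (translate G \<kappa> \<gamma>)" "{?m} \<in> sets (\<kappa> (rge G \<gamma>))"
      using s1 \<kappa>(1)[OF u(1)] by (simp_all add: translate_def)
    then show ?thesis using e unfolding equiv_measure_def absolutely_continuous_def null_sets_def by blast
  qed
  ultimately show ?thesis by (simp add: zero_less_iff_neq_zero)
qed

text \<open>A measure carried by a countable set is carried by its atoms, so almost every arrow is
  an atom and, by symmetry, so is almost every inverse. Translating the inverse of \<gamma> by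
  \<gamma> gives the unit \<open>rge G \<gamma>\<close>, which is therefore an atom too.\<close>

lemma AE_unit_atom:
  assumes V: "inessential G C V" and cnt: "\<And>x. x \<in> V \<Longrightarrow> countable {\<gamma> \<in> arr. rge G \<gamma> = x \<and> src G \<gamma> \<in> V}"
  shows "AE x in \<mu>. w x > 0"
proof -
  have Vs: "V \<in> sets (unit_space G)" "AE x in \<mu>. x \<in> V" using V conull_iff unfolding inessential_def by auto
  have Us: "AE x in \<mu>. x \<in> U" using U_iness conull_iff unfolding inessential_def by auto
  define B where "B = arr - {\<gamma> \<in> arr. rge G \<gamma> \<in> V \<and> src G \<gamma> \<in> V}"
  have B: "B \<in> sets (arrows G)" unfolding B_def using sets_full[OF Vs(1)] by auto
  have "AE \<gamma> in \<nu>. \<gamma> \<notin> B" using AE_full[OF Vs(2)] by eventually_elim (simp add: B_def)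
  then have "AE x in \<mu>. emeasure (K x) B = 0" unfolding AE_disintegrate[OF B] .
  define Z where "Z = {\<gamma> \<in> arr. w \<gamma> = 0}"
  have Z: "Z \<in> sets (arrows G)" unfolding Z_def by measurable
  have "AE x in \<mu>. emeasure (K x) Z = 0"
    using \<open>AE x in \<mu>. emeasure (K x) B = 0\<close> Vs(2) AE_space
  proof eventually_elim
    case (elim x)
    then have xu: "x \<in> units" by simp
    define F where "F = {\<gamma> \<in> arr. rge G \<gamma> = x \<and> src G \<gamma> \<in> V \<and> w \<gamma> = 0}"
    have "countable F" by (rule countable_subset[OF _ cnt[OF elim(2)]]) (auto simp: F_def)
    moreover have "{\<gamma>} \<in> null_sets (K x)" if "\<gamma> \<in> F" for \<gamma>
      using that sets_singleton by (auto simp: F_def w_def null_sets_def)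
    ultimately have "(\<Union>\<gamma>\<in>F. {\<gamma>}) \<in> null_sets (K x)" by (rule null_sets_UN')
    then have F0: "F \<in> null_sets (K x)" by simp
    have B0: "B \<in> null_sets (K x)" using elim B by (simp add: null_sets_def)
    define N where "N = {\<gamma> \<in> arr. rge G \<gamma> \<noteq> x}"
    have Ns: "N \<in> sets (arrows G)"
    proof -
      have "N = arr - {\<gamma> \<in> arr. rge G \<gamma> = x}" by (auto simp: N_def)
      then show ?thesis using sets_fibre_set[OF xu] by auto
    qed
    have "emeasure (K x) N = 0" 
    proof -
      have "N \<inter> {\<gamma> \<in> arr. rge G \<gamma> = x} = {}" by (auto simp: N_def)
      then show ?thesis unfolding emeasure_K[OF xu Ns] by simp
    qed
    then have N0: "N \<in> null_sets (K x)" using Ns by (simp add: null_sets_def)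
    \<comment> \<open>A non-atom is in the countable set \<open>F\<close>, outside the reduction to
      \<open>V\<close>, or outside the fibre over \<open>x\<close>; each of these sets is
      null.\<close>
    have "Z \<subseteq> F \<union> B \<union> N" by (auto simp: Z_def F_def B_def N_def)
    moreover have "F \<union> B \<union> N \<in> null_sets (K x)" using F0 B0 N0 by blast
    ultimately have "Z \<in> null_sets (K x)" by (rule null_sets_subset[rotated 2]) (simp add: Z)
    then show ?case by (simp add: null_sets_def)
  qed
  then have "AE \<gamma> in \<nu>. \<gamma> \<notin> Z" unfolding AE_disintegrate[OF Z] .
  from AE_ginv[OF this] AE_full[OF Us] AE_space have "AE \<gamma> in \<nu>. w (rge G \<gamma>) > 0"
  proof eventually_elim
    case (elim \<gamma>)
    then have \<gamma>: "\<gamma> \<in> arr" by simp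
    then have "w (ginv G \<gamma>) > 0" using elim ginv_closed by (auto simp: Z_def zero_less_iff_neq_zero)
    then have "w (mul G \<gamma> (ginv G \<gamma>)) > 0" using w_mul[OF \<gamma>, of "ginv G \<gamma>"] elim \<gamma> ginv_closed rge_ginv by auto
    then show ?case using mul_ginv[OF \<gamma>] by simp
  qed
  moreover have "{x \<in> units. w x > 0} \<in> sets (unit_space G)"
  proof -
    have "{x \<in> units. w x > 0} = units \<inter> {x \<in> arr. w x > 0}" by auto
    moreover have "{x \<in> arr. w x > 0} \<in> sets (arrows G)" by measurable
    ultimately show ?thesis unfolding sets_unit_space_iff using sets_units by auto
  qed
  ultimately show ?thesis unfolding \<mu>_def
    by (subst AE_distr_iff[OF rge_\<nu>]) (auto simp: space_unit_space)
qed

end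

subsection \<open>Treed groupoids\<close>

lemma tree_metric_cong:
  assumes "tree_metric V d" "\<And>x y. x \<in> V \<Longrightarrow> y \<in> V \<Longrightarrow> d x y = d' x y"
  shows "tree_metric V d'"
proof -
  interpret tree_metric V d by (rule assms(1))
  note eq = assms(2)[symmetric]
  show ?thesis
  proof
    fix x c assume *: "x \<in> V" "c \<in> V" "c \<noteq> x"
    have "(c' \<in> V \<and> d' c c' = 1 \<and> d' x c = Suc (d' x c')) \<longleftrightarrow> (c' \<in> V \<and> d c c' = 1 \<and> d x c = Suc (d x c'))" for c'
      using eq * by auto
    then show "\<exists>!c'. c' \<in> V \<and> d' c c' = 1 \<and> d' x c = Suc (d' x c')"
      using parent_ex1[OF *] by simp
  qed (simp_all add: eq zero adjacent_neq triangle, simp add: sym)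
qed

locale treed_groupoid = disintegrated_groupoid G C \<nu> \<kappa> U for G :: "'g borel_gpd" and C \<nu> \<kappa> U +
  fixes V :: "'g set" and E :: "'g \<Rightarrow> 'g rel"
  assumes V_iness: "inessential G C V" and V_discrete: "r_discrete_borel (reduction G V)"
    and V_tree: "tree_bundle (reduction G V) E"
begin

definition W :: "'g set" where "W = {\<gamma> \<in> arr. rge G \<gamma> \<in> V \<and> src G \<gamma> \<in> V}"

definition fib :: "'g \<Rightarrow> 'g set" where "fib x = {\<gamma> \<in> W. rge G \<gamma> = x}"

definition WW :: "('g \<times> 'g) set" where "WW = {(a, b) \<in> W \<times> W. rge G a = rge G b}"

text \<open>The bundle controls \<open>path_dist\<close> only on pairs from one fibre of the
  reduction. With the value 0 off \<open>WW\<close> the distance becomes a total function that is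
  Borel on all pairs of arrows.\<close>

definition tdist :: "'g \<Rightarrow> 'g \<Rightarrow> nat" where
  "tdist a b = (if (a, b) \<in> WW then path_dist (E (rge G a)) a b else 0)"

lemma tdist_not_WW: "(a, b) \<notin> WW \<Longrightarrow> tdist a b = 0"
  by (simp add: tdist_def)

lemma V_sets: "V \<in> sets (unit_space G)" "V \<in> sets (arrows G)" "V \<subseteq> units"
  using V_iness sets_unit_space_iff unfolding inessential_def by auto

lemma W_sets: "W \<in> sets (arrows G)"
  unfolding W_def by (rule sets_full[OF V_sets(1)])

lemma W_arr: "\<gamma> \<in> W \<Longrightarrow> \<gamma> \<in> arr" by (simp add: W_def)

lemma unit_in_W: "x \<in> V \<Longrightarrow> x \<in> W"
  using V_sets(3) src_of_unit[of x] by (auto simp: W_def)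

lemma rge_in_V: "\<gamma> \<in> W \<Longrightarrow> rge G \<gamma> \<in> V" "\<gamma> \<in> W \<Longrightarrow> src G \<gamma> \<in> V"
  by (simp_all add: W_def)

lemma V_unit: "x \<in> V \<Longrightarrow> x \<in> arr \<and> rge G x = x \<and> src G x = x"
  using V_sets(3) src_of_unit[of x] by auto

lemma mul_in_W: "\<gamma> \<in> W \<Longrightarrow> c \<in> W \<Longrightarrow> src G \<gamma> = rge G c \<Longrightarrow> mul G \<gamma> c \<in> W"
  by (simp add: W_def mul_closed rge_mul src_mul)

lemma ginv_in_W: "\<gamma> \<in> W \<Longrightarrow> ginv G \<gamma> \<in> W"
  by (simp add: W_def ginv_closed rge_ginv src_ginv)

lemma space_red: "space (arrows (reduction G V)) = W"
  unfolding W_def by (rule space_reduction)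

lemma red_simps: "rge (reduction G V) = rge G" "src (reduction G V) = src G" "mul (reduction G V) = mul G"
  by (simp_all add: reduction_def)

lemma space_red_units: "space (unit_space (reduction G V)) = V"
proof -
  have "space (unit_space (reduction G V)) = {x \<in> W. rge G x = x}"
    by (auto simp: unit_space_def space_restrict_space space_red red_simps)
  also have "\<dots> = V"
  proof (intro equalityI subsetI)
    fix x assume "x \<in> {x \<in> W. rge G x = x}"
    then show "x \<in> V" using rge_in_V(1)[of x] by simp
  qed (use unit_in_W V_unit in simp)
  finally show ?thesis .
qed

lemma space_red_fibre: "space (fibre (reduction G V) x) = fib x"
  by (auto simp: fibre_def space_restrict_space space_red red_simps fib_def)

lemma fib_countable: "x \<in> V \<Longrightarrow> countable (fib x)"
  using V_discrete unfolding r_discrete_borel_def space_red_units space_red_fibre by blast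

lemma fib_WW: "a \<in> fib x \<Longrightarrow> b \<in> fib x \<Longrightarrow> (a, b) \<in> WW"
  by (simp add: fib_def WW_def)

lemma tree: assumes "x \<in> V" shows "tree_metric (fib x) tdist"
proof -
  have "tree_on (fib x) (E x)"
    using V_tree assms unfolding tree_bundle_def space_red_units space_red_fibre by blast
  from tree_on_tree_metric[OF this] show ?thesis
    by (rule tree_metric_cong) (use fib_WW in \<open>auto simp: tdist_def fib_def\<close>)
qed

lemma tdist_translate:
  assumes "\<gamma> \<in> W" "a \<in> fib (src G \<gamma>)" "b \<in> fib (src G \<gamma>)"
  shows "tdist (mul G \<gamma> a) (mul G \<gamma> b) = tdist a b"
proof -
  have ab: "a \<in> W" "b \<in> W" "rge G a = src G \<gamma>" "rge G b = src G \<gamma>" using assms by (auto simp: fib_def)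
  have m: "(mul G \<gamma> a, mul G \<gamma> b) \<in> WW" "rge G (mul G \<gamma> a) = rge G \<gamma>"
    using ab assms(1) by (auto simp: WW_def mul_in_W rge_mul W_arr)
  have "path_dist (E (rge G \<gamma>)) (mul G \<gamma> a) (mul G \<gamma> b) = path_dist (E (src G \<gamma>)) a b"
    using V_tree assms unfolding tree_bundle_def space_red red_simps space_red_fibre by blast
  then show ?thesis using m fib_WW[OF assms(2,3)] ab by (simp add: tdist_def)
qed

lemma WW_sets: "WW \<in> sets (arrows G \<Otimes>\<^sub>M arrows G)"
proof -
  have 1: "{p \<in> space (arrows G \<Otimes>\<^sub>M arrows G). rge G (fst p) = rge G (snd p)} \<in> sets (arrows G \<Otimes>\<^sub>M arrows G)"
    by (rule sets_eq_graph[OF measurable_compose[OF measurable_fst measurable_rge]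
          measurable_compose[OF measurable_snd measurable_rge]])
  have "WW = {p \<in> space (arrows G \<Otimes>\<^sub>M arrows G). rge G (fst p) = rge G (snd p)} \<inter> W \<times> W"
    using W_arr by (auto simp: WW_def space_pair_measure)
  then show ?thesis using 1 W_sets by auto
qed

text \<open>The distance is Borel for the product of the reduction with itself; the identity map of
  \<open>WW\<close> transports this to pairs of arrows of \<open>G\<close>.\<close>

lemma tdist_level_sets: "{p \<in> WW. tdist (fst p) (snd p) = n} \<in> sets (arrows G \<Otimes>\<^sub>M arrows G)"
proof -
  let ?A = "arrows G" and ?R = "arrows (reduction G V)"
  let ?N = "restrict_space (?A \<Otimes>\<^sub>M ?A) WW"
  have sN: "space ?N = WW" using WW_sets by simp
  have sub: "fst p \<in> W \<and> snd p \<in> W \<and> rge G (fst p) = rge G (snd p)" if "p \<in> space ?N" for p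
    using that unfolding sN by (auto simp: WW_def)
  have R: "?R = restrict_space ?A {\<gamma>. rge G \<gamma> \<in> V \<and> src G \<gamma> \<in> V}" by (simp add: reduction_def)
  have "fst \<in> ?N \<rightarrow>\<^sub>M ?R" "snd \<in> ?N \<rightarrow>\<^sub>M ?R" unfolding R
    by (intro measurable_restrict_space2 measurable_restrict_space1 measurable_fst measurable_snd;
        use sub in \<open>auto simp: W_def\<close>)+
  then have "(\<lambda>p. (fst p, snd p)) \<in> ?N \<rightarrow>\<^sub>M ?R \<Otimes>\<^sub>M ?R" by (rule measurable_Pair)
  then have "(\<lambda>p. p) \<in> ?N \<rightarrow>\<^sub>M restrict_space (?R \<Otimes>\<^sub>M ?R) {(\<gamma>, \<gamma>'). rge G \<gamma> = rge G \<gamma>'}"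
    by (intro measurable_restrict_space2) (use sub in auto)
  moreover have "(\<lambda>(\<gamma>, \<gamma>'). path_dist (E (rge G \<gamma>)) \<gamma> \<gamma>') \<in>
      restrict_space (?R \<Otimes>\<^sub>M ?R) {(\<gamma>, \<gamma>'). rge G \<gamma> = rge G \<gamma>'} \<rightarrow>\<^sub>M count_space UNIV"
    using V_tree unfolding tree_bundle_def red_simps by blast
  ultimately have "(\<lambda>p. case p of (\<gamma>, \<gamma>') \<Rightarrow> path_dist (E (rge G \<gamma>)) \<gamma> \<gamma>') \<in> ?N \<rightarrow>\<^sub>M count_space UNIV"
    by (rule measurable_compose)
  then have "(\<lambda>p. case p of (\<gamma>, \<gamma>') \<Rightarrow> path_dist (E (rge G \<gamma>)) \<gamma> \<gamma>') -` {n} \<inter> space ?N \<in> sets ?N"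
    by (rule measurable_sets) simp
  also have "(\<lambda>p. case p of (\<gamma>, \<gamma>') \<Rightarrow> path_dist (E (rge G \<gamma>)) \<gamma> \<gamma>') -` {n} \<inter> space ?N =
     {p \<in> WW. tdist (fst p) (snd p) = n}" unfolding sN by (auto simp: tdist_def)
  finally show ?thesis using WW_sets by (simp add: sets_restrict_space_iff)
qed

lemma measurable_tdist:
  assumes f: "f \<in> M \<rightarrow>\<^sub>M arrows G" and g: "g \<in> M \<rightarrow>\<^sub>M arrows G"
  shows "(\<lambda>x. tdist (f x) (g x)) \<in> M \<rightarrow>\<^sub>M count_space UNIV"
proof -
  have fg: "(\<lambda>x. (f x, g x)) \<in> M \<rightarrow>\<^sub>M arrows G \<Otimes>\<^sub>M arrows G" using f g by (rule measurable_Pair)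
  have "(\<lambda>x. tdist (f x) (g x)) -` {n} \<inter> space M \<in> sets M" for n
  proof -
    have 1: "(\<lambda>x. (f x, g x)) -` {p \<in> WW. tdist (fst p) (snd p) = n} \<inter> space M \<in> sets M"
      by (rule measurable_sets[OF fg tdist_level_sets])
    have 2: "(\<lambda>x. (f x, g x)) -` WW \<inter> space M \<in> sets M"
      by (rule measurable_sets[OF fg WW_sets])
    have "(\<lambda>x. tdist (f x) (g x)) -` {n} \<inter> space M =
      ((\<lambda>x. (f x, g x)) -` {p \<in> WW. tdist (fst p) (snd p) = n} \<inter> space M) \<union>
      (if n = 0 then space M - ((\<lambda>x. (f x, g x)) -` WW \<inter> space M) else {})" (is "?L = ?R")
    proof (rule Set.set_eqI)
      fix x
      show "x \<in> ?L \<longleftrightarrow> x \<in> ?R"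
        by (cases "(f x, g x) \<in> WW") (auto simp: tdist_not_WW)
    qed
    then show ?thesis using 1 2 by auto
  qed
  then show ?thesis by (subst measurable_count_space_eq2_countable) auto
qed

section \<open>The Borel parent map\<close>

definition P :: "'g \<Rightarrow> 'g" where
  "P c = (if c \<in> W then parent (fib (rge G c)) tdist (rge G c) c else c)"

definition depth :: "'g \<Rightarrow> nat" where "depth c = tdist (rge G c) c"

lemma P_fib: "c \<in> fib x \<Longrightarrow> P c = parent (fib x) tdist x c"
  by (auto simp: P_def fib_def)

lemma depth_fib: "c \<in> fib x \<Longrightarrow> depth c = tdist x c"
  by (auto simp: depth_def fib_def)

lemma root_fib: "x \<in> V \<Longrightarrow> x \<in> fib x"
  using unit_in_W V_unit by (simp add: fib_def)

lemma fib_self: "c \<in> W \<Longrightarrow> c \<in> fib (rge G c)"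
  by (simp add: fib_def)

lemma P_in_fib: "x \<in> V \<Longrightarrow> c \<in> fib x \<Longrightarrow> P c \<in> fib x"
  using tree_metric.par_in[OF tree root_fib] P_fib by metis

lemma P_pow_fib: "x \<in> V \<Longrightarrow> c \<in> fib x \<Longrightarrow> (P ^^ n) c \<in> fib x \<and> (P ^^ n) c = (parent (fib x) tdist x ^^ n) c"
proof (induction n)
  case (Suc n)
  then have IH: "(P ^^ n) c \<in> fib x" "(P ^^ n) c = (parent (fib x) tdist x ^^ n) c" by blast+
  show ?case using P_in_fib[OF Suc.prems(1) IH(1)] P_fib[OF IH(1)] by (simp add: IH(2)[symmetric])
qed simp

lemma P_root: "x \<in> V \<Longrightarrow> P x = x"
  using P_fib[OF root_fib] by (simp add: parent_def)

lemma P_arr: "c \<in> arr \<Longrightarrow> P c \<in> arr \<and> rge G (P c) = rge G c"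
proof (cases "c \<in> W")
  case True
  then have "P c \<in> fib (rge G c)" by (intro P_in_fib fib_self rge_in_V(1))
  then show ?thesis by (simp add: fib_def W_arr)
qed (simp add: P_def)

lemma measurable_depth [measurable]: "depth \<in> arrows G \<rightarrow>\<^sub>M count_space UNIV"
  unfolding depth_def by (rule measurable_tdist[OF measurable_rge measurable_ident_sets[OF refl]])

text \<open>Describes the graph by conditions that are Borel in the pair, which is the form that
  \<open>measurable_graph\<close> asks for: the parent is recognized as the neighbour one step
  closer to the unit, without selecting it from a list.\<close>

lemma P_graph:
  assumes "c \<in> arr" "c' \<in> arr"
  shows "c' = P c \<longleftrightarrow> (c \<notin> W \<and> c' = c) \<or> (c \<in> W \<and> rge G c = c \<and> c' = c) \<or>
     ((c, c') \<in> WW \<and> tdist c c' = 1 \<and> tdist (rge G c) c = Suc (tdist (rge G c) c'))"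
proof (cases "c \<in> W")
  case False
  then show ?thesis by (auto simp: P_def WW_def)
next
  case True
  define x where "x = rge G c"
  have x: "x \<in> V" "c \<in> fib x" using True rge_in_V(1) fib_self by (auto simp: x_def)
  interpret T: tree_metric "fib x" tdist by (rule tree[OF x(1)])
  note r = root_fib[OF x(1)]
  have WWiff: "(c, c') \<in> WW \<longleftrightarrow> c' \<in> fib x" using True by (auto simp: WW_def fib_def x_def)
  show ?thesis
  proof (cases "c = x")
    case cx: True
    have "tdist (rge G c) c = 0" using T.zero[OF r r] cx V_unit[OF x(1)] by simp
    moreover have "rge G c = c" "P c = c" using cx P_root[OF x(1)] V_unit[OF x(1)] by simp_all
    ultimately show ?thesis using True by simp
  next
    case False
    have "c' = P c \<longleftrightarrow> c' \<in> fib x \<and> tdist c c' = 1 \<and> tdist x c = Suc (tdist x c')"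
      unfolding P_fib[OF x(2)]
    proof
      assume "c' = T.par x c"
      then show "c' \<in> fib x \<and> tdist c c' = 1 \<and> tdist x c = Suc (tdist x c')"
        using T.par[OF r x(2) False] by simp
    next
      assume "c' \<in> fib x \<and> tdist c c' = 1 \<and> tdist x c = Suc (tdist x c')"
      then show "c' = T.par x c" using T.par_eqI[OF r x(2), of c'] by simp
    qed
    then show ?thesis using False True WWiff by (auto simp: x_def)
  qed
qed

lemma measurable_P [measurable]: "P \<in> arrows G \<rightarrow>\<^sub>M arrows G"
proof (rule measurable_graph[OF standard standard])
  let ?AA = "arrows G \<Otimes>\<^sub>M arrows G"
  have diag: "{p \<in> space ?AA. snd p = fst p} \<in> sets ?AA"
    by (rule sets_eq_graph[OF measurable_snd measurable_fst])
  have unitW: "{p \<in> space ?AA. rge G (fst p) = fst p} \<in> sets ?AA"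
    by (rule sets_eq_graph[OF measurable_compose[OF measurable_fst measurable_rge] measurable_fst])
  have "W \<times> arr \<in> sets ?AA" using W_sets by auto
  moreover have "{p \<in> space ?AA. tdist (rge G (fst p)) (fst p) = Suc (tdist (rge G (fst p)) (snd p))} \<in> sets ?AA"
  proof -
    let ?f = "\<lambda>p. tdist (rge G (fst p)) (fst p)" and ?g = "\<lambda>p. tdist (rge G (fst p)) (snd p)"
    have fg: "?f \<in> ?AA \<rightarrow>\<^sub>M count_space UNIV" "?g \<in> ?AA \<rightarrow>\<^sub>M count_space UNIV"
      by (intro measurable_tdist measurable_compose[OF measurable_fst measurable_rge] measurable_fst measurable_snd)+
    have "{p \<in> space ?AA. ?f p = Suc (?g p)} =
      (\<Union>n. (?f -` {Suc n} \<inter> space ?AA) \<inter> (?g -` {n} \<inter> space ?AA))" by auto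
    also have "\<dots> \<in> sets ?AA"
      by (intro sets.countable_UN sets.Int image_subsetI measurable_sets[OF fg(1)] measurable_sets[OF fg(2)]) simp_all
    finally show ?thesis .
  qed
  \<comment> \<open>The three pieces of the graph: arrows outside \<open>W\<close>, units of
    \<open>V\<close>, and arrows with a parent other than themselves.\<close>
  ultimately have "(({p \<in> space ?AA. snd p = fst p} - W \<times> arr) \<union>
    ({p \<in> space ?AA. snd p = fst p} \<inter> {p \<in> space ?AA. rge G (fst p) = fst p} \<inter> W \<times> arr)) \<union>
    ({p \<in> WW. tdist (fst p) (snd p) = 1} \<inter>
     {p \<in> space ?AA. tdist (rge G (fst p)) (fst p) = Suc (tdist (rge G (fst p)) (snd p))}) \<in> sets ?AA"
    using diag unitW tdist_level_sets[of 1] by (intro sets.Un sets.Int sets.Diff)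
  moreover have "(({p \<in> space ?AA. snd p = fst p} - W \<times> arr) \<union>
    ({p \<in> space ?AA. snd p = fst p} \<inter> {p \<in> space ?AA. rge G (fst p) = fst p} \<inter> W \<times> arr)) \<union>
    ({p \<in> WW. tdist (fst p) (snd p) = 1} \<inter>
     {p \<in> space ?AA. tdist (rge G (fst p)) (fst p) = Suc (tdist (rge G (fst p)) (snd p))}) =
     {(c, c') \<in> arr \<times> arr. c' = P c}" (is "?L = ?R")
  proof (rule Set.set_eqI)
    fix p :: "'g \<times> 'g"
    obtain c c' where p: "p = (c, c')" by (cases p)
    show "p \<in> ?L \<longleftrightarrow> p \<in> ?R"
    proof (cases "c \<in> arr \<and> c' \<in> arr")
      case True
      then show ?thesis unfolding p using P_graph[of c c'] by (simp add: space_pair_measure) blast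
    next
      case False
      then show ?thesis unfolding p using W_arr by (auto simp: space_pair_measure WW_def)
    qed
  qed
  ultimately show "{(c, c') \<in> arr \<times> arr. c' = P c} \<in> sets ?AA" by (simp only:)
qed (use P_arr in blast)

lemma measurable_P_pow [measurable]: "P ^^ n \<in> arrows G \<rightarrow>\<^sub>M arrows G"
proof (induction n)
  case 0
  show ?case by (simp add: id_def)
next
  case (Suc n)
  show ?case using measurable_comp[OF Suc measurable_P] by simp
qed

definition X :: "'g set" where "X = {x \<in> V \<inter> U. 0 < w x}"

lemma X_V: "x \<in> X \<Longrightarrow> x \<in> V" "x \<in> X \<Longrightarrow> x \<in> U" "x \<in> X \<Longrightarrow> 0 < w x"
  by (auto simp: X_def)

lemma X_sets: "X \<in> sets (unit_space G)"
proof -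
  have "U \<in> sets (arrows G)" using U_iness sets_unit_space_iff unfolding inessential_def by auto
  moreover have "{x \<in> arr. 0 < w x} \<in> sets (arrows G)" by measurable
  moreover have "X = V \<inter> U \<inter> {x \<in> arr. 0 < w x}" using V_unit by (auto simp: X_def)
  ultimately show ?thesis unfolding sets_unit_space_iff using V_sets by auto
qed

text \<open>Three almost-everywhere properties meet on \<open>X\<close>: the fibre of the reduction
  is a tree, arrows between units of \<open>X\<close> respect the classes of the fibre measures, and
  the unit is an atom. The last property is where the countability of the fibres enters.\<close>

lemma X_conull: "AE x in \<mu>. x \<in> X"
proof -
  have "countable {\<gamma> \<in> arr. rge G \<gamma> = x \<and> src G \<gamma> \<in> V}" if "x \<in> V" for x
    by (rule countable_subset[OF _ fib_countable[OF that]]) (use that in \<open>auto simp: fib_def W_def\<close>)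
  from AE_unit_atom[OF V_iness this] have "AE x in \<mu>. 0 < w x" .
  moreover have "AE x in \<mu>. x \<in> V" "AE x in \<mu>. x \<in> U"
    using V_iness U_iness conull_iff unfolding inessential_def by auto
  ultimately show ?thesis by eventually_elim (simp add: X_def)
qed

definition atoms :: "'g \<Rightarrow> 'g set" where "atoms x = {c \<in> fib x. 0 < w c}"

text \<open>For \<open>x\<close> in \<open>X\<close> the root is an atom, and this is the convex
  hull of the atoms. Vertices of the hull that are not atoms are reached from atoms by the Borel map
  \<open>P\<close>, so the hull has a Borel enumeration if the atoms have one.\<close>

definition T :: "'g \<Rightarrow> 'g set" where "T x = {(P ^^ n) c | n c. c \<in> atoms x}"

lemma root_atoms: "x \<in> X \<Longrightarrow> x \<in> atoms x"
  using root_fib X_V by (simp add: atoms_def)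

lemma atoms_T: "atoms x \<subseteq> T x"
proof
  fix c assume "c \<in> atoms x"
  then have "(P ^^ 0) c \<in> T x" unfolding T_def by blast
  then show "c \<in> T x" by simp
qed

lemma root_T: "x \<in> X \<Longrightarrow> x \<in> T x"
  using root_atoms atoms_T by blast

lemma P_T: "c \<in> T x \<Longrightarrow> P c \<in> T x"
proof -
  assume "c \<in> T x"
  then obtain n c' where "c = (P ^^ n) c'" "c' \<in> atoms x" unfolding T_def by blast
  then have "P c = (P ^^ Suc n) c'" "c' \<in> atoms x" by simp_all
  then show ?thesis unfolding T_def by blast
qed

lemma T_fib: "x \<in> V \<Longrightarrow> T x \<subseteq> fib x"
  using P_pow_fib by (auto simp: T_def atoms_def)

lemma T_par: "x \<in> V \<Longrightarrow> c \<in> T x \<Longrightarrow> parent (fib x) tdist x c \<in> T x"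
  using P_T P_fib T_fib by (metis subsetD)

lemma T_alt: "x \<in> V \<Longrightarrow> T x = {(parent (fib x) tdist x ^^ n) c | n c. c \<in> atoms x}"
  unfolding T_def using P_pow_fib by (auto simp: atoms_def) metis+

definition GX :: "'g set" where "GX = {\<gamma> \<in> arr. rge G \<gamma> \<in> X \<and> src G \<gamma> \<in> X}"

lemma GX_W: "\<gamma> \<in> GX \<Longrightarrow> \<gamma> \<in> W"
  by (auto simp: GX_def W_def X_def)

lemma GX_ginv: "\<gamma> \<in> GX \<Longrightarrow> ginv G \<gamma> \<in> GX"
  by (simp add: GX_def ginv_closed rge_ginv src_ginv)

lemma mul_fib: "\<gamma> \<in> W \<Longrightarrow> c \<in> fib (src G \<gamma>) \<Longrightarrow> mul G \<gamma> c \<in> fib (rge G \<gamma>)"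
  by (auto simp: fib_def mul_in_W rge_mul W_arr)

lemma mul_atoms: assumes "\<gamma> \<in> GX" "c \<in> atoms (src G \<gamma>)" shows "mul G \<gamma> c \<in> atoms (rge G \<gamma>)"
proof -
  have \<gamma>: "\<gamma> \<in> arr" "rge G \<gamma> \<in> U" "src G \<gamma> \<in> U" "\<gamma> \<in> W" using assms(1) X_V GX_W by (auto simp: GX_def)
  have c: "c \<in> fib (src G \<gamma>)" "0 < w c" using assms(2) by (auto simp: atoms_def)
  then have "c \<in> arr" "rge G c = src G \<gamma>" using W_arr by (auto simp: fib_def)
  then have "0 < w (mul G \<gamma> c)" using w_mul[OF \<gamma>(1-3)] c by simp
  then show ?thesis using mul_fib[OF \<gamma>(4) c(1)] by (simp add: atoms_def)
qed

text \<open>The arrow is the translate by itself of the unit \<open>src G \<gamma>\<close>, which is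
  an atom. Hence no arrow between units of \<open>X\<close> lies in a null set of its fibre
  measure.\<close>

lemma GX_atoms: assumes "\<gamma> \<in> GX" shows "\<gamma> \<in> atoms (rge G \<gamma>)"
proof -
  have "src G \<gamma> \<in> atoms (src G \<gamma>)" using assms root_atoms by (simp add: GX_def)
  from mul_atoms[OF assms this] show ?thesis using assms mul_src by (simp add: GX_def)
qed

text \<open>Translation is an isometry, but it moves the root \<open>src G \<gamma>\<close> to
  \<open>\<gamma>\<close> and not to the unit \<open>rge G \<gamma>\<close>; this is why changes of
  root matter.\<close>

lemma mul_parent:
  assumes \<gamma>: "\<gamma> \<in> W" and c: "c \<in> fib (src G \<gamma>)"
  shows "mul G \<gamma> (parent (fib (src G \<gamma>)) tdist (src G \<gamma>) c) = parent (fib (rge G \<gamma>)) tdist \<gamma> (mul G \<gamma> c)"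
proof -
  let ?s = "src G \<gamma>"
  have sV: "?s \<in> V" "rge G \<gamma> \<in> V" using \<gamma> rge_in_V by auto
  interpret S: tree_metric "fib ?s" tdist by (rule tree[OF sV(1)])
  interpret R: tree_metric "fib (rge G \<gamma>)" tdist by (rule tree[OF sV(2)])
  note s = root_fib[OF sV(1)]
  have ms: "mul G \<gamma> ?s = \<gamma>" using mul_src \<gamma> W_arr by blast
  show ?thesis
  proof (cases "c = ?s")
    case True
    then show ?thesis using ms by simp
  next
    case False
    note p = S.par[OF s c False]
    show ?thesis
    proof (rule R.par_eqI[symmetric])
      show "\<gamma> \<in> fib (rge G \<gamma>)" using \<gamma> by (rule fib_self)
      show "mul G \<gamma> c \<in> fib (rge G \<gamma>)" "mul G \<gamma> (S.par ?s c) \<in> fib (rge G \<gamma>)"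
        using mul_fib[OF \<gamma>] c p by auto
      show "tdist (mul G \<gamma> c) (mul G \<gamma> (S.par ?s c)) = 1" using tdist_translate[OF \<gamma> c p(1)] p(2) by simp
      show "tdist \<gamma> (mul G \<gamma> c) = Suc (tdist \<gamma> (mul G \<gamma> (S.par ?s c)))"
        using tdist_translate[OF \<gamma> s c] tdist_translate[OF \<gamma> s p(1)] p(3) ms by simp
    qed
  qed
qed

text \<open>Translation leads into the hull rooted at \<open>\<gamma>\<close>. Both
  \<open>\<gamma>\<close> and the unit \<open>rge G \<gamma>\<close> are atoms, so
  \<open>hull_root_change\<close> identifies it with the hull rooted at the unit.\<close>

lemma mul_T:
  assumes \<gamma>: "\<gamma> \<in> GX" and c: "c \<in> T (src G \<gamma>)"
  shows "mul G \<gamma> c \<in> T (rge G \<gamma>)"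
proof -
  let ?s = "src G \<gamma>" and ?r = "rge G \<gamma>"
  have W: "\<gamma> \<in> W" and sV: "?s \<in> V" "?r \<in> V" "?r \<in> X" using \<gamma> GX_W rge_in_V by (auto simp: GX_def)
  interpret R: tree_metric "fib ?r" tdist by (rule tree[OF sV(2)])
  obtain n a where a: "a \<in> atoms ?s" "c = (parent (fib ?s) tdist ?s ^^ n) a"
    using c unfolding T_alt[OF sV(1)] by blast
  have af: "a \<in> fib ?s" using a(1) by (simp add: atoms_def)
  have "mul G \<gamma> ((parent (fib ?s) tdist ?s ^^ n) a) = (R.par \<gamma> ^^ n) (mul G \<gamma> a)"
  proof (induction n)
    case (Suc n)
    have "(parent (fib ?s) tdist ?s ^^ n) a \<in> fib ?s" by (rule tree_metric.par_pow_in[OF tree[OF sV(1)] root_fib[OF sV(1)] af])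
    then show ?case using mul_parent[OF W] Suc by simp
  qed simp
  then have "mul G \<gamma> c \<in> {(R.par \<gamma> ^^ n) c | n c. c \<in> atoms ?r}"
    using a mul_atoms[OF \<gamma> a(1)] by blast
  also have "{(R.par \<gamma> ^^ n) c | n c. c \<in> atoms ?r} = {(R.par ?r ^^ n) c | n c. c \<in> atoms ?r}"
    by (rule R.hull_root_change) (use GX_atoms[OF \<gamma>] root_atoms[OF sV(3)] in \<open>auto simp: atoms_def\<close>)
  finally show ?thesis unfolding T_alt[OF sV(2)] .
qed

lemma GX_T: "\<gamma> \<in> GX \<Longrightarrow> \<gamma> \<in> T (rge G \<gamma>)"
  using GX_atoms atoms_T by blast

lemma T_arr: "x \<in> V \<Longrightarrow> c \<in> T x \<Longrightarrow> c \<in> arr \<and> rge G c = x"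
  using T_fib[of x] W_arr by (auto simp: fib_def)

lemma bij_betw_mul_T: assumes \<gamma>: "\<gamma> \<in> GX" shows "bij_betw (mul G \<gamma>) (T (src G \<gamma>)) (T (rge G \<gamma>))"
proof (rule bij_betw_byWitness[where f' = "mul G (ginv G \<gamma>)"])
  have *: "\<gamma> \<in> arr" "src G \<gamma> \<in> V" "rge G \<gamma> \<in> V" using \<gamma> X_V by (auto simp: GX_def)
  show "\<forall>a\<in>T (src G \<gamma>). mul G (ginv G \<gamma>) (mul G \<gamma> a) = a"
    using T_arr[OF *(2)] mul_ginv_cancel(1)[OF *(1)] by simp
  show "\<forall>a\<in>T (rge G \<gamma>). mul G \<gamma> (mul G (ginv G \<gamma>) a) = a"
    using T_arr[OF *(3)] mul_ginv_cancel(2)[OF *(1)] by simp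
  show "mul G \<gamma> ` T (src G \<gamma>) \<subseteq> T (rge G \<gamma>)" using mul_T[OF \<gamma>] by blast
  show "mul G (ginv G \<gamma>) ` T (rge G \<gamma>) \<subseteq> T (src G \<gamma>)"
    using mul_T[OF GX_ginv[OF \<gamma>]] * by (auto simp: src_ginv rge_ginv)
qed

end

subsection \<open>Borel enumeration of the trees\<close>

lemma measurable_enumerate:
  assumes "\<And>k :: nat. Measurable.pred M (\<lambda>x. k \<in> J x)"
  shows "(\<lambda>x. enumerate (J x) n) \<in> M \<rightarrow>\<^sub>M count_space UNIV"
  using assms
proof (induction n arbitrary: J)
  case 0
  show ?case unfolding enumerate_0 by (rule measurable_Least[OF 0])
next
  case (Suc n)
  have least: "(\<lambda>x. LEAST k. k \<in> J x) \<in> M \<rightarrow>\<^sub>M count_space UNIV" by (rule measurable_Least[OF Suc.prems])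
  have "Measurable.pred M (\<lambda>x. k \<in> J x - {LEAST k. k \<in> J x})" for k
  proof -
    have "Measurable.pred M (\<lambda>x. k \<in> J x \<and> \<not> (LEAST k. k \<in> J x) = k)"
      by (intro pred_intros_logic Suc.prems pred_eq_const1[OF least]) simp_all
    then show ?thesis by (simp add: eq_commute)
  qed
  then show ?case unfolding enumerate_Suc by (rule Suc.IH)
qed

context treed_groupoid
begin

text \<open>The names of atoms are finite words of truth values, each word recording membership in
  an initial segment of the basic sets. In the cell \<open>cyl l\<close> at most one arrow of a
  fibre carries more than half of the mass of the cell, and this arrow gets the name
  \<open>l\<close>. The cells around an atom shrink to it, so their masses tend to its own mass and
  every atom gets a name.\<close>

lemma atoms_enumeration:
  obtains v :: "nat \<Rightarrow> 'g \<Rightarrow> 'g" where "\<forall>m. v m \<in> unit_space G \<rightarrow>\<^sub>M arrows G" "\<forall>x\<in>X. range (\<lambda>m. v m x) = atoms x"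
proof -
  obtain \<B> where \<B>: "souslin_basis (arrows G) \<B>" using standard_borel_souslin_basis[OF standard] by blast
  define Bs where "Bs = from_nat_into (insert {} \<B>)"
  have rB: "range Bs = insert {} \<B>" unfolding Bs_def using souslin_basisD(1)[OF \<B>] by (simp add: range_from_nat_into)
  have Bs: "Bs j \<in> sets (arrows G)" for j
  proof -
    have "Bs j \<in> insert {} \<B>" using rB by (metis rangeI)
    then show ?thesis using souslin_basisD(2)[OF \<B>] by auto
  qed
  have sep: "\<exists>j. (c \<in> Bs j) \<noteq> (c' \<in> Bs j)" if cc: "c \<in> arr" "c' \<in> arr" "c \<noteq> c'" for c c'
  proof -
    obtain S where S: "S \<in> \<B>" "(c \<in> S) \<noteq> (c' \<in> S)" by (rule separatesE[OF souslin_basisD(4)[OF \<B>] cc])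
    then have "S \<in> range Bs" unfolding rB by simp
    then show ?thesis using S by auto
  qed
  define cyl where "cyl l = {c \<in> arr. \<forall>j<length l. (c \<in> Bs j) = l ! j}" for l
  have cyl: "cyl l \<in> sets (arrows G)" for l
  proof -
    have Bs': "(if b then Bs j else arr - Bs j) \<in> sets (arrows G)" for b j using Bs[of j] by simp
    show ?thesis
    proof (cases "l = []")
      case True
      then have "cyl l = arr" by (simp add: cyl_def)
      then show ?thesis by simp
    next
      case False
      have "(\<Inter>j\<in>{..<length l}. if l ! j then Bs j else arr - Bs j) \<in> sets (arrows G)"
        by (rule sets.finite_INT) (use False Bs' in auto)
      moreover have "cyl l = arr \<inter> (\<Inter>j\<in>{..<length l}. if l ! j then Bs j else arr - Bs j)"
        by (auto simp: cyl_def split: if_splits)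
      ultimately show ?thesis by (simp only: sets.Int[OF sets.top])
    qed
  qed
  define D where "D l = {c \<in> W. emeasure (K (rge G c)) (cyl l) < 2 * w c} \<inter> cyl l" for l
  have D: "D l \<in> sets (arrows G)" for l
  proof -
    have [measurable]: "(\<lambda>c. emeasure (K (rge G c)) (cyl l)) \<in> borel_measurable (arrows G)"
      using measurable_compose[OF rge_borel measurable_emeasure_kernel[OF measurable_K cyl]] .
    have "{c \<in> arr. emeasure (K (rge G c)) (cyl l) < 2 * w c} \<in> sets (arrows G)" by measurable
    moreover have "D l = W \<inter> {c \<in> arr. emeasure (K (rge G c)) (cyl l) < 2 * w c} \<inter> cyl l"
      using W_arr by (auto simp: D_def)
    ultimately show ?thesis using cyl W_sets by auto
  qed
  have D_pos: "0 < w c" if "c \<in> D l" for c l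
    using that by (cases "w c = 0") (auto simp: D_def zero_less_iff_neq_zero)
  have D_unique: "c = c'" if c: "c \<in> D l" "c' \<in> D l" "rge G c = rge G c'" for c c' l
  proof (rule ccontr)
    assume ne: "c \<noteq> c'"
    have ca: "c \<in> arr" "c' \<in> arr" using c W_arr by (auto simp: D_def)
    have "w c + w c' = emeasure (K (rge G c)) {c, c'}"
      unfolding w_def c(3)[symmetric] using ne sets_singleton ca
      by (subst plus_emeasure) (auto simp: insert_commute)
    also have "\<dots> \<le> emeasure (K (rge G c)) (cyl l)" using c cyl by (intro emeasure_mono) (auto simp: D_def)
    finally have le: "w c + w c' \<le> emeasure (K (rge G c)) (cyl l)" .
    have lt: "emeasure (K (rge G c)) (cyl l) < w c + w c" "emeasure (K (rge G c)) (cyl l) < w c' + w c'"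
      using c by (auto simp: D_def mult_2)
    show False
    proof (cases "w c \<le> w c'")
      case True
      then have "w c + w c \<le> w c + w c'" by (intro add_left_mono)
      then show False using le lt by (metis leD order_trans)
    next
      case False
      then have "w c' + w c' \<le> w c + w c'" by (intro add_right_mono) simp
      then show False using le lt by (metis leD order_trans)
    qed
  qed
  \<comment> \<open>Elements of \<open>D l\<close> are atoms, so the presence of one in a fibre
    amounts to the positivity of a fibre measure: a Borel condition on \<open>x\<close> obtained
    without a projection.\<close>
  have KD: "0 < emeasure (K x) (D l \<inter> B) \<longleftrightarrow> (\<exists>c\<in>D l \<inter> B. rge G c = x)"
    if x: "x \<in> units" and B: "B \<in> sets (arrows G)" for x l B
  proof
    assume "\<exists>c\<in>D l \<inter> B. rge G c = x"
    then obtain c where c: "c \<in> D l" "c \<in> B" "rge G c = x" by blast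
    then have "c \<in> arr" using W_arr by (auto simp: D_def)
    then have "w c \<le> emeasure (K x) (D l \<inter> B)" using emeasure_K_le_w[of c "D l \<inter> B"] c D B by auto
    then show "0 < emeasure (K x) (D l \<inter> B)" using D_pos[OF c(1)] by simp
  next
    assume pos: "0 < emeasure (K x) (D l \<inter> B)"
    show "\<exists>c\<in>D l \<inter> B. rge G c = x"
    proof (rule ccontr)
      assume "\<not> ?thesis"
      then have "D l \<inter> B \<inter> {\<gamma> \<in> arr. rge G \<gamma> = x} = {}" by blast
      then show False using pos emeasure_K[OF x, of "D l \<inter> B"] D B by simp
    qed
  qed
  \<comment> \<open>On \<open>X\<close> the default \<open>x\<close> is harmless, being an atom
    itself.\<close>
  define v where "v l x = (if x \<in> X \<and> (\<exists>c\<in>D l. rge G c = x) then THE c. c \<in> D l \<and> rge G c = x else x)" for l x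
  have v_eq: "v l x = c" if "x \<in> X" "c \<in> D l" "rge G c = x" for l x c
  proof -
    have "(THE c. c \<in> D l \<and> rge G c = x) = c"
    proof (rule the_equality)
      show "c \<in> D l \<and> rge G c = x" using that by simp
      show "c' = c" if "c' \<in> D l \<and> rge G c' = x" for c'
        using D_unique[of c' l c] that \<open>c \<in> D l\<close> \<open>rge G c = x\<close> by simp
    qed
    then show ?thesis using that by (auto simp: v_def)
  qed
  have v_other: "v l x = x" if "\<not> (x \<in> X \<and> (\<exists>c\<in>D l. rge G c = x))" for l x
    unfolding v_def using that by (rule if_not_P)
  have X_units: "x \<in> units" if "x \<in> X" for x using X_V(1)[OF that] V_unit by simp
  have v_arr: "v l x \<in> arr" if "x \<in> units" for l x
  proof (cases "x \<in> X \<and> (\<exists>c\<in>D l. rge G c = x)")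
    case True
    then obtain c where "c \<in> D l" "rge G c = x" "v l x = c" using v_eq by blast
    then show ?thesis using W_arr by (auto simp: D_def)
  next
    case False
    then show ?thesis using v_other that by simp
  qed
  have v_meas: "v l \<in> unit_space G \<rightarrow>\<^sub>M arrows G" for l
  proof (rule measurableI)
    show "x \<in> space (unit_space G) \<Longrightarrow> v l x \<in> arr" for x using v_arr space_unit_space by blast
    fix B assume B: "B \<in> sets (arrows G)"
    have mK: "{x \<in> units. 0 < emeasure (K x) B'} \<in> sets (unit_space G)" if "B' \<in> sets (arrows G)" for B'
    proof -
      have [measurable]: "(\<lambda>x. emeasure (K x) B') \<in> borel_measurable (unit_space G)"
        by (rule measurable_emeasure_kernel[OF measurable_K that])
      have "{x \<in> space (unit_space G). 0 < emeasure (K x) B'} \<in> sets (unit_space G)" by measurable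
      then show ?thesis by (simp only: space_unit_space)
    qed
    have "v l -` B \<inter> space (unit_space G) =
      (X \<inter> {x \<in> units. 0 < emeasure (K x) (D l \<inter> B)}) \<union>
      ((units \<inter> B) - (X \<inter> {x \<in> units. 0 < emeasure (K x) (D l \<inter> arr)}))" (is "?L = ?R")
    proof (rule Set.set_eqI)
      fix x
      show "x \<in> ?L \<longleftrightarrow> x \<in> ?R"
      proof (cases "x \<in> units")
        case True
        note 1 = KD[OF True B, of l]
        have Darr: "D l \<inter> arr = D l" using W_arr by (auto simp: D_def)
        have 2: "0 < emeasure (K x) (D l) \<longleftrightarrow> (\<exists>c\<in>D l. rge G c = x)"
          using KD[OF True sets.top, of l] unfolding Darr .
        show ?thesis
        proof (cases "x \<in> X \<and> (\<exists>c\<in>D l. rge G c = x)")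
          case t: True
          then obtain c where c: "c \<in> D l" "rge G c = x" "v l x = c" using v_eq by blast
          have "(\<exists>c\<in>D l \<inter> B. rge G c = x) \<longleftrightarrow> c \<in> B"
          proof
            assume "\<exists>c\<in>D l \<inter> B. rge G c = x"
            then obtain c' where "c' \<in> D l" "c' \<in> B" "rge G c' = x" by blast
            then show "c \<in> B" using D_unique[of c' l c] c by simp
          qed (use c in blast)
          then have p: "0 < emeasure (K x) (D l \<inter> B) \<longleftrightarrow> c \<in> B" using 1 by simp
          have q: "0 < emeasure (K x) (D l \<inter> arr)" unfolding Darr 2 using c by blast
          show ?thesis unfolding space_unit_space using True t c(3) p q by simp
        next
          case False
          then have p: "\<not> (x \<in> X \<and> 0 < emeasure (K x) (D l \<inter> B))" unfolding 1 by blast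
          have q: "\<not> (x \<in> X \<and> 0 < emeasure (K x) (D l \<inter> arr))" unfolding Darr 2 using False .
          show ?thesis unfolding space_unit_space using True p q v_other[OF False] by auto
        qed
      next
        case False
        then show ?thesis unfolding space_unit_space using X_units by blast
      qed
    qed
    also have "\<dots> \<in> sets (unit_space G)"
    proof -
      have "units \<inter> B \<in> sets (unit_space G)" using B sets_units by (simp add: sets_unit_space_iff)
      moreover have "D l \<inter> B \<in> sets (arrows G)" "D l \<inter> arr \<in> sets (arrows G)" using D B by auto
      ultimately show ?thesis by (intro sets.Un sets.Diff sets.Int[OF X_sets mK])
    qed
    finally show "v l -` B \<inter> space (unit_space G) \<in> sets (unit_space G)" .
  qed
  have ran: "range (\<lambda>m. v (from_nat m) x) = atoms x" if x: "x \<in> X" for x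
  proof (intro equalityI subsetI)
    fix c assume "c \<in> range (\<lambda>m. v (from_nat m) x)"
    then obtain l where l: "c = v l x" by auto
    show "c \<in> atoms x"
    proof (cases "\<exists>c\<in>D l. rge G c = x")
      case True
      then obtain c' where "c' \<in> D l" "rge G c' = x" "v l x = c'" using v_eq[OF x] by blast
      then show ?thesis using l D_pos by (auto simp: atoms_def fib_def D_def)
    next
      case False
      then have "v l x = x" using v_other by blast
      then show ?thesis using l root_atoms[OF x] by simp
    qed
  next
    fix c assume "c \<in> atoms x"
    then have c: "c \<in> W" "rge G c = x" "0 < w c" "c \<in> arr" using W_arr by (auto simp: atoms_def fib_def)
    interpret prob_space "K x" by (rule prob_K[OF X_units[OF x]])
    define l where "l k = map (\<lambda>j. c \<in> Bs j) [0..<k]" for k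
    have lc: "cyl (l k) = {c' \<in> arr. \<forall>j<k. (c' \<in> Bs j) = (c \<in> Bs j)}" for k by (auto simp: cyl_def l_def)
    \<comment> \<open>Continuity from above along the cells around \<open>c\<close>; their
      intersection is a singleton because the basic sets separate points.\<close>
    have "(\<lambda>k. emeasure (K x) (cyl (l k))) \<longlonglongrightarrow> emeasure (K x) (\<Inter>k. cyl (l k))"
    proof (rule Lim_emeasure_decseq)
      show "decseq (\<lambda>k. cyl (l k))" unfolding lc decseq_def by auto
      show "range (\<lambda>k. cyl (l k)) \<subseteq> sets (K x)" using cyl by auto
    qed simp
    moreover have "(\<Inter>k. cyl (l k)) = {c}"
    proof (intro equalityI subsetI)
      fix c' assume c': "c' \<in> (\<Inter>k. cyl (l k))"
      show "c' \<in> {c}"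
      proof (rule ccontr)
        assume "c' \<notin> {c}"
        moreover have "c' \<in> arr" using c' by (auto simp: lc)
        ultimately obtain j where j: "(c' \<in> Bs j) \<noteq> (c \<in> Bs j)" using sep[of c' c] c by auto
        have "c' \<in> cyl (l (Suc j))" using c' by blast
        then show False using j unfolding lc by auto
      qed
    qed (use c in \<open>auto simp: lc\<close>)
    moreover have "emeasure (K x) {c} < 2 * w c"
    proof -
      have wc: "emeasure (K x) {c} = w c" using c by (simp add: w_def)
      have "w c \<noteq> \<infinity>" unfolding wc[symmetric] by simp
      then have "w c + 0 < w c + w c" using c(3) by (intro ennreal_add_left_cancel_less[THEN iffD2]) auto
      then show ?thesis unfolding wc by (simp add: mult_2)
    qed
    ultimately have "\<forall>\<^sub>F k in sequentially. emeasure (K x) (cyl (l k)) < 2 * w c"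
      by (intro order_tendstoD(2)) auto
    then obtain k where k: "emeasure (K x) (cyl (l k)) < 2 * w c" unfolding eventually_sequentially by blast
    have "c \<in> D (l k)" using c k by (auto simp: D_def lc)
    then have "v (l k) x = c" using v_eq[OF x] c by blast
    then have "v (from_nat (to_nat (l k))) x = c" by simp
    then show "c \<in> range (\<lambda>m. v (from_nat m) x)" by blast
  qed
  show ?thesis by (rule that[of "\<lambda>m. v (from_nat m)"]) (use v_meas ran in auto)
qed

lemma T_enumeration:
  obtains t :: "nat \<Rightarrow> 'g \<Rightarrow> 'g" where "\<forall>n. t n \<in> unit_space G \<rightarrow>\<^sub>M arrows G" "\<forall>x. t 0 x = x"
    "\<forall>x\<in>X. range (\<lambda>n. t n x) = T x"
proof -
  obtain v :: "nat \<Rightarrow> 'g \<Rightarrow> 'g" where v: "\<forall>m. v m \<in> unit_space G \<rightarrow>\<^sub>M arrows G" "\<forall>x\<in>X. range (\<lambda>m. v m x) = atoms x"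
    by (rule atoms_enumeration)
  define s where "s n x = (P ^^ snd (prod_decode n)) (v (fst (prod_decode n)) x)" for n x
  \<comment> \<open>Index 0 is reserved for the root, however the atoms are enumerated.\<close>
  define t where "t n = (case n of 0 \<Rightarrow> \<lambda>x. x | Suc n \<Rightarrow> s n)" for n
  have "t n \<in> unit_space G \<rightarrow>\<^sub>M arrows G" for n
  proof (cases n)
    case 0
    then show ?thesis using measurable_unit_space_inclusion by (simp add: t_def)
  next
    case (Suc k)
    have "s k \<in> unit_space G \<rightarrow>\<^sub>M arrows G" unfolding s_def
      by (rule measurable_compose[OF v(1)[rule_format] measurable_P_pow])
    then show ?thesis using Suc by (simp add: t_def)
  qed
  moreover have "range (\<lambda>n. t n x) = T x" if x: "x \<in> X" for x
  proof (intro equalityI subsetI)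
    fix c assume "c \<in> range (\<lambda>n. t n x)"
    then obtain n where n: "c = t n x" by auto
    show "c \<in> T x"
    proof (cases n)
      case 0
      then show ?thesis using n root_T[OF x] by (simp add: t_def)
    next
      case (Suc k)
      have "v (fst (prod_decode k)) x \<in> atoms x" using v(2) x by blast
      then show ?thesis using n Suc unfolding T_def by (auto simp: t_def s_def)
    qed
  next
    fix c assume "c \<in> T x"
    then obtain n a where a: "c = (P ^^ n) a" "a \<in> atoms x" unfolding T_def by blast
    then obtain m where m: "a = v m x" using v(2) x by auto
    have "t (Suc (prod_encode (m, n))) x = c" by (simp add: t_def s_def a m)
    then show "c \<in> range (\<lambda>n. t n x)" by blast
  qed
  moreover have "t 0 x = x" for x by (simp add: t_def)
  ultimately show ?thesis by (intro that[of t]) blast+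
qed

text \<open>Only the first occurrence of each vertex is kept, and the remaining indices are
  renumbered in increasing order. Index 0 survives, so the root keeps number 0; this fixes the
  coordinate of the root vector in the representation.\<close>

lemma T_bijective_enumeration:
  obtains g :: "nat \<Rightarrow> 'g \<Rightarrow> 'g" where "\<forall>n. g n \<in> unit_space G \<rightarrow>\<^sub>M arrows G" "\<forall>x\<in>X. infinite (T x) \<longrightarrow> g 0 x = x"
    "\<forall>x\<in>X. infinite (T x) \<longrightarrow> bij_betw (\<lambda>n. g n x) UNIV (T x)" "{x \<in> X. infinite (T x)} \<in> sets (unit_space G)"
proof -
  obtain t :: "nat \<Rightarrow> 'g \<Rightarrow> 'g" where t: "\<forall>n. t n \<in> unit_space G \<rightarrow>\<^sub>M arrows G" "\<forall>x. t 0 x = x"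
    "\<forall>x\<in>X. range (\<lambda>n. t n x) = T x" by (rule T_enumeration)
  define J where "J x = {n. \<forall>m<n. t m x \<noteq> t n x}" for x
  have J_pred: "Measurable.pred (unit_space G) (\<lambda>x. n \<in> J x)" for n
  proof -
    have "Measurable.pred (unit_space G) (\<lambda>x. t m x = t n x)" for m
      unfolding pred_def by (rule sets_eq_graph[OF t(1)[rule_format] t(1)[rule_format]])
    then have "Measurable.pred (unit_space G) (\<lambda>x. \<forall>m\<in>{..<n}. \<not> t m x = t n x)"
      by (intro pred_intros_finite pred_intros_logic) auto
    moreover have "(\<lambda>x. n \<in> J x) = (\<lambda>x. \<forall>m\<in>{..<n}. \<not> t m x = t n x)" by (auto simp: J_def fun_eq_iff)
    ultimately show ?thesis by (simp only:)
  qed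
  define g where "g n x = t (enumerate (J x) n) x" for n x
  have g_meas: "g n \<in> unit_space G \<rightarrow>\<^sub>M arrows G" for n
    unfolding g_def by (rule measurable_compose_countable[OF t(1)[rule_format] measurable_enumerate[OF J_pred]])
  have tJ: "bij_betw (\<lambda>n. t n x) (J x) (T x)" if x: "x \<in> X" for x
    unfolding bij_betw_def
  proof
    show "inj_on (\<lambda>n. t n x) (J x)"
    proof (rule inj_onI)
      fix m n assume "m \<in> J x" "n \<in> J x" "t m x = t n x"
      then have "\<not> m < n" "\<not> n < m" by (auto simp: J_def)
      then show "m = n" by simp
    qed
    show "(\<lambda>n. t n x) ` J x = T x"
    proof
      show "(\<lambda>n. t n x) ` J x \<subseteq> T x" using t(3) x by auto
      show "T x \<subseteq> (\<lambda>n. t n x) ` J x"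
      proof
        fix c assume "c \<in> T x"
        then have "c \<in> range (\<lambda>n. t n x)" using t(3) x by simp
        then obtain n where n: "t n x = c" by auto
        define k where "k = (LEAST n. t n x = c)"
        have k: "t k x = c" unfolding k_def by (rule LeastI[of "\<lambda>n. t n x = c", OF n])
        have "t m x \<noteq> c" if "m < k" for m using not_less_Least[OF that[unfolded k_def]] .
        then have "k \<in> J x" using k by (simp add: J_def)
        then show "c \<in> (\<lambda>n. t n x) ` J x" using k by blast
      qed
    qed
  qed
  have inf: "infinite (T x) \<longleftrightarrow> infinite (J x)" if "x \<in> X" for x
    using bij_betw_finite[OF tJ[OF that]] by simp
  have J0: "0 \<in> J x" for x by (simp add: J_def)
  have "g 0 x = x" for x
  proof -
    have "(LEAST k. k \<in> J x) = 0" using J0 by (rule Least_eq_0)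
    then show ?thesis by (simp add: g_def enumerate_0 t(2))
  qed
  moreover have "bij_betw (\<lambda>n. g n x) UNIV (T x)" if "x \<in> X" "infinite (T x)" for x
    using bij_betw_trans[OF bij_enumerate tJ[OF that(1)]] inf that by (simp add: g_def comp_def)
  moreover have "{x \<in> X. infinite (T x)} \<in> sets (unit_space G)"
  proof -
    have "Measurable.pred (unit_space G) (\<lambda>x. \<forall>n. \<exists>k. n < k \<and> k \<in> J x)"
      by (intro pred_intros_countable pred_intros_logic J_pred) simp
    then have "{x \<in> space (unit_space G). \<forall>n. \<exists>k. n < k \<and> k \<in> J x} \<in> sets (unit_space G)"
      unfolding pred_def .
    moreover have "{x \<in> X. infinite (T x)} = X \<inter> {x \<in> space (unit_space G). \<forall>n. \<exists>k. n < k \<and> k \<in> J x}"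
      using inf X_V(1) V_sets(3) unfolding space_unit_space by (auto simp: infinite_nat_iff_unbounded)
    ultimately show ?thesis using sets.Int[OF X_sets] by (simp only:)
  qed
  ultimately show ?thesis using g_meas by (intro that[of g]) blast+
qed

end

subsection \<open>The representation\<close>

lemma tint_cong:
  assumes "\<And>i. i < n \<Longrightarrow> u ((p ^^ i) c) = u' ((p ^^ i) c)" "u r = u' r"
  shows "tint l p r n u c = tint l p r n u' c"
  unfolding tint_def using assms by simp

context treed_groupoid
begin

lemma tint_P:
  assumes "x \<in> V" "c \<in> fib x"
  shows "tint l P x n u c = tint l (parent (fib x) tdist x) x n u c"
  unfolding tint_def using P_pow_fib[OF assms] by simp

lemma tdiff_P:
  assumes "c \<in> fib x"
  shows "tdiff l P x f c = tdiff l (parent (fib x) tdist x) x f c"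
  unfolding tdiff_def P_fib[OF assms] ..

lemma tdiff_tint_T:
  assumes l: "0 < l" "l < 1" and x: "x \<in> V" and c: "c \<in> fib x"
  shows "tdiff l P x (\<lambda>c. tint l P x (depth c) u c) c = u c"
proof -
  interpret tree_metric "fib x" tdist by (rule tree[OF x])
  have p: "P c \<in> fib x" by (rule P_in_fib[OF x c])
  have "tdiff l P x (\<lambda>c. tint l P x (depth c) u c) c = tdiff l (par x) x (\<lambda>c. tint l (par x) x (tdist x c) u c) c"
    unfolding tdiff_def P_fib[OF c, symmetric] tint_P[OF x c] tint_P[OF x p] depth_fib[OF c] depth_fib[OF p] ..
  also have "\<dots> = u c" by (rule tdiff_tint[OF l root_fib[OF x] c])
  finally show ?thesis .
qed

lemma tint_tdiff_T:
  assumes l: "0 < l" "l < 1" and x: "x \<in> V" and c: "c \<in> fib x"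
  shows "tint l P x (depth c) (tdiff l P x f) c = f c"
proof -
  interpret tree_metric "fib x" tdist by (rule tree[OF x])
  have "tint l P x (depth c) (tdiff l P x f) c = tint l P x (depth c) (tdiff l (par x) x f) c"
    by (rule tint_cong) (use P_pow_fib[OF x c] tdiff_P root_fib[OF x] in blast)+
  also have "\<dots> = tint l (par x) x (tdist x c) (tdiff l (par x) x f) c"
    unfolding tint_P[OF x c] depth_fib[OF c] ..
  also have "\<dots> = f c" by (rule tint_tdiff[OF l root_fib[OF x] c])
  finally show ?thesis .
qed

text \<open>Translation carries the energy rooted at \<open>src G \<gamma>\<close> to the energy
  rooted at \<open>\<gamma>\<close>; then \<open>energy_root_change\<close> moves the root from
  \<open>\<gamma>\<close> to the unit \<open>rge G \<gamma>\<close>.\<close>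

lemma energy_translate:
  assumes l: "0 < l" "l < 1" and \<gamma>: "\<gamma> \<in> GX"
  shows "(\<integral>\<^sup>+c. ennreal ((cmod (tdiff l P (rge G \<gamma>) (\<lambda>c. f (mul G (ginv G \<gamma>) c)) c))\<^sup>2) \<partial>count_space (T (rge G \<gamma>))) =
    (\<integral>\<^sup>+c. ennreal ((cmod (tdiff l P (src G \<gamma>) f c))\<^sup>2) \<partial>count_space (T (src G \<gamma>)))"
proof -
  let ?r = "rge G \<gamma>" and ?s = "src G \<gamma>" and ?f = "\<lambda>c. f (mul G (ginv G \<gamma>) c)"
  have rs: "?r \<in> X" "?s \<in> X" "?r \<in> V" "?s \<in> V" "\<gamma> \<in> arr" "\<gamma> \<in> W" using \<gamma> X_V GX_W by (auto simp: GX_def)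
  interpret R: tree_metric "fib ?r" tdist by (rule tree[OF rs(3)])
  interpret S: tree_metric "fib ?s" tdist by (rule tree[OF rs(4)])
  have "(\<integral>\<^sup>+c. ennreal ((cmod (tdiff l P ?r ?f c))\<^sup>2) \<partial>count_space (T ?r)) =
      (\<integral>\<^sup>+c. ennreal ((cmod (tdiff l (R.par ?r) ?r ?f c))\<^sup>2) \<partial>count_space (T ?r))"
    by (rule nn_integral_cong) (use T_fib[OF rs(3)] tdiff_P in auto)
  also have "\<dots> = (\<integral>\<^sup>+c. ennreal ((cmod (tdiff l (R.par \<gamma>) \<gamma> ?f c))\<^sup>2) \<partial>count_space (T ?r))"
    by (rule R.energy_root_change[OF l T_fib[OF rs(3)] GX_T[OF \<gamma>] root_T[OF rs(1)] T_par[OF rs(3)], symmetric])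
  also have "\<dots> = (\<integral>\<^sup>+b. ennreal ((cmod (tdiff l (R.par \<gamma>) \<gamma> ?f (mul G \<gamma> b)))\<^sup>2) \<partial>count_space (T ?s))"
    by (rule nn_integral_bij_count_space[OF bij_betw_mul_T[OF \<gamma>], symmetric])
  also have "\<dots> = (\<integral>\<^sup>+c. ennreal ((cmod (tdiff l P ?s f c))\<^sup>2) \<partial>count_space (T ?s))"
  proof (rule nn_integral_cong)
    fix b assume "b \<in> space (count_space (T ?s))"
    then have b: "b \<in> T ?s" "b \<in> fib ?s" using T_fib[OF rs(4)] by auto
    have canc: "mul G (ginv G \<gamma>) (mul G \<gamma> a) = a" if "a \<in> T ?s" for a
      using mul_ginv_cancel(1)[OF rs(5), of a] T_arr[OF rs(4) that] by simp
    have s: "mul G \<gamma> ?s = \<gamma>" using mul_src rs by blast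
    have "mul G \<gamma> b = \<gamma> \<longleftrightarrow> b = ?s"
      using canc[OF b(1)] canc[OF root_T[OF rs(2)]] s by metis
    moreover have "R.par \<gamma> (mul G \<gamma> b) = mul G \<gamma> (P b)"
      unfolding P_fib[OF b(2)] by (rule mul_parent[OF rs(6) b(2), symmetric])
    ultimately have "tdiff l (R.par \<gamma>) \<gamma> ?f (mul G \<gamma> b) = tdiff l P ?s f b"
      unfolding tdiff_def by (simp only: canc[OF b(1)] canc[OF P_T[OF b(1)]])
    then show "ennreal ((cmod (tdiff l (R.par \<gamma>) \<gamma> ?f (mul G \<gamma> b)))\<^sup>2) = ennreal ((cmod (tdiff l P ?s f b))\<^sup>2)"
      by simp
  qed
  finally show ?thesis .
qed

end

text \<open>The case of hulls that are infinite almost everywhere. A Borel field of bijections with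
  the natural numbers identifies their spaces of square summable functions with the single space
  \<open>l2\<close>, so that a constant Hilbert bundle suffices.\<close>

locale enumerated_groupoid = treed_groupoid G C \<nu> \<kappa> U V E
  for G :: "'g borel_gpd" and C \<nu> \<kappa> U V E +
  fixes g :: "nat \<Rightarrow> 'g \<Rightarrow> 'g" and Y :: "'g set"
  assumes g_meas: "g n \<in> unit_space G \<rightarrow>\<^sub>M arrows G"
    and g_0: "x \<in> Y \<Longrightarrow> g 0 x = x"
    and g_bij: "x \<in> Y \<Longrightarrow> bij_betw (\<lambda>n. g n x) UNIV (T x)"
    and Y_X: "Y \<subseteq> X" and Y_sets: "Y \<in> sets (unit_space G)" and Y_conull: "AE x in \<mu>. x \<in> Y"
begin

definition GY :: "'g set" where "GY = {\<gamma> \<in> arr. rge G \<gamma> \<in> Y \<and> src G \<gamma> \<in> Y}"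

definition idx :: "'g \<Rightarrow> 'g \<Rightarrow> nat" where "idx x c = (LEAST n. g n x = c)"

text \<open>A sequence in the open unit interval that tends to 1; with 1 in place of the offset 2
  its first value would be 0.\<close>

definition lam :: "nat \<Rightarrow> real" where "lam k = 1 - 1 / (real k + 2)"

text \<open>The fibre over a unit \<open>x\<close> is the direct sum over \<open>k\<close> of copies of \<open>\<ell>\<^sup>2 (T x)\<close>, the \<open>k\<close>-th copy
  standing for the space of the kernel \<open>lam k ^ d\<close>; both indices are coded into one natural number.\<close>

definition comp :: "nat \<Rightarrow> 'g \<Rightarrow> (nat \<Rightarrow> complex) \<Rightarrow> 'g \<Rightarrow> complex" where
  "comp k x v c = v (prod_encode (k, idx x c))"

text \<open>The \<open>k\<close>-th component as an element of the space of the kernel, that is, as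
  a function on the tree. In this form arrows act by translation.\<close>

definition kfun :: "nat \<Rightarrow> 'g \<Rightarrow> (nat \<Rightarrow> complex) \<Rightarrow> 'g \<Rightarrow> complex" where
  "kfun k x v c = tint (lam k) P x (depth c) (comp k x v) c"

text \<open>Passes from coordinates rooted at the source to functions on the tree, translates them,
  and returns to coordinates rooted at the range. Off \<open>GY\<close> it is the identity, because
  a representation has to give an isomorphism for every arrow.\<close>

definition Lrep :: "'g \<Rightarrow> (nat \<Rightarrow> complex) \<Rightarrow> nat \<Rightarrow> complex" where
  "Lrep \<gamma> v m = (if \<gamma> \<in> GY
     then tdiff (lam (fst (prod_decode m))) P (rge G \<gamma>)
       (\<lambda>c. kfun (fst (prod_decode m)) (src G \<gamma>) v (mul G (ginv G \<gamma>) c)) (g (snd (prod_decode m)) (rge G \<gamma>))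
     else v m)"

lemma lam: "0 < lam k" "lam k < 1"
  by (simp_all add: lam_def field_simps)

lemma lam_lim: "lam \<longlonglongrightarrow> 1"
proof -
  have "(\<lambda>n. 1 / real n) \<longlonglongrightarrow> 0" by (rule lim_1_over_n)
  from LIMSEQ_ignore_initial_segment[OF this, of 2] have "(\<lambda>k. 1 / (real k + 2)) \<longlonglongrightarrow> 0"
    by (simp add: add.commute)
  then have "(\<lambda>k. 1 - 1 / (real k + 2)) \<longlonglongrightarrow> 1 - 0" by (intro tendsto_diff tendsto_const)
  then show ?thesis by (simp add: lam_def[abs_def])
qed

lemma Y_V: "x \<in> Y \<Longrightarrow> x \<in> V" "x \<in> Y \<Longrightarrow> x \<in> X"
  using Y_X X_V by auto

lemma GY_GX: "\<gamma> \<in> GY \<Longrightarrow> \<gamma> \<in> GX"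
  using Y_X by (auto simp: GY_def GX_def)

lemma GYD: assumes "\<gamma> \<in> GY" shows "\<gamma> \<in> arr" "rge G \<gamma> \<in> Y" "src G \<gamma> \<in> Y" "\<gamma> \<in> GX"
  using assms GY_GX by (auto simp: GY_def)

lemma g_T: "x \<in> Y \<Longrightarrow> g n x \<in> T x"
  using g_bij[of x] by (auto simp: bij_betw_def)

lemma idx_g: "x \<in> Y \<Longrightarrow> idx x (g n x) = n"
  using g_bij[of x] unfolding idx_def bij_betw_def by (intro Least_equality) (auto dest: injD)

lemma g_idx: assumes "x \<in> Y" "c \<in> T x" shows "g (idx x c) x = c"
proof -
  have "c \<in> range (\<lambda>n. g n x)" using g_bij[OF assms(1)] assms(2) by (simp add: bij_betw_def)
  then obtain n where "g n x = c" by auto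
  then show ?thesis unfolding idx_def by (rule LeastI)
qed

lemma comp_g: "x \<in> Y \<Longrightarrow> comp k x v (g n x) = v (prod_encode (k, n))"
  by (simp add: comp_def idx_g)

lemma tdiff_kfun: "x \<in> Y \<Longrightarrow> c \<in> T x \<Longrightarrow> tdiff (lam k) P x (kfun k x v) c = comp k x v c"
  unfolding kfun_def[abs_def] using tdiff_tint_T[OF lam Y_V(1)] T_fib[OF Y_V(1)] by blast

lemma comp_Lrep:
  assumes \<gamma>: "\<gamma> \<in> GY" and c: "c \<in> T (rge G \<gamma>)"
  shows "comp k (rge G \<gamma>) (Lrep \<gamma> v) c =
    tdiff (lam k) P (rge G \<gamma>) (\<lambda>c. kfun k (src G \<gamma>) v (mul G (ginv G \<gamma>) c)) c"
  using \<gamma> g_idx[OF GYD(2)[OF \<gamma>] c] by (simp add: comp_def Lrep_def)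

lemma P_pow_T: "c \<in> T x \<Longrightarrow> (P ^^ n) c \<in> T x"
  by (induction n) (simp_all add: P_T)

text \<open>\<open>tint\<close> undoes the \<open>tdiff\<close> in \<open>Lrep\<close>, so in kernel
  form \<open>Lrep\<close> is translation and its multiplicativity is associativity in the groupoid.
  Since \<open>tint\<close> is a finite sum, the identity holds for arbitrary sequences
  \<open>v\<close>.\<close>

lemma kfun_Lrep:
  assumes \<gamma>: "\<gamma> \<in> GY" and c: "c \<in> T (rge G \<gamma>)"
  shows "kfun k (rge G \<gamma>) (Lrep \<gamma> v) c = kfun k (src G \<gamma>) v (mul G (ginv G \<gamma>) c)"
proof -
  note r = GYD(2)[OF \<gamma>]
  have "kfun k (rge G \<gamma>) (Lrep \<gamma> v) c = tint (lam k) P (rge G \<gamma>) (depth c)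
     (tdiff (lam k) P (rge G \<gamma>) (\<lambda>c. kfun k (src G \<gamma>) v (mul G (ginv G \<gamma>) c))) c"
    unfolding kfun_def[of k "rge G \<gamma>"]
    by (rule tint_cong) (use comp_Lrep[OF \<gamma>] P_pow_T[OF c] root_T[OF Y_V(2)[OF r]] in blast)+
  also have "\<dots> = kfun k (src G \<gamma>) v (mul G (ginv G \<gamma>) c)"
    by (rule tint_tdiff_T[OF lam Y_V(1)[OF r]]) (use T_fib[OF Y_V(1)[OF r]] c in blast)
  finally show ?thesis .
qed

lemma tdiff_cong_T:
  assumes "c \<in> T x" "\<And>c. c \<in> T x \<Longrightarrow> f c = f' c"
  shows "tdiff l P x f c = tdiff l P x f' c"
  unfolding tdiff_def using assms(2)[OF assms(1)] assms(2)[OF P_T[OF assms(1)]] by auto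

lemma Lrep_mul:
  assumes \<gamma>: "\<gamma> \<in> GY" and \<gamma>': "\<gamma>' \<in> GY" and comp: "src G \<gamma> = rge G \<gamma>'"
  shows "Lrep (mul G \<gamma> \<gamma>') v = Lrep \<gamma> (Lrep \<gamma>' v)"
proof
  fix m
  note a = GYD[OF \<gamma>] and a' = GYD[OF \<gamma>']
  have m: "mul G \<gamma> \<gamma>' \<in> GY" "rge G (mul G \<gamma> \<gamma>') = rge G \<gamma>" "src G (mul G \<gamma> \<gamma>') = src G \<gamma>'"
    using a a' comp mul_closed rge_mul src_mul by (auto simp: GY_def)
  obtain k n where kn: "prod_decode m = (k, n)" by (cases "prod_decode m")
  have "kfun k (src G \<gamma>') v (mul G (ginv G (mul G \<gamma> \<gamma>')) c) =
     kfun k (src G \<gamma>) (Lrep \<gamma>' v) (mul G (ginv G \<gamma>) c)" if c: "c \<in> T (rge G \<gamma>)" for c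
  proof -
    have ca: "c \<in> arr" "rge G c = rge G \<gamma>" using T_arr[OF Y_V(1)[OF a(2)] c] by auto
    have "mul G (ginv G \<gamma>) c \<in> T (src G \<gamma>)"
      using mul_T[OF GX_ginv[OF a(4)], of c] c a(1) by (simp add: src_ginv rge_ginv)
    then have "kfun k (src G \<gamma>) (Lrep \<gamma>' v) (mul G (ginv G \<gamma>) c) =
      kfun k (src G \<gamma>') v (mul G (ginv G \<gamma>') (mul G (ginv G \<gamma>) c))"
      using kfun_Lrep[OF \<gamma>'] comp by simp
    also have "mul G (ginv G \<gamma>') (mul G (ginv G \<gamma>) c) = mul G (mul G (ginv G \<gamma>') (ginv G \<gamma>)) c"
      using a a' comp ca by (intro mul_assoc[symmetric]) (simp_all add: ginv_closed src_ginv rge_ginv)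
    also have "mul G (ginv G \<gamma>') (ginv G \<gamma>) = ginv G (mul G \<gamma> \<gamma>')"
      by (rule ginv_mul_eq[OF a(1) a'(1) comp, symmetric])
    finally show ?thesis by simp
  qed
  then show "Lrep (mul G \<gamma> \<gamma>') v m = Lrep \<gamma> (Lrep \<gamma>' v) m"
    using m \<gamma> g_T[OF a(2)] unfolding Lrep_def[of "mul G \<gamma> \<gamma>'"] Lrep_def[of \<gamma>]
    by (auto simp: kn intro!: tdiff_cong_T)
qed

lemma Lrep_unit: assumes "x \<in> Y" shows "Lrep x v = v"
proof
  fix m
  have x: "x \<in> arr" "rge G x = x" "src G x = x" using V_unit Y_V(1)[OF assms] by auto
  then have "x \<in> GY" using assms by (simp add: GY_def)
  have gx: "ginv G x = x"
    using mul_rge[OF ginv_closed[OF x(1)]] mul_ginv[OF x(1)] rge_ginv[OF x(1)] x by simp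
  have "kfun k x v (mul G x c) = kfun k x v c" if "c \<in> T x" for k c
    using mul_rge[of c] T_arr[OF Y_V(1)[OF assms] that] by simp
  then have "Lrep x v m = tdiff (lam (fst (prod_decode m))) P x (kfun (fst (prod_decode m)) x v) (g (snd (prod_decode m)) x)"
    using \<open>x \<in> GY\<close> g_T[OF assms] x gx unfolding Lrep_def by (auto intro!: tdiff_cong_T)
  also have "\<dots> = v m" using tdiff_kfun[OF assms g_T[OF assms]] by (simp add: comp_g[OF assms])
  finally show "Lrep x v m = v m" .
qed

lemma Lrep_ginv: assumes "\<gamma> \<in> GY" shows "Lrep (ginv G \<gamma>) (Lrep \<gamma> v) = v" "Lrep \<gamma> (Lrep (ginv G \<gamma>) v) = v"
proof -
  note a = GYD[OF assms]
  have i: "ginv G \<gamma> \<in> GY" using a by (simp add: GY_def ginv_closed rge_ginv src_ginv)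
  show "Lrep (ginv G \<gamma>) (Lrep \<gamma> v) = v"
    using Lrep_mul[OF i assms, of v] a ginv_mul Lrep_unit by (simp add: src_ginv)
  show "Lrep \<gamma> (Lrep (ginv G \<gamma>) v) = v"
    using Lrep_mul[OF assms i, of v] a mul_ginv Lrep_unit by (simp add: rge_ginv)
qed

lemma kfun_add: "kfun k x (\<lambda>i. u i + v i) c = kfun k x u c + kfun k x v c"
  unfolding kfun_def comp_def[abs_def] by (rule tint_add)

lemma kfun_mult: "kfun k x (\<lambda>i. a * v i) c = a * kfun k x v c"
  unfolding kfun_def comp_def[abs_def] by (rule tint_mult)

lemma Lrep_add: "Lrep \<gamma> (\<lambda>i. u i + v i) = (\<lambda>i. Lrep \<gamma> u i + Lrep \<gamma> v i)"
  by (simp add: fun_eq_iff Lrep_def kfun_add tdiff_add)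

lemma Lrep_mult: "Lrep \<gamma> (\<lambda>i. a * v i) = (\<lambda>i. a * Lrep \<gamma> v i)"
  by (simp add: fun_eq_iff Lrep_def kfun_mult tdiff_mult)

text \<open>Sorts the coordinates by the copy \<open>k\<close> and the vertex, through
  \<open>prod_encode\<close> and the enumeration \<open>g\<close>.\<close>

lemma energy_components:
  assumes x: "x \<in> Y"
  shows "(\<integral>\<^sup>+m. ennreal ((cmod (v m))\<^sup>2) \<partial>count_space UNIV) =
    (\<integral>\<^sup>+k. (\<integral>\<^sup>+c. ennreal ((cmod (comp k x v c))\<^sup>2) \<partial>count_space (T x)) \<partial>count_space UNIV)"
proof -
  have b: "bij_betw prod_encode UNIV UNIV" using inj_prod_encode surj_prod_encode by (simp add: bij_betw_def)
  have "(\<integral>\<^sup>+m. ennreal ((cmod (v m))\<^sup>2) \<partial>count_space UNIV) =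
      (\<integral>\<^sup>+p. ennreal ((cmod (v (prod_encode p)))\<^sup>2) \<partial>count_space UNIV)"
    by (rule nn_integral_bij_count_space[OF b, symmetric])
  also have "\<dots> = (\<integral>\<^sup>+k. (\<integral>\<^sup>+n. ennreal ((cmod (v (prod_encode (k, n))))\<^sup>2) \<partial>count_space UNIV) \<partial>count_space UNIV)"
    by (rule nn_integral_fst_count_space[symmetric])
  also have "\<dots> = (\<integral>\<^sup>+k. (\<integral>\<^sup>+n. ennreal ((cmod (comp k x v (g n x)))\<^sup>2) \<partial>count_space UNIV) \<partial>count_space UNIV)"
    by (simp only: comp_g[OF x])
  also have "\<dots> = (\<integral>\<^sup>+k. (\<integral>\<^sup>+c. ennreal ((cmod (comp k x v c))\<^sup>2) \<partial>count_space (T x)) \<partial>count_space UNIV)"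
    by (simp only: nn_integral_bij_count_space[OF g_bij[OF x], where f = "\<lambda>c. ennreal ((cmod (comp _ x v c))\<^sup>2)"])
  finally show ?thesis .
qed

lemma comp_energy_Lrep:
  assumes "\<gamma> \<in> GY"
  shows "(\<integral>\<^sup>+c. ennreal ((cmod (comp k (rge G \<gamma>) (Lrep \<gamma> v) c))\<^sup>2) \<partial>count_space (T (rge G \<gamma>))) =
    (\<integral>\<^sup>+c. ennreal ((cmod (comp k (src G \<gamma>) v c))\<^sup>2) \<partial>count_space (T (src G \<gamma>)))"
proof -
  note a = GYD[OF assms]
  have "(\<integral>\<^sup>+c. ennreal ((cmod (comp k (rge G \<gamma>) (Lrep \<gamma> v) c))\<^sup>2) \<partial>count_space (T (rge G \<gamma>))) =
     (\<integral>\<^sup>+c. ennreal ((cmod (tdiff (lam k) P (rge G \<gamma>) (\<lambda>c. kfun k (src G \<gamma>) v (mul G (ginv G \<gamma>) c)) c))\<^sup>2)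
       \<partial>count_space (T (rge G \<gamma>)))"
    by (rule nn_integral_cong) (use comp_Lrep[OF assms] in simp)
  also have "\<dots> = (\<integral>\<^sup>+c. ennreal ((cmod (tdiff (lam k) P (src G \<gamma>) (kfun k (src G \<gamma>) v) c))\<^sup>2) \<partial>count_space (T (src G \<gamma>)))"
    by (rule energy_translate[OF lam a(4)])
  also have "\<dots> = (\<integral>\<^sup>+c. ennreal ((cmod (comp k (src G \<gamma>) v c))\<^sup>2) \<partial>count_space (T (src G \<gamma>)))"
    by (rule nn_integral_cong) (use tdiff_kfun[OF a(3)] in simp)
  finally show ?thesis .
qed

text \<open>As infinite values are allowed, this shows at once that \<open>l2\<close> is preserved
  and that norms are.\<close>

lemma energy_Lrep:
  "(\<integral>\<^sup>+m. ennreal ((cmod (Lrep \<gamma> v m))\<^sup>2) \<partial>count_space UNIV) = (\<integral>\<^sup>+m. ennreal ((cmod (v m))\<^sup>2) \<partial>count_space UNIV)"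
proof (cases "\<gamma> \<in> GY")
  case True
  show ?thesis
    unfolding energy_components[OF GYD(2)[OF True], of "Lrep \<gamma> v"] energy_components[OF GYD(3)[OF True], of v]
    by (simp only: comp_energy_Lrep[OF True])
qed (simp add: Lrep_def)

lemma Lrep_l2: "summable (\<lambda>i. (cmod (Lrep \<gamma> v i))\<^sup>2) \<longleftrightarrow> summable (\<lambda>i. (cmod (v i))\<^sup>2)"
  unfolding l2_nn_integral(1) energy_Lrep ..

lemma sqnorm_Lrep:
  assumes "summable (\<lambda>i. (cmod (v i))\<^sup>2)" shows "sqnorm (Lrep \<gamma> v) = sqnorm v"
proof -
  have s: "summable (\<lambda>i. (cmod (Lrep \<gamma> v i))\<^sup>2)" using assms Lrep_l2 by blast
  have "ennreal (sqnorm (Lrep \<gamma> v)) = ennreal (sqnorm v)"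
    using energy_Lrep[of \<gamma> v] unfolding l2_nn_integral(2)[OF s] l2_nn_integral(2)[OF assms] .
  then show ?thesis using s assms by simp
qed

lemma hilbert_iso_Lrep: "hilbert_iso l2 l2 (Lrep \<gamma>)"
proof (rule hilbert_iso_l2I)
  show "bij_betw (Lrep \<gamma>) (carrier l2) (carrier l2)"
  proof (cases "\<gamma> \<in> GY")
    case True
    have l2: "Lrep \<delta> v \<in> carrier l2" if "v \<in> carrier l2" for \<delta> v
      using that Lrep_l2 by (simp only: l2_simps)
    show ?thesis
      by (rule bij_betw_byWitness[where f' = "Lrep (ginv G \<gamma>)"]) (use Lrep_ginv[OF True] l2 in auto)
  next
    case False
    then have "Lrep \<gamma> = id" by (simp add: Lrep_def fun_eq_iff)
    then show ?thesis by (simp add: bij_betw_id)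
  qed
qed (use Lrep_add Lrep_mult sqnorm_Lrep in simp_all)

end

subsection \<open>Property T yields finite invariant sets\<close>

text \<open>The only inner product in the expansion is a coordinate of \<open>w\<close>, so almost
  invariance will depend on one matrix coefficient of the representation.\<close>

lemma sqnorm_unit_vec_diff:
  assumes w: "summable (\<lambda>i. (cmod (w i))\<^sup>2)"
  shows "sqnorm (\<lambda>i. unit_vec m i - w i) = 1 + sqnorm w - 2 * Re (w m)"
proof -
  have w': "summable (\<lambda>i. (cmod (- w i))\<^sup>2)" using w by simp
  have "(\<Sum>i. unit_vec m i * cnj (- w i)) = - cnj (w m)"
    by (subst suminf_finite[of "{m}"]) (auto simp: unit_vec_def)
  then have "Re (- cnj (w m)) = (sqnorm (\<lambda>i. unit_vec m i + - w i) - sqnorm (unit_vec m) - sqnorm (\<lambda>i. - w i)) / 2"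
    using ip_polarization[OF unit_vec_l2 w', of m] by simp
  moreover have "sqnorm (\<lambda>i. - w i) = sqnorm w" by (simp add: sqnorm_def)
  ultimately show ?thesis by simp
qed

context borel_groupoid
begin

lemma measurable_mul:
  assumes "f \<in> M \<rightarrow>\<^sub>M arrows G" "h \<in> M \<rightarrow>\<^sub>M arrows G" "\<And>\<omega>. \<omega> \<in> space M \<Longrightarrow> src G (f \<omega>) = rge G (h \<omega>)"
  shows "(\<lambda>\<omega>. mul G (f \<omega>) (h \<omega>)) \<in> M \<rightarrow>\<^sub>M arrows G"
proof -
  have "(\<lambda>\<omega>. (f \<omega>, h \<omega>)) \<in> M \<rightarrow>\<^sub>M restrict_space (arrows G \<Otimes>\<^sub>M arrows G) {(\<gamma>, \<gamma>'). src G \<gamma> = rge G \<gamma>'}"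
    by (rule measurable_restrict_space2[OF _ measurable_Pair[OF assms(1,2)]]) (use assms(3) in auto)
  from measurable_compose[OF this mul_borel] show ?thesis by simp
qed

end

section \<open>Measurability and almost invariance of the representation\<close>

context enumerated_groupoid
begin

lemma measurable_idx:
  assumes "x \<in> M \<rightarrow>\<^sub>M unit_space G" "c \<in> M \<rightarrow>\<^sub>M arrows G"
  shows "(\<lambda>\<omega>. idx (x \<omega>) (c \<omega>)) \<in> M \<rightarrow>\<^sub>M count_space UNIV"
  unfolding idx_def
proof (rule measurable_Least)
  fix n
  show "Measurable.pred M (\<lambda>\<omega>. g n (x \<omega>) = c \<omega>)"
    unfolding pred_def by (rule sets_eq_graph[OF measurable_compose[OF assms(1) g_meas] assms(2)])
qed

text \<open>The index of a vertex and the number of terms in \<open>tint\<close> vary with the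
  point, but both take values in the natural numbers; once they are fixed, finite sums of Borel
  functions remain.\<close>

lemma measurable_kfun:
  assumes x: "x \<in> M \<rightarrow>\<^sub>M unit_space G" and c: "c \<in> M \<rightarrow>\<^sub>M arrows G"
    and v: "\<And>m. (\<lambda>\<omega>. v \<omega> m) \<in> borel_measurable M"
  shows "(\<lambda>\<omega>. kfun k (x \<omega>) (v \<omega>) (c \<omega>)) \<in> borel_measurable M"
proof -
  have comp: "(\<lambda>\<omega>. comp k (x \<omega>) (v \<omega>) (d \<omega>)) \<in> borel_measurable M" if d: "d \<in> M \<rightarrow>\<^sub>M arrows G" for d
    unfolding comp_def by (rule measurable_compose_countable[OF v measurable_idx[OF x d]])
  have xa: "x \<in> M \<rightarrow>\<^sub>M arrows G" using measurable_compose[OF x measurable_unit_space_inclusion] by simp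
  have "(\<lambda>\<omega>. tint (lam k) P (x \<omega>) N (comp k (x \<omega>) (v \<omega>)) (c \<omega>)) \<in> borel_measurable M" for N
    unfolding tint_def
    by (intro borel_measurable_add borel_measurable_sum borel_measurable_times borel_measurable_const
        comp xa measurable_compose[OF c measurable_P_pow])
  then show ?thesis unfolding kfun_def
    by (rule measurable_compose_countable[OF _ measurable_compose[OF c measurable_depth]])
qed

lemma GY_sets: "GY \<in> sets (arrows G)"
  unfolding GY_def by (rule sets_full[OF Y_sets])

lemma measurable_Lrep: "(\<lambda>\<gamma>. Lrep \<gamma> v m) \<in> borel_measurable (arrows G)"
proof -
  obtain k n where kn: "prod_decode m = (k, n)" by (cases "prod_decode m")
  let ?M = "restrict_space (arrows G) GY"
  have sM: "space ?M = GY" using GY_sets by simp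
  have r: "rge G \<in> ?M \<rightarrow>\<^sub>M unit_space G" "src G \<in> ?M \<rightarrow>\<^sub>M unit_space G" "ginv G \<in> ?M \<rightarrow>\<^sub>M arrows G" "rge G \<in> ?M \<rightarrow>\<^sub>M arrows G"
    using measurable_restrict_space1[OF rge_borel] measurable_restrict_space1[OF src_borel]
      measurable_restrict_space1[OF ginv_borel] measurable_restrict_space1[OF measurable_rge] by blast+
  define c where "c \<gamma> = g n (rge G \<gamma>)" for \<gamma>
  have c: "c \<in> ?M \<rightarrow>\<^sub>M arrows G" unfolding c_def by (rule measurable_compose[OF r(1) g_meas])
  have Pc: "(\<lambda>\<gamma>. P (c \<gamma>)) \<in> ?M \<rightarrow>\<^sub>M arrows G" by (rule measurable_compose[OF c measurable_P])
  have cT: "c \<gamma> \<in> T (rge G \<gamma>)" "P (c \<gamma>) \<in> T (rge G \<gamma>)" if "\<gamma> \<in> GY" for \<gamma>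
    using g_T P_T GYD[OF that] by (simp_all add: c_def)
  have srcs: "src G (ginv G \<gamma>) = rge G (c \<gamma>)" "src G (ginv G \<gamma>) = rge G (P (c \<gamma>))" if "\<gamma> \<in> GY" for \<gamma>
    using T_arr[OF Y_V(1)[OF GYD(2)[OF that]]] cT[OF that] src_ginv[OF GYD(1)[OF that]] by simp_all
  define F where "F d \<gamma> = kfun k (src G \<gamma>) v (mul G (ginv G \<gamma>) (d \<gamma>))" for d \<gamma>
  have F: "F c \<in> borel_measurable ?M" "F (\<lambda>\<gamma>. P (c \<gamma>)) \<in> borel_measurable ?M"
    unfolding F_def
    by (intro measurable_kfun r measurable_mul c Pc borel_measurable_const; use srcs sM in simp)+
  have eq: "{\<gamma> \<in> space ?M. c \<gamma> = rge G \<gamma>} \<in> sets ?M" by (rule sets_eq_graph[OF c r(4)])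
  have f: "(\<lambda>\<gamma>. if c \<gamma> = rge G \<gamma> then F c \<gamma> else
      (F c \<gamma> - of_real (lam k) * F (\<lambda>\<gamma>. P (c \<gamma>)) \<gamma>) / of_real (sqrt (1 - (lam k)\<^sup>2))) \<in> borel_measurable ?M"
    by (intro measurable_If eq borel_measurable_divide borel_measurable_diff borel_measurable_times borel_measurable_const F)
  have e: "Lrep \<gamma> v m = (if c \<gamma> = rge G \<gamma> then F c \<gamma> else
      (F c \<gamma> - of_real (lam k) * F (\<lambda>\<gamma>. P (c \<gamma>)) \<gamma>) / of_real (sqrt (1 - (lam k)\<^sup>2)))" if "\<gamma> \<in> space ?M" for \<gamma>
    using that unfolding sM by (simp add: Lrep_def kn tdiff_def F_def c_def)
  have in_GY: "(\<lambda>\<gamma>. Lrep \<gamma> v m) \<in> borel_measurable ?M"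
    by (rule measurable_cong[THEN iffD2, OF e f])
  have "(\<lambda>\<gamma>. if \<gamma> \<in> GY then Lrep \<gamma> v m else v m) \<in> borel_measurable (arrows G)"
  proof (subst measurable_If_restrict_space_iff)
    show "{\<gamma> \<in> arr. \<gamma> \<in> GY} \<in> sets (arrows G)"
      using GY_sets sets.sets_into_space[OF GY_sets] by (simp add: Collect_conj_eq Int_absorb1)
    show "(\<lambda>\<gamma>. Lrep \<gamma> v m) \<in> borel_measurable (restrict_space (arrows G) {\<gamma>. \<gamma> \<in> GY}) \<and>
      (\<lambda>\<gamma>. v m) \<in> borel_measurable (restrict_space (arrows G) {\<gamma>. \<gamma> \<notin> GY})"
      using in_GY by simp
  qed
  moreover have "(\<lambda>\<gamma>. if \<gamma> \<in> GY then Lrep \<gamma> v m else v m) = (\<lambda>\<gamma>. Lrep \<gamma> v m)"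
    by (simp add: fun_eq_iff Lrep_def)
  ultimately show ?thesis by (simp only:)
qed

lemma Y_iness: "inessential G C Y"
  unfolding inessential_def conull_iff using Y_sets Y_conull by blast

lemma representation_Lrep: "representation G C (\<lambda>_. l2) (\<lambda>n _. unit_vec n) Lrep"
  unfolding representation_def
proof (intro conjI)
  show "hilbert_bundle (unit_space G) (\<lambda>_. l2) (\<lambda>n _. unit_vec n)"
    unfolding hilbert_bundle_def using hilbert_space_l2 total_unit_vec by simp
  show "\<forall>\<gamma>\<in>arr. hilbert_iso l2 l2 (Lrep \<gamma>)" using hilbert_iso_Lrep by blast
  show "\<forall>m n. (\<lambda>\<gamma>. ip l2 (Lrep \<gamma> (unit_vec m)) (unit_vec n)) \<in> borel_measurable (arrows G)"
    unfolding l2_simps ip_unit_vec using measurable_Lrep by blast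
  have "Lrep (mul G \<gamma> \<gamma>') v = Lrep \<gamma> (Lrep \<gamma>' v)"
    if "\<gamma> \<in> space (arrows (reduction G Y))" "\<gamma>' \<in> space (arrows (reduction G Y))" "src G \<gamma> = rge G \<gamma>'" for \<gamma> \<gamma>' v
    by (rule Lrep_mul) (use that in \<open>simp_all add: space_reduction GY_def\<close>)
  then show "\<exists>U. inessential G C U \<and> (\<forall>\<gamma>\<in>space (arrows (reduction G U)). \<forall>\<gamma>'\<in>space (arrows (reduction G U)).
      src G \<gamma> = rge G \<gamma>' \<longrightarrow> (\<forall>v\<in>carrier l2. Lrep (mul G \<gamma> \<gamma>') v = Lrep \<gamma> (Lrep \<gamma>' v)))"
    using Y_iness by blast
qed

lemma AE_GY: "AE \<gamma> in \<nu>. \<gamma> \<in> GY"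
  using AE_full[OF Y_conull] AE_space by eventually_elim (simp add: GY_def)

text \<open>In kernel form the root vector at \<open>src G \<gamma>\<close> is \<open>lam k\<close>
  to the power of the distance from that root. Its translate is evaluated at the unit
  \<open>rge G \<gamma>\<close>, which means evaluating it at the inverse of
  \<open>\<gamma>\<close>; and the coordinate at a root is the plain value there, since
  \<open>tdiff\<close> leaves it unchanged.\<close>

lemma Lrep_coefficient:
  assumes "\<gamma> \<in> GY" and m_def: "m = prod_encode (k, 0)"
  shows "Lrep \<gamma> (unit_vec m) m = of_real (lam k ^ depth (ginv G \<gamma>))"
proof -
  note a = GYD[OF assms(1)]
  let ?s = "src G \<gamma>" and ?c = "ginv G \<gamma>"
  note sV = Y_V(1)[OF a(3)]
  have cT: "?c \<in> T ?s" using GX_T[OF GX_ginv[OF a(4)]] rge_ginv[OF a(1)] by simp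
  have cf: "?c \<in> fib ?s" using cT T_fib[OF sV] by blast
  interpret S: tree_metric "fib ?s" tdist by (rule tree[OF sV])
  note s = root_fib[OF sV]
  have "Lrep \<gamma> (unit_vec m) m = kfun k ?s (unit_vec m) (mul G ?c (rge G \<gamma>))"
    using assms g_0[OF a(2)] by (simp add: Lrep_def tdiff_def)
  also have "mul G ?c (rge G \<gamma>) = ?c" using mul_src[OF ginv_closed[OF a(1)]] src_ginv[OF a(1)] by simp
  also have "kfun k ?s (unit_vec m) ?c = of_real (lam k ^ depth ?c)"
  proof -
    have cmp: "comp k ?s (unit_vec m) b = (if b = ?s then 1 else 0)" if "b \<in> T ?s" for b
    proof -
      have "idx ?s b = 0 \<longleftrightarrow> b = ?s" using idx_g[OF a(3), of 0] g_idx[OF a(3) that] g_0[OF a(3)] by metis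
      then show ?thesis by (simp add: comp_def m_def unit_vec_def)
    qed
    \<comment> \<open>Fewer than \<open>depth ?c\<close> steps do not reach the root, so only the
      final term of \<open>tint\<close> survives.\<close>
    have "comp k ?s (unit_vec m) ((P ^^ i) ?c) = 0" if "i < depth ?c" for i
    proof -
      have *: "(P ^^ i) ?c = (S.par ?s ^^ i) ?c" using P_pow_fib[OF sV cf] by blast
      have "tdist ?s ((P ^^ i) ?c) = depth ?c - i"
        using S.dist_neq_par[OF s cf, of i] that unfolding depth_fib[OF cf] * by simp
      then have "(P ^^ i) ?c \<noteq> ?s" using that S.zero[OF s s] by auto
      then show ?thesis using cmp[OF P_pow_T[OF cT]] by simp
    qed
    moreover have "comp k ?s (unit_vec m) ?s = 1" using cmp root_T Y_V(2)[OF a(3)] by simp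
    ultimately show ?thesis unfolding kfun_def tint_def by simp
  qed
  finally show ?thesis .
qed

text \<open>The sections are the root vectors of the successive copies. Their squared displacement
  is 2 - 2 lam^D, where the depth D of the inverse arrow does not depend on
  \<open>k\<close>.\<close>

lemma almost_invariant: "almost_contains_unit_invariant_sections G C (\<lambda>_. l2) (\<lambda>n _. unit_vec n) Lrep"
  unfolding almost_contains_unit_invariant_sections_def
proof (intro exI conjI allI)
  let ?\<xi> = "\<lambda>k (x :: 'g). unit_vec (prod_encode (k, 0))"
  show "unit_section G C (\<lambda>_. l2) (\<lambda>n _. unit_vec n) (?\<xi> k)" for k
    unfolding unit_section_def borel_section_def by (simp add: hnorm_l2 AE_class_def)
  show "AE_class C (\<lambda>\<gamma>. (\<lambda>k. hnorm l2 (?\<xi> k (rge G \<gamma>) \<ominus>\<^bsub>l2\<^esub> Lrep \<gamma> (?\<xi> k (src G \<gamma>)))) \<longlonglongrightarrow> 0)"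
    unfolding AE_class_iff using AE_GY
  proof eventually_elim
    case (elim \<gamma>)
    let ?D = "depth (ginv G \<gamma>)"
    have "hnorm l2 (unit_vec m \<ominus>\<^bsub>l2\<^esub> Lrep \<gamma> (unit_vec m)) = sqrt (2 - 2 * lam k ^ ?D)"
      if m: "m = prod_encode (k, 0)" for k m
    proof -
      have s: "summable (\<lambda>i. (cmod (Lrep \<gamma> (unit_vec m) i))\<^sup>2)" using Lrep_l2 unit_vec_l2 by blast
      have "hnorm l2 (unit_vec m \<ominus>\<^bsub>l2\<^esub> Lrep \<gamma> (unit_vec m)) = sqrt (sqnorm (\<lambda>i. unit_vec m i - Lrep \<gamma> (unit_vec m) i))"
        unfolding l2_minus[OF unit_vec_l2 s] by (rule hnorm_l2[OF l2_diff[OF unit_vec_l2 s]])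
      also have "sqnorm (\<lambda>i. unit_vec m i - Lrep \<gamma> (unit_vec m) i) = 2 - 2 * lam k ^ ?D"
        unfolding sqnorm_unit_vec_diff[OF s] sqnorm_Lrep[OF unit_vec_l2]
        using Lrep_coefficient[OF elim m] by simp
      finally show ?thesis .
    qed
    then have "(\<lambda>k. hnorm l2 (?\<xi> k (rge G \<gamma>) \<ominus>\<^bsub>l2\<^esub> Lrep \<gamma> (?\<xi> k (src G \<gamma>)))) = (\<lambda>k. sqrt (2 - 2 * lam k ^ ?D))"
      by blast
    moreover have "(\<lambda>k. sqrt (2 - 2 * lam k ^ ?D)) \<longlonglongrightarrow> sqrt (2 - 2 * 1 ^ ?D)"
      by (intro tendsto_intros lam_lim)
    ultimately show ?case by simp
  qed
qed

lemma invariant_section: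
  assumes "property_T G C"
  obtains \<xi> where "\<forall>m. (\<lambda>x. \<xi> x m) \<in> borel_measurable (unit_space G)" "\<forall>x\<in>units. \<xi> x \<in> carrier l2"
    "AE x in \<mu>. \<xi> x \<noteq> (\<lambda>_. 0)" "AE \<gamma> in \<nu>. \<xi> (rge G \<gamma>) = Lrep \<gamma> (\<xi> (src G \<gamma>))"
proof -
  have "contains_unit_invariant_section G C (\<lambda>_. l2) (\<lambda>n _. unit_vec n) Lrep"
    using assms representation_Lrep almost_invariant unfolding property_T_def by blast
  then obtain \<xi> where \<xi>: "borel_section (unit_space G) (\<lambda>_. l2) (\<lambda>n _. unit_vec n) \<xi>"
    "AE_class (unit_class G C) (\<lambda>x. hnorm l2 (\<xi> x) = 1)" "AE_class C (\<lambda>\<gamma>. \<xi> (rge G \<gamma>) = Lrep \<gamma> (\<xi> (src G \<gamma>)))"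
    unfolding contains_unit_invariant_section_def unit_section_def by blast
  have "(\<lambda>x. ip l2 (\<xi> x) (unit_vec m)) \<in> borel_measurable (unit_space G)" for m
    using \<xi>(1) unfolding borel_section_def by blast
  then have "(\<lambda>x. \<xi> x m) \<in> borel_measurable (unit_space G)" for m
    unfolding l2_simps ip_unit_vec .
  moreover have "\<xi> x \<in> carrier l2" if "x \<in> units" for x
    using \<xi>(1) that unfolding borel_section_def space_unit_space by blast
  moreover have "AE x in \<mu>. \<xi> x \<noteq> (\<lambda>_. 0)"
    using \<xi>(2) unfolding AE_unit_class_iff
  proof eventually_elim
    case (elim x)
    have "hnorm l2 (\<lambda>_. 0) = 0" by (simp add: hnorm_def)
    then show ?case using elim by auto
  qed
  ultimately show ?thesis using that[of \<xi>] \<xi>(3) unfolding AE_class_iff by blast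
qed

end

section \<open>Finite sets of maxima of an invariant section\<close>

context enumerated_groupoid
begin

text \<open>In kernel form an invariant section is a family of functions compatible with
  translation, so arrows carry the sets of maxima of the modulus to each other. The component used
  is the first nonzero one, which makes the choice agree along arrows. Measurability of
  \<open>F\<close> is stated in the form that ergodicity will use, for the sources of its
  elements.\<close>

lemma finite_invariant_field:
  assumes pT: "property_T G C"
  obtains Z F where "Z \<in> sets (unit_space G)" "Z \<subseteq> X" "AE x in \<mu>. x \<in> Z"
    "\<forall>x\<in>Z. finite (F x) \<and> F x \<noteq> {} \<and> F x \<subseteq> T x"
    "\<forall>\<gamma>\<in>arr. rge G \<gamma> \<in> Z \<longrightarrow> src G \<gamma> \<in> Z \<longrightarrow> (\<forall>c\<in>F (src G \<gamma>). mul G \<gamma> c \<in> F (rge G \<gamma>))"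
    "\<forall>B\<in>sets (arrows G). {x \<in> Z. \<exists>c\<in>F x. src G c \<in> B} \<in> sets (unit_space G)"
proof -
  obtain \<xi> where \<xi>: "\<forall>m. (\<lambda>x. \<xi> x m) \<in> borel_measurable (unit_space G)" "\<forall>x\<in>units. \<xi> x \<in> carrier l2"
    "AE x in \<mu>. \<xi> x \<noteq> (\<lambda>_. 0)" "AE \<gamma> in \<nu>. \<xi> (rge G \<gamma>) = Lrep \<gamma> (\<xi> (src G \<gamma>))"
    by (rule invariant_section[OF pT])
  obtain N where N: "{x \<in> space \<mu>. \<not> \<xi> x \<noteq> (\<lambda>_. 0)} \<subseteq> N" "emeasure \<mu> N = 0" "N \<in> sets \<mu>"
    by (rule AE_E[OF \<xi>(3)])
  obtain B where B: "{\<gamma> \<in> space \<nu>. \<not> \<xi> (rge G \<gamma>) = Lrep \<gamma> (\<xi> (src G \<gamma>))} \<subseteq> B" "emeasure \<nu> B = 0" "B \<in> sets \<nu>"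
    by (rule AE_E[OF \<xi>(4)])
  have Bs: "B \<in> sets (arrows G)" using B(3) sets_\<nu> by simp
  have "AE \<gamma> in \<nu>. \<gamma> \<notin> B" by (rule AE_not_in) (use B in \<open>simp add: null_sets_def\<close>)
  then have BK: "AE x in \<mu>. emeasure (K x) B = 0" unfolding AE_disintegrate[OF Bs] .
  have AN: "AE x in \<mu>. x \<notin> N" by (rule AE_not_in) (use N in \<open>simp add: null_sets_def\<close>)
  \<comment> \<open>Drops a null set \<open>N\<close> that contains the zeros of the section, and
    the units whose fibre measure charges the set \<open>B\<close> in which all failures of
    invariance lie.\<close>
  define Z where "Z = (Y \<inter> {x \<in> space (unit_space G). emeasure (K x) B = 0}) - N"
  have Zs: "Z \<in> sets (unit_space G)"
  proof -
    have [measurable]: "(\<lambda>x. emeasure (K x) B) \<in> borel_measurable (unit_space G)"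
      by (rule measurable_emeasure_kernel[OF measurable_K Bs])
    have "{x \<in> space (unit_space G). emeasure (K x) B = 0} \<in> sets (unit_space G)" by measurable
    then show ?thesis unfolding Z_def using Y_sets N(3) by (intro sets.Diff sets.Int) (simp_all only: sets_\<mu>)
  qed
  have ZAE: "AE x in \<mu>. x \<in> Z"
    using BK AN Y_conull AE_space by eventually_elim (simp add: Z_def space_unit_space)
  have ZY: "x \<in> Y" if "x \<in> Z" for x using that by (simp add: Z_def)
  note ZX = Y_V(2)[OF ZY] and ZV = Y_V(1)[OF ZY]
  have Zu: "x \<in> units" if "x \<in> Z" for x using V_unit[OF ZV[OF that]] by simp
  \<comment> \<open>An arrow between units of \<open>Z\<close> is an atom of its fibre measure and
    so cannot lie in the null set \<open>B\<close>: invariance almost everywhere turns into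
    invariance for every arrow of the reduction to \<open>Z\<close>.\<close>
  have inv: "\<xi> (rge G \<gamma>) = Lrep \<gamma> (\<xi> (src G \<gamma>))" "\<gamma> \<in> GY" if \<gamma>: "\<gamma> \<in> arr" "rge G \<gamma> \<in> Z" "src G \<gamma> \<in> Z" for \<gamma>
  proof -
    show GY: "\<gamma> \<in> GY" using \<gamma> ZY by (simp add: GY_def)
    have "0 < w \<gamma>" using GX_atoms[OF GYD(4)[OF GY]] by (simp add: atoms_def)
    moreover have "emeasure (K (rge G \<gamma>)) B = 0" using \<gamma>(2) by (simp add: Z_def)
    ultimately have "\<gamma> \<notin> B" using emeasure_K_le_w[OF \<gamma>(1) Bs] by auto
    then show "\<xi> (rge G \<gamma>) = Lrep \<gamma> (\<xi> (src G \<gamma>))" using B(1) \<gamma>(1) by auto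
  qed
  define f where "f k x = kfun k x (\<xi> x)" for k x
  have f_inv: "f k (rge G \<gamma>) (mul G \<gamma> b) = f k (src G \<gamma>) b"
    if \<gamma>: "\<gamma> \<in> arr" "rge G \<gamma> \<in> Z" "src G \<gamma> \<in> Z" and b: "b \<in> T (src G \<gamma>)" for k \<gamma> b
  proof -
    have "mul G \<gamma> b \<in> T (rge G \<gamma>)" by (rule mul_T[OF GYD(4)[OF inv(2)[OF \<gamma>]] b])
    then have "f k (rge G \<gamma>) (mul G \<gamma> b) = f k (src G \<gamma>) (mul G (ginv G \<gamma>) (mul G \<gamma> b))"
      unfolding f_def inv(1)[OF \<gamma>] by (rule kfun_Lrep[OF inv(2)[OF \<gamma>]])
    also have "mul G (ginv G \<gamma>) (mul G \<gamma> b) = b"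
      using mul_ginv_cancel(1)[OF \<gamma>(1), of b] T_arr[OF ZV[OF \<gamma>(3)] b] by simp
    finally show ?thesis .
  qed
  have gT: "(\<exists>c\<in>T x. Q c) \<longleftrightarrow> (\<exists>n. Q (g n x))" "(\<forall>c\<in>T x. Q c) \<longleftrightarrow> (\<forall>n. Q (g n x))" if "x \<in> Z" for x Q
  proof -
    have "T x = range (\<lambda>n. g n x)" using g_bij[OF ZY[OF that]] by (simp add: bij_betw_def)
    then show "(\<exists>c\<in>T x. Q c) \<longleftrightarrow> (\<exists>n. Q (g n x))" "(\<forall>c\<in>T x. Q c) \<longleftrightarrow> (\<forall>n. Q (g n x))" by simp_all
  qed
  have nz: "\<exists>k. \<exists>c\<in>T x. f k x c \<noteq> 0" if x: "x \<in> Z" for x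
  proof (rule ccontr)
    assume "\<not> ?thesis"
    then have 0: "f k x c = 0" if "c \<in> T x" for k c using that by blast
    have "\<xi> x m = 0" for m
    proof -
      obtain k n where kn: "prod_decode m = (k, n)" by (cases "prod_decode m")
      then have m: "m = prod_encode (k, n)" by (metis prod_decode_inverse)
      have c: "g n x \<in> T x" by (rule g_T[OF ZY[OF x]])
      have "\<xi> x m = tdiff (lam k) P x (f k x) (g n x)"
        unfolding m f_def tdiff_kfun[OF ZY[OF x] c] comp_g[OF ZY[OF x]] ..
      also have "\<dots> = 0" unfolding tdiff_def 0[OF c] 0[OF P_T[OF c]] by simp
      finally show ?thesis .
    qed
    then have "\<xi> x = (\<lambda>_. 0)" by (simp add: fun_eq_iff)
    then show False using N(1) x Zu[OF x] by (auto simp: Z_def)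
  qed
  \<comment> \<open>A least index is Borel in \<open>x\<close> and constant along the arrows of the
    reduction to \<open>Z\<close>.\<close>
  define kk where "kk x = (LEAST k. \<exists>n. f k x (g n x) \<noteq> 0)" for x
  have kk: "\<exists>c\<in>T x. f (kk x) x c \<noteq> 0" if x: "x \<in> Z" for x
  proof -
    have "\<exists>k. \<exists>n. f k x (g n x) \<noteq> 0" using nz[OF x] unfolding gT[OF x] .
    then have "\<exists>n. f (kk x) x (g n x) \<noteq> 0" unfolding kk_def by (rule LeastI_ex)
    then show ?thesis unfolding gT[OF x] .
  qed
  have kk_inv: "kk (rge G \<gamma>) = kk (src G \<gamma>)" if \<gamma>: "\<gamma> \<in> arr" "rge G \<gamma> \<in> Z" "src G \<gamma> \<in> Z" for \<gamma>
  proof -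
    have "(\<exists>c\<in>T (rge G \<gamma>). f k (rge G \<gamma>) c \<noteq> 0) \<longleftrightarrow> (\<exists>b\<in>T (src G \<gamma>). f k (src G \<gamma>) b \<noteq> 0)" for k
    proof -
      have "T (rge G \<gamma>) = mul G \<gamma> ` T (src G \<gamma>)"
        using bij_betw_mul_T[OF GYD(4)[OF inv(2)[OF \<gamma>]]] by (simp add: bij_betw_def)
      then show ?thesis using f_inv[OF \<gamma>] by auto
    qed
    then have "(\<exists>n. f k (rge G \<gamma>) (g n (rge G \<gamma>)) \<noteq> 0) \<longleftrightarrow> (\<exists>n. f k (src G \<gamma>) (g n (src G \<gamma>)) \<noteq> 0)" for k
      unfolding gT[OF \<gamma>(2)] gT[OF \<gamma>(3)] .
    then show ?thesis unfolding kk_def by (simp only:)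
  qed
  define F where "F x = {c \<in> T x. \<forall>c'\<in>T x. cmod (f (kk x) x c') \<le> cmod (f (kk x) x c)}" for x
  have "finite (F x) \<and> F x \<noteq> {} \<and> F x \<subseteq> T x" if x: "x \<in> Z" for x
  proof -
    interpret tree_metric "fib x" tdist by (rule tree[OF ZV[OF x]])
    obtain c where c: "c \<in> T x" "f (kk x) x c \<noteq> 0" using kk[OF x] by blast
    let ?e = "\<lambda>k. \<integral>\<^sup>+c. ennreal ((cmod (comp k x (\<xi> x) c))\<^sup>2) \<partial>count_space (T x)"
    have "(\<integral>\<^sup>+c. ennreal ((cmod (tdiff (lam (kk x)) (par x) x (f (kk x) x) c))\<^sup>2) \<partial>count_space (T x)) = ?e (kk x)"
    proof (rule nn_integral_cong)
      fix c assume "c \<in> space (count_space (T x))"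
      then have c: "c \<in> T x" "c \<in> fib x" using T_fib[OF ZV[OF x]] by auto
      then show "ennreal ((cmod (tdiff (lam (kk x)) (par x) x (f (kk x) x) c))\<^sup>2) = ennreal ((cmod (comp (kk x) x (\<xi> x) c))\<^sup>2)"
        unfolding f_def tdiff_P[OF c(2), symmetric] tdiff_kfun[OF ZY[OF x] c(1)] by simp
    qed
    \<comment> \<open>One component has at most the total energy, which is finite because the
      section takes values in \<open>l2\<close>.\<close>
    also have "?e (kk x) \<le> (\<integral>\<^sup>+k. ?e k \<partial>count_space UNIV)" by (rule nn_integral_ge_point) simp
    also have "\<dots> = (\<integral>\<^sup>+m. ennreal ((cmod (\<xi> x m))\<^sup>2) \<partial>count_space UNIV)"
      by (rule energy_components[OF ZY[OF x], symmetric])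
    also have "\<dots> < \<infinity>" using \<xi>(2) Zu[OF x] l2_nn_integral(1)[of "\<xi> x"] by (simp only: l2_simps)
    finally have fin: "(\<integral>\<^sup>+c. ennreal ((cmod (tdiff (lam (kk x)) (par x) x (f (kk x) x) c))\<^sup>2) \<partial>count_space (T x)) < \<infinity>" .
    show ?thesis unfolding F_def
      using finite_argmax[OF lam T_fib[OF ZV[OF x]] root_T[OF ZX[OF x]] T_par[OF ZV[OF x]] fin c] by auto
  qed
  moreover have "mul G \<gamma> c \<in> F (rge G \<gamma>)"
    if \<gamma>: "\<gamma> \<in> arr" "rge G \<gamma> \<in> Z" "src G \<gamma> \<in> Z" and c: "c \<in> F (src G \<gamma>)" for \<gamma> c
  proof -
    have b: "bij_betw (mul G \<gamma>) (T (src G \<gamma>)) (T (rge G \<gamma>))" by (rule bij_betw_mul_T[OF GYD(4)[OF inv(2)[OF \<gamma>]]])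
    have cT: "c \<in> T (src G \<gamma>)" using c by (simp add: F_def)
    have "cmod (f (kk (rge G \<gamma>)) (rge G \<gamma>) c') \<le> cmod (f (kk (rge G \<gamma>)) (rge G \<gamma>) (mul G \<gamma> c))"
      if c': "c' \<in> T (rge G \<gamma>)" for c'
    proof -
      obtain b' where b': "b' \<in> T (src G \<gamma>)" "c' = mul G \<gamma> b'" using b c' by (auto simp: bij_betw_def)
      show ?thesis unfolding b'(2) kk_inv[OF \<gamma>] f_inv[OF \<gamma> b'(1)] f_inv[OF \<gamma> cT]
        using c b'(1) by (simp add: F_def)
    qed
    then show ?thesis using bij_betw_apply[OF b cT] by (simp add: F_def)
  qed
  moreover have "{x \<in> Z. \<exists>c\<in>F x. src G c \<in> A} \<in> sets (unit_space G)" if A: "A \<in> sets (arrows G)" for A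
  proof -
    define h where "h k n x = cmod (f k x (g n x))" for k n x
    have id: "(\<lambda>x. x) \<in> unit_space G \<rightarrow>\<^sub>M unit_space G" by (rule measurable_ident_sets) simp
    have h [measurable]: "h k n \<in> borel_measurable (unit_space G)" for k n
      unfolding h_def f_def
      by (rule measurable_compose[OF measurable_kfun[OF id g_meas] borel_measurable_norm]) (use \<xi>(1) in blast)
    have "Measurable.pred (unit_space G) (\<lambda>x. \<exists>n. h k n x \<noteq> 0)" for k by measurable
    then have "(\<lambda>x. LEAST k. \<exists>n. h k n x \<noteq> 0) \<in> unit_space G \<rightarrow>\<^sub>M count_space UNIV" by (rule measurable_Least)
    moreover have "(\<lambda>x. LEAST k. \<exists>n. h k n x \<noteq> 0) = kk" by (simp add: kk_def h_def fun_eq_iff)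
    ultimately have kkm: "kk \<in> unit_space G \<rightarrow>\<^sub>M count_space UNIV" by (simp only:)
    have H [measurable]: "(\<lambda>x. h (kk x) n x) \<in> borel_measurable (unit_space G)" for n
      by (rule measurable_compose_countable[OF h kkm])
    have S: "Measurable.pred (unit_space G) (\<lambda>x. src G (g n x) \<in> A)" for n
    proof -
      have "{x \<in> space (unit_space G). src G (g n x) \<in> A} = (\<lambda>x. src G (g n x)) -` A \<inter> space (unit_space G)" by auto
      then show ?thesis unfolding pred_def
        using measurable_sets[OF measurable_compose[OF g_meas[of n] measurable_src] A] by (simp only:)
    qed
    have L: "Measurable.pred (unit_space G) (\<lambda>x. h (kk x) m x \<le> h (kk x) n x)" for m n by measurable
    have "Measurable.pred (unit_space G) (\<lambda>x. \<exists>n. src G (g n x) \<in> A \<and> (\<forall>m. h (kk x) m x \<le> h (kk x) n x))"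
      by (intro pred_intros_countable pred_intros_logic S L)
    then have "{x \<in> space (unit_space G). \<exists>n. src G (g n x) \<in> A \<and> (\<forall>m. h (kk x) m x \<le> h (kk x) n x)} \<in> sets (unit_space G)"
      unfolding pred_def .
    moreover have "{x \<in> Z. \<exists>c\<in>F x. src G c \<in> A} =
      Z \<inter> {x \<in> space (unit_space G). \<exists>n. src G (g n x) \<in> A \<and> (\<forall>m. h (kk x) m x \<le> h (kk x) n x)}"
    proof -
      have "(\<exists>c\<in>F x. src G c \<in> A) \<longleftrightarrow> (\<exists>n. src G (g n x) \<in> A \<and> (\<forall>m. h (kk x) m x \<le> h (kk x) n x))"
        if x: "x \<in> Z" for x
      proof -
        have "(\<exists>c\<in>F x. src G c \<in> A) \<longleftrightarrow>
          (\<exists>c\<in>T x. src G c \<in> A \<and> (\<forall>c'\<in>T x. cmod (f (kk x) x c') \<le> cmod (f (kk x) x c)))"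
          unfolding F_def by blast
        then show ?thesis unfolding gT[OF x] h_def .
      qed
      then show ?thesis using Zu unfolding space_unit_space by blast
    qed
    ultimately show ?thesis using sets.Int[OF Zs] by (simp only:)
  qed
  ultimately show ?thesis
    using Zs ZAE ZX by (intro that[of Z F]) blast+
qed

end

subsection \<open>Ergodicity\<close>

text \<open>Saturations are images of Borel sets under \<open>src G\<close>, thus Souslin but not
  evidently Borel; disjoint ones can still be separated by a Borel set.\<close>

lemma (in borel_groupoid) saturation_separation:
  assumes D: "D \<in> sets (arrows G)" "B \<in> sets (arrows G)" "saturation G D \<inter> saturation G B = {}"
  shows "\<exists>D'\<in>sets (unit_space G). saturation G D \<subseteq> D' \<and> D' \<inter> saturation G B = {}"
proof -
  have s: "{\<gamma> \<in> arr. rge G \<gamma> \<in> S} \<in> sets (arrows G)" if "S \<in> sets (arrows G)" for S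
    using measurable_sets[OF measurable_rge that] by (simp add: vimage_def Int_def conj_commute)
  obtain D' where D': "D' \<in> sets (arrows G)" "saturation G D \<subseteq> D'" "D' \<inter> saturation G B = {}"
    using standard_borel_separation[OF standard standard standard measurable_src s[OF D(1)] measurable_src s[OF D(2)]]
      D(3) unfolding saturation_def by blast
  have "saturation G D \<subseteq> units" using src_unit by (auto simp: saturation_def)
  moreover have "D' \<inter> units \<in> sets (unit_space G)" using D'(1) sets_units by (simp add: sets_unit_space_iff)
  ultimately show ?thesis using D' by (intro bexI[of _ "D' \<inter> units"]) auto
qed

lemma (in borel_groupoid) subset_saturation: "B \<subseteq> units \<Longrightarrow> B \<subseteq> saturation G B"
  unfolding saturation_def using src_of_unit by (force intro!: image_eqI)

lemma (in groupoid) saturation_disjoint: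
  assumes "D \<inter> saturation G B = {}"
  shows "saturation G D \<inter> saturation G B = {}"
proof (rule ccontr)
  assume "\<not> ?thesis"
  then obtain \<gamma> \<gamma>' where g: "\<gamma> \<in> space (arrows G)" "rge G \<gamma> \<in> D" "\<gamma>' \<in> space (arrows G)" "rge G \<gamma>' \<in> B"
    "src G \<gamma> = src G \<gamma>'" by (auto simp: saturation_def)
  then have "rge G \<gamma> \<in> saturation G B" unfolding saturation_def
    by (intro image_eqI[of _ _ "mul G \<gamma>' (ginv G \<gamma>)"]) (auto simp: src_mul rge_mul mul_closed ginv_closed rge_ginv src_ginv)
  then show False using g assms by blast
qed

context disintegrated_groupoid
begin

text \<open>Ergodicity speaks of Borel sets invariant under all arrows, whereas \<open>A\<close> is
  invariant only inside \<open>Z\<close>. Saturations and separating Borel sets are interleaved: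
  each Borel set of the chain contains the saturation of the previous one and misses that of
  \<open>Z - A\<close>. The union is Borel and invariant, and it meets \<open>Z\<close> exactly in
  \<open>A\<close>.\<close>

lemma ergodic_dichotomy:
  assumes erg: "ergodic G C" and Z: "Z \<in> sets (unit_space G)" "AE x in \<mu>. x \<in> Z"
    and A: "A \<in> sets (unit_space G)" "A \<subseteq> Z"
    and inv: "\<And>\<gamma>. \<gamma> \<in> arr \<Longrightarrow> rge G \<gamma> \<in> A \<Longrightarrow> src G \<gamma> \<in> Z \<Longrightarrow> src G \<gamma> \<in> A"
  shows "(AE x in \<mu>. x \<in> A) \<or> (AE x in \<mu>. x \<notin> A)"
proof -
  define B where "B = Z - A"
  have B: "B \<in> sets (arrows G)" "B \<subseteq> units" and A': "A \<in> sets (arrows G)" "A \<subseteq> units"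
    using sets.Diff[OF Z(1) A(1)] A(1) by (auto simp: B_def sets_unit_space_iff)
  have "A \<inter> saturation G B = {}"
  proof (rule ccontr)
    assume "\<not> ?thesis"
    then obtain \<gamma> where g: "\<gamma> \<in> arr" "rge G \<gamma> \<in> B" "src G \<gamma> \<in> A" by (auto simp: saturation_def)
    then have "rge G \<gamma> \<in> A"
      using inv[of "ginv G \<gamma>"] by (auto simp: ginv_closed rge_ginv src_ginv B_def)
    then show False using g by (simp add: B_def)
  qed
  define good where "good D \<longleftrightarrow> D \<in> sets (arrows G) \<and> D \<subseteq> units \<and> D \<inter> saturation G B = {}" for D
  have "good A" using A' \<open>A \<inter> saturation G B = {}\<close> by (simp add: good_def)
  have step: "\<exists>D'. good D' \<and> saturation G D \<subseteq> D'" if "good D" for D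
  proof -
    have D: "D \<in> sets (arrows G)" "D \<inter> saturation G B = {}" using that by (auto simp: good_def)
    obtain D' where "D' \<in> sets (unit_space G)" "saturation G D \<subseteq> D'" "D' \<inter> saturation G B = {}"
      using saturation_separation[OF D(1) B(1) saturation_disjoint[OF D(2)]] by blast
    then show ?thesis unfolding good_def sets_unit_space_iff by blast
  qed
  have "\<exists>D. \<forall>n :: nat. (good (D n) \<and> (n = 0 \<longrightarrow> D n = A)) \<and> saturation G (D n) \<subseteq> D (Suc n)"
  proof (rule dependent_nat_choice)
    show "\<exists>D. good D \<and> (0 = (0::nat) \<longrightarrow> D = A)" using \<open>good A\<close> by blast
    fix D and n :: nat assume "good D \<and> (n = 0 \<longrightarrow> D = A)"
    then obtain D' where "good D'" "saturation G D \<subseteq> D'" using step by blast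
    then show "\<exists>D'. (good D' \<and> (Suc n = 0 \<longrightarrow> D' = A)) \<and> saturation G D \<subseteq> D'" by blast
  qed
  then obtain D where D: "\<And>n :: nat. good (D n)" "D 0 = A" "\<And>n. saturation G (D n) \<subseteq> D (Suc n)" by blast
  define D' where "D' = (\<Union>n. D n)"
  have D's: "D' \<in> sets (unit_space G)" "D' \<subseteq> units" "D' \<inter> saturation G B = {}" "A \<subseteq> D'"
    using D(1,2) unfolding D'_def sets_unit_space_iff good_def by auto
  have "saturation G D' = D'"
  proof
    show "saturation G D' \<subseteq> D'" using D(3) unfolding D'_def saturation_def by blast
    show "D' \<subseteq> saturation G D'" by (rule subset_saturation[OF D's(2)])
  qed
  then have "null_units G C D' \<or> conull_units G C D'" using erg D's(1) unfolding ergodic_def by blast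
  then show ?thesis
  proof
    assume "null_units G C D'"
    then have "AE x in \<mu>. x \<notin> D'" unfolding null_iff .
    then have "AE x in \<mu>. x \<notin> A" by eventually_elim (use D's(4) in blast)
    then show ?thesis ..
  next
    assume "conull_units G C D'"
    then have "AE x in \<mu>. x \<in> D'" unfolding conull_iff .
    with Z(2) have "AE x in \<mu>. x \<in> A"
      by eventually_elim (use D's(3) subset_saturation[OF B(2)] in \<open>auto simp: B_def\<close>)
    then show ?thesis ..
  qed
qed

lemma AE_exists: assumes "AE x in \<mu>. Q x" obtains x where "x \<in> units" "Q x"
proof -
  have "\<exists>x\<in>space \<mu>. Q x"
  proof (rule ccontr)
    assume neg: "\<not> ?thesis"
    have "AE x in \<mu>. False" using assms AE_space by eventually_elim (use neg in blast)
    then show False using prob_space.ae_filter_bot[OF prob_\<mu>] by (simp add: eventually_False)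
  qed
  then show ?thesis using that by auto
qed

end

section \<open>A common source and finite sets of arrows\<close>

context treed_groupoid
begin

text \<open>Left translation keeps sources, so whether some element of \<open>F x\<close> has its
  source in a given Borel set does not change along arrows of the reduction to \<open>Z\<close>, and
  holds almost everywhere or almost nowhere. Halving along the basic sets, always keeping a half
  that is met for almost every \<open>x\<close>, leaves at most one point; finiteness of
  \<open>F x\<close> ensures that this point is still met.\<close>

lemma constant_source:
  assumes erg: "ergodic G C" and Z: "Z \<in> sets (unit_space G)" "AE x in \<mu>. x \<in> Z"
    and F: "\<forall>x\<in>Z. finite (F x) \<and> F x \<subseteq> fib x \<and> F x \<noteq> {}"
    and inv: "\<forall>\<gamma>\<in>arr. rge G \<gamma> \<in> Z \<longrightarrow> src G \<gamma> \<in> Z \<longrightarrow> (\<forall>c\<in>F (src G \<gamma>). mul G \<gamma> c \<in> F (rge G \<gamma>))"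
    and meas: "\<forall>B\<in>sets (arrows G). {x \<in> Z. \<exists>c\<in>F x. src G c \<in> B} \<in> sets (unit_space G)"
  obtains y where "y \<in> V" "AE x in \<mu>. x \<in> Z \<and> (\<exists>c\<in>F x. src G c = y)"
proof -
  define S where "S B = {x \<in> Z. \<exists>c\<in>F x. src G c \<in> B}" for B
  have Fa: "c \<in> arr \<and> rge G c = x \<and> c \<in> W" if "x \<in> Z" "c \<in> F x" for x c
    using F that W_arr by (auto simp: fib_def)
  have S01: "(AE x in \<mu>. x \<in> S B) \<or> (AE x in \<mu>. x \<notin> S B)" if B: "B \<in> sets (arrows G)" for B
  proof (rule ergodic_dichotomy[OF erg Z])
    show "S B \<in> sets (unit_space G)" using meas B by (simp add: S_def)
    show "S B \<subseteq> Z" by (auto simp: S_def)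
    fix \<gamma> assume \<gamma>: "\<gamma> \<in> arr" "rge G \<gamma> \<in> S B" "src G \<gamma> \<in> Z"
    then obtain c where c: "c \<in> F (rge G \<gamma>)" "src G c \<in> B" "rge G \<gamma> \<in> Z" by (auto simp: S_def)
    have "mul G (ginv G \<gamma>) c \<in> F (src G \<gamma>)"
      using inv[rule_format, of "ginv G \<gamma>"] c \<gamma> by (simp add: ginv_closed rge_ginv src_ginv)
    moreover have "src G (mul G (ginv G \<gamma>) c) = src G c"
      using Fa[OF c(3,1)] \<gamma>(1) by (simp add: src_mul ginv_closed src_ginv)
    ultimately show "src G \<gamma> \<in> S B" unfolding S_def
      using c(2) \<gamma>(3) by (intro CollectI conjI bexI[of _ "mul G (ginv G \<gamma>) c"]) simp_all
  qed
  obtain \<B> where \<B>: "souslin_basis (arrows G) \<B>" using standard_borel_souslin_basis[OF standard] by blast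
  define Bs where "Bs = from_nat_into (insert {} \<B>)"
  have rB: "range Bs = insert {} \<B>" unfolding Bs_def using souslin_basisD(1)[OF \<B>] by (simp add: range_from_nat_into)
  have Bs: "Bs j \<in> sets (arrows G)" for j
  proof -
    have "Bs j \<in> insert {} \<B>" using rB by (metis rangeI)
    then show ?thesis using souslin_basisD(2)[OF \<B>] by auto
  qed
  define D where "D = rec_nat arr (\<lambda>k D. if AE x in \<mu>. x \<in> S (D \<inter> Bs k) then D \<inter> Bs k else D - Bs k)"
  have D0: "D 0 = arr" and DS: "D (Suc k) = (if AE x in \<mu>. x \<in> S (D k \<inter> Bs k) then D k \<inter> Bs k else D k - Bs k)" for k
    by (simp_all add: D_def)
  have Dk: "D k \<in> sets (arrows G) \<and> (AE x in \<mu>. x \<in> S (D k))" for k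
  proof (induction k)
    case 0
    have "AE x in \<mu>. x \<in> S arr" using Z(2)
    proof eventually_elim
      case (elim x)
      then show ?case using F Fa[OF elim] src_closed by (auto simp: S_def)
    qed
    then show ?case using D0 by simp
  next
    case (Suc k)
    show ?case
    proof (cases "AE x in \<mu>. x \<in> S (D k \<inter> Bs k)")
      case True
      then show ?thesis using Suc Bs by (simp add: DS sets.Int)
    next
      case False
      then have "AE x in \<mu>. x \<notin> S (D k \<inter> Bs k)" using S01[of "D k \<inter> Bs k"] Suc Bs by blast
      then have "AE x in \<mu>. x \<in> S (D k - Bs k)"
        using Suc[THEN conjunct2] by eventually_elim (auto simp: S_def)
      then show ?thesis using False Suc Bs by (simp add: DS sets.Diff)
    qed
  qed
  have "decseq D" by (rule decseq_SucI) (auto simp: DS)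
  have D_unique: "p = q" if pq: "p \<in> (\<Inter>k. D k)" "q \<in> (\<Inter>k. D k)" for p q
  proof (rule ccontr)
    assume ne: "p \<noteq> q"
    have "p \<in> arr" "q \<in> arr" using pq D0 by auto
    then obtain T where T: "T \<in> \<B>" "(p \<in> T) \<noteq> (q \<in> T)" by (rule separatesE[OF souslin_basisD(4)[OF \<B>] _ _ ne])
    then have "T \<in> range Bs" unfolding rB by simp
    then obtain j where "T = Bs j" by auto
    moreover have "p \<in> D (Suc j)" "q \<in> D (Suc j)" using pq by blast+
    ultimately show False using T(2) unfolding DS by (auto split: if_splits)
  qed
  have "AE x in \<mu>. \<forall>k. x \<in> S (D k)" using Dk by (simp add: AE_all_countable)
  then have ae: "AE x in \<mu>. x \<in> Z \<and> (\<exists>c\<in>F x. src G c \<in> (\<Inter>k. D k))"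
  proof eventually_elim
    case (elim x)
    then have xZ: "x \<in> Z" by (auto simp: S_def)
    have "\<exists>c\<in>F x. \<forall>k. src G c \<in> D k"
    proof (rule ccontr)
      assume "\<not> ?thesis"
      then have "\<forall>c\<in>F x. \<exists>k. src G c \<notin> D k" by blast
      then obtain k where k: "\<And>c. c \<in> F x \<Longrightarrow> src G c \<notin> D (k c)" by metis
      \<comment> \<open>If each of the finitely many arrows dropped out at some stage, none would be
        left at the last of these stages.\<close>
      define m where "m = Max (insert 0 (k ` F x))"
      obtain c where c: "c \<in> F x" "src G c \<in> D m" using elim by (auto simp: S_def)
      have "k c \<le> m" unfolding m_def using c(1) F xZ by (intro Max_ge) auto
      then have "src G c \<in> D (k c)" using decseqD[OF \<open>decseq D\<close>] c(2) by blast
      then show False using k[OF c(1)] by simp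
    qed
    then show ?case using xZ by auto
  qed
  obtain x c where xc: "x \<in> Z" "c \<in> F x" "src G c \<in> (\<Inter>k. D k)" using AE_exists[OF ae] by blast
  have "src G c \<in> V" using Fa[OF xc(1,2)] rge_in_V(2) by blast
  moreover have "AE x in \<mu>. x \<in> Z \<and> (\<exists>c'\<in>F x. src G c' = src G c)"
    using ae by eventually_elim (use D_unique xc(3) in blast)
  ultimately show ?thesis by (rule that)
qed

text \<open>Left translation by an arrow \<open>a\<close> from \<open>rge G \<gamma>\<^sub>0\<close>
  to \<open>x\<close> embeds the set into \<open>F x\<close>: the product \<open>b\<close> of
  \<open>a\<close> and \<gamma> has the source of \<open>c\<close>, hence it is the translate of
  \<open>c\<close> by an isotropy arrow at \<open>x\<close>, and such arrows map \<open>F x\<close>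
  into itself. So the unit \<open>rge G \<gamma>\<^sub>0\<close> may lie outside
  \<open>Z\<close>.\<close>

lemma finite_hom_sets:
  assumes inv: "\<forall>\<gamma>\<in>arr. rge G \<gamma> \<in> Z \<longrightarrow> src G \<gamma> \<in> Z \<longrightarrow> (\<forall>c\<in>F (src G \<gamma>). mul G \<gamma> c \<in> F (rge G \<gamma>))"
    and x: "x \<in> Z" "finite (F x)" and c: "c \<in> F x" "c \<in> arr" "rge G c = x"
    and \<gamma>\<^sub>0: "\<gamma>\<^sub>0 \<in> arr" "src G \<gamma>\<^sub>0 = src G c"
  shows "finite {\<gamma> \<in> arr. rge G \<gamma> = rge G \<gamma>\<^sub>0 \<and> src G \<gamma> = src G c}"
proof (rule inj_on_finite[OF _ _ x(2)])
  let ?A = "{\<gamma> \<in> arr. rge G \<gamma> = rge G \<gamma>\<^sub>0 \<and> src G \<gamma> = src G c}"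
  define a where "a = mul G c (ginv G \<gamma>\<^sub>0)"
  have a: "a \<in> arr" "rge G a = x" "src G a = rge G \<gamma>\<^sub>0"
    using c \<gamma>\<^sub>0 by (simp_all add: a_def mul_closed ginv_closed rge_ginv src_ginv rge_mul src_mul)
  show "inj_on (mul G a) ?A"
    by (rule inj_onI) (use mul_left_cancel[OF a(1)] a in auto)
  show "mul G a ` ?A \<subseteq> F x"
  proof
    fix b assume "b \<in> mul G a ` ?A"
    then obtain \<gamma> where \<gamma>: "b = mul G a \<gamma>" "\<gamma> \<in> arr" "rge G \<gamma> = rge G \<gamma>\<^sub>0" "src G \<gamma> = src G c" by blast
    have b: "b \<in> arr" "rge G b = x" "src G b = src G c" using \<gamma> a by (simp_all add: mul_closed rge_mul src_mul)
    let ?d = "mul G b (ginv G c)"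
    have d: "?d \<in> arr" "rge G ?d = x" "src G ?d = x"
      using b c by (simp_all add: mul_closed ginv_closed rge_ginv src_ginv rge_mul src_mul)
    have "mul G ?d c = mul G b (mul G (ginv G c) c)"
      using b c by (intro mul_assoc) (simp_all add: ginv_closed rge_ginv src_ginv)
    also have "\<dots> = b" using b c mul_src[OF b(1)] by (simp add: ginv_mul)
    finally have "mul G ?d c = b" .
    moreover have "mul G ?d c \<in> F x" using inv d x(1) c(1) by (metis (no_types))
    ultimately show "b \<in> F x" by simp
  qed
qed

end

subsection \<open>Finite isotropy and properness\<close>

lemma emeasure_uniform_count_distr:
  assumes "finite A" "A \<noteq> {}" "A \<subseteq> space N" "B \<in> sets N"
  shows "emeasure (distr (uniform_count_measure A) N (\<lambda>x. x)) B = ennreal (real (card (B \<inter> A)) / real (card A))"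
proof -
  have "(\<lambda>x. x) \<in> uniform_count_measure A \<rightarrow>\<^sub>M N"
    using assms(3) by (auto simp: measurable_def sets_uniform_count_measure space_uniform_count_measure)
  from emeasure_distr[OF this assms(4)]
  have "emeasure (distr (uniform_count_measure A) N (\<lambda>x. x)) B = emeasure (uniform_count_measure A) ((\<lambda>x. x) -` B \<inter> A)"
    by (simp add: space_uniform_count_measure)
  also have "\<dots> = ennreal (real (card (B \<inter> A)) / real (card A))"
    using assms(1) by (subst emeasure_uniform_count_measure) auto
  finally show ?thesis .
qed

context treed_groupoid
begin

text \<open>Over a unit of the orbit the measure is uniform on the finite set of arrows from
  \<open>y\<close>, and left translation is a bijection between these sets. The complement of the
  orbit is null, and there the point mass at the unit serves. Borel dependence is clear because the
  orbit consists of countably many units.\<close>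

lemma proper_of_finite_homs:
  assumes y: "y \<in> V" and conull: "AE x in \<mu>. x \<in> saturation G {y}"
    and fin: "\<And>\<gamma>. \<gamma> \<in> arr \<Longrightarrow> src G \<gamma> = y \<Longrightarrow> finite {\<delta> \<in> arr. rge G \<delta> = rge G \<gamma> \<and> src G \<delta> = y}"
  shows "proper G C"
proof -
  \<comment> \<open>Intersected with \<open>V\<close>, the orbit consists of sources of elements of
    \<open>fib y\<close>, which is countable.\<close>
  define Orb where "Orb = V \<inter> saturation G {y}"
  define A where "A x = {\<delta> \<in> arr. rge G \<delta> = x \<and> src G \<delta> = y}" for x
  define S where "S x = (if x \<in> Orb then A x else {x})" for x
  define \<kappa>' where "\<kappa>' x = distr (uniform_count_measure (S x)) (fibre G x) (\<lambda>\<gamma>. \<gamma>)" for x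
  have Oex: "\<exists>\<gamma>\<in>W. rge G \<gamma> = x \<and> src G \<gamma> = y" if x: "x \<in> Orb" for x
  proof -
    obtain \<gamma> where \<gamma>: "\<gamma> \<in> arr" "rge G \<gamma> = y" "x = src G \<gamma>" "x \<in> V" using x by (auto simp: Orb_def saturation_def)
    then have "ginv G \<gamma> \<in> W" using y by (simp add: W_def ginv_closed rge_ginv src_ginv)
    then show ?thesis using \<gamma> by (intro bexI[of _ "ginv G \<gamma>"]) (simp_all add: rge_ginv src_ginv)
  qed
  have "Orb \<subseteq> src G ` fib y"
  proof
    fix x assume "x \<in> Orb"
    then obtain \<gamma> where \<gamma>: "\<gamma> \<in> W" "rge G \<gamma> = x" "src G \<gamma> = y" using Oex by blast
    then have "ginv G \<gamma> \<in> fib y" "src G (ginv G \<gamma>) = x"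
      using ginv_in_W W_arr by (simp_all add: fib_def rge_ginv src_ginv)
    then show "x \<in> src G ` fib y" by blast
  qed
  then have cntO: "countable Orb" by (rule countable_subset[OF _ countable_image[OF fib_countable[OF y]]])
  have S: "finite (S x)" "S x \<noteq> {}" "S x \<subseteq> space (fibre G x)" if x: "x \<in> units" for x
  proof -
    have "finite (S x) \<and> S x \<noteq> {} \<and> S x \<subseteq> {\<gamma> \<in> arr. rge G \<gamma> = x}"
    proof (cases "x \<in> Orb")
      case True
      then obtain \<gamma> where \<gamma>: "\<gamma> \<in> W" "rge G \<gamma> = x" "src G \<gamma> = y" using Oex by blast
      then have "\<gamma> \<in> A x" "finite (A x)" using fin[of \<gamma>] W_arr by (auto simp: A_def)
      then show ?thesis using True by (auto simp: S_def A_def)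
    next
      case False
      then show ?thesis using x by (simp add: S_def)
    qed
    then show "finite (S x)" "S x \<noteq> {}" "S x \<subseteq> space (fibre G x)" unfolding space_fibre by blast+
  qed
  have meas: "(\<lambda>\<gamma>. \<gamma>) \<in> uniform_count_measure (S x) \<rightarrow>\<^sub>M fibre G x" if "x \<in> units" for x
    using S(3)[OF that] by (auto simp: measurable_def sets_uniform_count_measure space_uniform_count_measure)
  have "fibre_probs G \<kappa>'"
    unfolding fibre_probs_def space_unit_space
  proof (intro conjI ballI allI impI)
    fix x assume x: "x \<in> units"
    show "sets (\<kappa>' x) = sets (fibre G x)" by (simp add: \<kappa>'_def)
    show "prob_space (\<kappa>' x)" unfolding \<kappa>'_def
      by (rule prob_space.prob_space_distr[OF prob_space_uniform_count_measure[OF S(1,2)[OF x]] meas[OF x]])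
  next
    fix f :: "'g \<Rightarrow> ennreal" assume f: "f \<in> borel_measurable (arrows G)"
    have ff: "f \<in> borel_measurable (fibre G x)" for x unfolding fibre_def by (rule measurable_restrict_space1[OF f])
    have fu: "f \<in> borel_measurable (unit_space G)" unfolding unit_space_def by (rule measurable_restrict_space1[OF f])
    show "(\<lambda>x. \<integral>\<^sup>+\<gamma>. f \<gamma> \<partial>\<kappa>' x) \<in> borel_measurable (unit_space G)"
    proof (rule measurable_discrete_difference[OF fu cntO])
      fix x assume "x \<in> Orb"
      then have "x \<in> units" using V_unit by (auto simp: Orb_def)
      then show "{x} \<in> sets (unit_space G)" using sets_singleton by (simp add: sets_unit_space_iff)
    next
      fix x assume x: "x \<in> space (unit_space G)" "x \<notin> Orb"
      then have xu: "x \<in> units" by (simp add: space_unit_space)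
      have "(\<integral>\<^sup>+\<gamma>. f \<gamma> \<partial>\<kappa>' x) = (\<integral>\<^sup>+\<gamma>. f \<gamma> \<partial>uniform_count_measure (S x))"
        unfolding \<kappa>'_def by (rule nn_integral_distr[OF meas[OF xu]]) (use ff in simp)
      also have "\<dots> = f x"
        using x(2) unfolding uniform_count_measure_def by (subst nn_integral_point_measure_finite) (simp_all add: S_def)
      finally show "f x = (\<integral>\<^sup>+\<gamma>. f \<gamma> \<partial>\<kappa>' x)" by simp
    qed simp
  qed
  moreover have "AE_class C (\<lambda>\<gamma>. translate G \<kappa>' \<gamma> = \<kappa>' (rge G \<gamma>))"
  proof -
    have "AE x in \<mu>. x \<in> V" using V_iness conull_iff unfolding inessential_def by auto
    with conull have "AE x in \<mu>. x \<in> Orb" by eventually_elim (simp add: Orb_def)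
    from AE_full[OF this] AE_space show ?thesis unfolding AE_class_iff
    proof eventually_elim
      case (elim \<gamma>)
      then have \<gamma>: "\<gamma> \<in> arr" "rge G \<gamma> \<in> Orb" "src G \<gamma> \<in> Orb" by simp_all
      note u = rge_unit[OF \<gamma>(1)] src_unit[OF \<gamma>(1)]
      have bij: "bij_betw (mul G \<gamma>) (A (src G \<gamma>)) (A (rge G \<gamma>))"
      proof (rule bij_betw_byWitness[where f' = "mul G (ginv G \<gamma>)"])
        show "\<forall>a\<in>A (src G \<gamma>). mul G (ginv G \<gamma>) (mul G \<gamma> a) = a"
          using mul_ginv_cancel(1)[OF \<gamma>(1)] by (simp add: A_def)
        show "\<forall>a\<in>A (rge G \<gamma>). mul G \<gamma> (mul G (ginv G \<gamma>) a) = a"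
          using mul_ginv_cancel(2)[OF \<gamma>(1)] by (simp add: A_def)
      qed (use \<gamma>(1) in \<open>auto simp: A_def mul_closed rge_mul src_mul ginv_closed rge_ginv src_ginv\<close>)
      have SA: "S (src G \<gamma>) = A (src G \<gamma>)" "S (rge G \<gamma>) = A (rge G \<gamma>)" using \<gamma> by (simp_all add: S_def)
      have m: "mul G \<gamma> \<in> \<kappa>' (src G \<gamma>) \<rightarrow>\<^sub>M fibre G (rge G \<gamma>)"
        unfolding \<kappa>'_def using measurable_mul_fibre[OF \<gamma>(1)] by simp
      show ?case
      proof (rule measure_eqI)
        show "sets (translate G \<kappa>' \<gamma>) = sets (\<kappa>' (rge G \<gamma>))" by (simp add: translate_def \<kappa>'_def)
        fix B assume "B \<in> sets (translate G \<kappa>' \<gamma>)"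
        then have B: "B \<in> sets (fibre G (rge G \<gamma>))" by (simp add: translate_def)
        have sp: "space (\<kappa>' (src G \<gamma>)) = space (fibre G (src G \<gamma>))" by (simp add: \<kappa>'_def)
        let ?B = "mul G \<gamma> -` B \<inter> space (fibre G (src G \<gamma>))"
        have B': "?B \<in> sets (fibre G (src G \<gamma>))" by (rule measurable_sets[OF measurable_mul_fibre[OF \<gamma>(1)] B])
        have "emeasure (translate G \<kappa>' \<gamma>) B = emeasure (\<kappa>' (src G \<gamma>)) ?B"
          unfolding translate_def sp[symmetric] by (rule emeasure_distr[OF m B])
        also have "\<dots> = ennreal (real (card (?B \<inter> A (src G \<gamma>))) / real (card (A (src G \<gamma>))))"
          unfolding \<kappa>'_def SA(1)[symmetric] by (rule emeasure_uniform_count_distr[OF S[OF u(2)] B'])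
        also have "card (?B \<inter> A (src G \<gamma>)) = card (B \<inter> A (rge G \<gamma>))"
        proof (rule bij_betw_same_card[of "mul G \<gamma>"], rule bij_betw_subset[OF bij])
          have "A (src G \<gamma>) \<subseteq> space (fibre G (src G \<gamma>))" by (auto simp: A_def space_fibre)
          then have "?B \<inter> A (src G \<gamma>) = {a \<in> A (src G \<gamma>). mul G \<gamma> a \<in> B}" by blast
          then show "mul G \<gamma> ` (?B \<inter> A (src G \<gamma>)) = B \<inter> A (rge G \<gamma>)"
            using bij by (auto simp: bij_betw_def)
        qed auto
        also have "card (A (src G \<gamma>)) = card (A (rge G \<gamma>))" by (rule bij_betw_same_card[OF bij])
        also have "ennreal (real (card (B \<inter> A (rge G \<gamma>))) / real (card (A (rge G \<gamma>)))) = emeasure (\<kappa>' (rge G \<gamma>)) B"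
          unfolding \<kappa>'_def SA(2)[symmetric] by (rule emeasure_uniform_count_distr[OF S[OF u(1)] B, symmetric])
        finally show "emeasure (translate G \<kappa>' \<gamma>) B = emeasure (\<kappa>' (rge G \<gamma>)) B" .
      qed
    qed
  qed
  ultimately show ?thesis unfolding proper_def by blast
qed

text \<open>Translation is a bijection between hulls, so by ergodicity almost all hulls are infinite
  or almost all are finite. In the first case property T supplies the field; in the second the hulls
  themselves form it.\<close>

lemma finite_invariant_field_exists:
  assumes erg: "ergodic G C" and pT: "property_T G C"
  obtains Z F where "Z \<in> sets (unit_space G)" "Z \<subseteq> X" "AE x in \<mu>. x \<in> Z"
    "\<forall>x\<in>Z. finite (F x) \<and> F x \<noteq> {} \<and> F x \<subseteq> T x"
    "\<forall>\<gamma>\<in>arr. rge G \<gamma> \<in> Z \<longrightarrow> src G \<gamma> \<in> Z \<longrightarrow> (\<forall>c\<in>F (src G \<gamma>). mul G \<gamma> c \<in> F (rge G \<gamma>))"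
    "\<forall>B\<in>sets (arrows G). {x \<in> Z. \<exists>c\<in>F x. src G c \<in> B} \<in> sets (unit_space G)"
proof -
  obtain g :: "nat \<Rightarrow> 'g \<Rightarrow> 'g" where g: "\<forall>n. g n \<in> unit_space G \<rightarrow>\<^sub>M arrows G"
    "\<forall>x\<in>X. infinite (T x) \<longrightarrow> g 0 x = x" "\<forall>x\<in>X. infinite (T x) \<longrightarrow> bij_betw (\<lambda>n. g n x) UNIV (T x)"
    "{x \<in> X. infinite (T x)} \<in> sets (unit_space G)" by (rule T_bijective_enumeration)
  define Y where "Y = {x \<in> X. infinite (T x)}"
  have Y: "Y \<in> sets (unit_space G)" "Y \<subseteq> X" using g(4) by (auto simp: Y_def)
  have "(AE x in \<mu>. x \<in> Y) \<or> (AE x in \<mu>. x \<notin> Y)"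
  proof (rule ergodic_dichotomy[OF erg X_sets X_conull Y])
    fix \<gamma> assume \<gamma>: "\<gamma> \<in> arr" "rge G \<gamma> \<in> Y" "src G \<gamma> \<in> X"
    then have "\<gamma> \<in> GX" using Y(2) by (auto simp: GX_def)
    from bij_betw_finite[OF bij_betw_mul_T[OF this]] show "src G \<gamma> \<in> Y" using \<gamma> by (auto simp: Y_def)
  qed
  then show ?thesis
  proof
    assume "AE x in \<mu>. x \<in> Y"
    then interpret enumerated_groupoid G C \<nu> \<kappa> U V E g Y
      by unfold_locales (use g Y in \<open>auto simp: Y_def\<close>)
    show ?thesis by (rule finite_invariant_field[OF pT]) (rule that)
  next
    assume nY: "AE x in \<mu>. x \<notin> Y"
    define Z where "Z = X - Y"
    have Z: "Z \<in> sets (unit_space G)" unfolding Z_def by (rule sets.Diff[OF X_sets Y(1)])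
    have ZAE: "AE x in \<mu>. x \<in> Z" using nY X_conull by eventually_elim (simp add: Z_def)
    obtain t :: "nat \<Rightarrow> 'g \<Rightarrow> 'g" where t: "\<forall>n. t n \<in> unit_space G \<rightarrow>\<^sub>M arrows G" "\<forall>x. t 0 x = x"
      "\<forall>x\<in>X. range (\<lambda>n. t n x) = T x" by (rule T_enumeration)
    have "{x \<in> Z. \<exists>c\<in>T x. src G c \<in> B} \<in> sets (unit_space G)" if B: "B \<in> sets (arrows G)" for B
    proof -
      have "{x \<in> Z. \<exists>c\<in>T x. src G c \<in> B} = Z \<inter> (\<Union>n. (\<lambda>x. src G (t n x)) -` B \<inter> space (unit_space G))" (is "?L = ?R")
      proof (rule Set.set_eqI)
        fix x
        show "x \<in> ?L \<longleftrightarrow> x \<in> ?R"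
        proof (cases "x \<in> Z")
          case True
          then have "T x = range (\<lambda>n. t n x)" "x \<in> space (unit_space G)"
            using t(3) Z[THEN sets.sets_into_space] by (auto simp: Z_def)
          then show ?thesis using True by simp
        qed simp
      qed
      moreover have "(\<lambda>x. src G (t n x)) -` B \<inter> space (unit_space G) \<in> sets (unit_space G)" for n
        by (rule measurable_sets[OF measurable_compose[OF t(1)[rule_format] measurable_src] B])
      then have "Z \<inter> (\<Union>n. (\<lambda>x. src G (t n x)) -` B \<inter> space (unit_space G)) \<in> sets (unit_space G)"
        by (intro sets.Int[OF Z] sets.countable_UN) blast
      ultimately show ?thesis by (simp only:)
    qed
    moreover have "mul G \<gamma> c \<in> T (rge G \<gamma>)" if "\<gamma> \<in> arr" "rge G \<gamma> \<in> Z" "src G \<gamma> \<in> Z" "c \<in> T (src G \<gamma>)" for \<gamma> c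
      by (rule mul_T) (use that in \<open>auto simp: GX_def Z_def\<close>)
    moreover have "finite (T x) \<and> T x \<noteq> {} \<and> T x \<subseteq> T x" if "x \<in> Z" for x
      using that root_T[of x] by (auto simp: Z_def Y_def)
    moreover have "Z \<subseteq> X" by (auto simp: Z_def)
    ultimately show ?thesis using Z ZAE by (intro that[of Z T]) blast+
  qed
qed

text \<open>One field \<open>F\<close> gives both conclusions: the common source of its elements has
  a conull orbit, and the finiteness of \<open>F x\<close> bounds the sets of arrows from that
  source. Properness refutes the first hypothesis of the theorem, transitivity refutes proper
  ergodicity.\<close>

lemma proper_and_transitive:
  assumes erg: "ergodic G C" and pT: "property_T G C"
  shows "proper G C \<and> essentially_transitive G C"
proof -
  obtain Z F where Z: "Z \<in> sets (unit_space G)" "Z \<subseteq> X" "AE x in \<mu>. x \<in> Z"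
    and F: "\<forall>x\<in>Z. finite (F x) \<and> F x \<noteq> {} \<and> F x \<subseteq> T x"
    and inv: "\<forall>\<gamma>\<in>arr. rge G \<gamma> \<in> Z \<longrightarrow> src G \<gamma> \<in> Z \<longrightarrow> (\<forall>c\<in>F (src G \<gamma>). mul G \<gamma> c \<in> F (rge G \<gamma>))"
    and meas: "\<forall>B\<in>sets (arrows G). {x \<in> Z. \<exists>c\<in>F x. src G c \<in> B} \<in> sets (unit_space G)"
    by (rule finite_invariant_field_exists[OF erg pT])
  have F': "\<forall>x\<in>Z. finite (F x) \<and> F x \<subseteq> fib x \<and> F x \<noteq> {}"
    using F T_fib Z(2) X_V(1) by blast
  obtain y where y: "y \<in> V" "AE x in \<mu>. x \<in> Z \<and> (\<exists>c\<in>F x. src G c = y)"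
    by (rule constant_source[OF erg Z(1,3) F' inv meas])
  have Fa: "c \<in> arr \<and> rge G c = x" if "x \<in> Z" "c \<in> F x" for x c
    using F' that W_arr by (auto simp: fib_def)
  have conull: "AE x in \<mu>. x \<in> saturation G {y}"
    using y(2)
  proof eventually_elim
    case (elim x)
    then obtain c where c: "c \<in> F x" "src G c = y" "x \<in> Z" by blast
    then have "c \<in> arr" "rge G c = x" using Fa by blast+
    then show ?case unfolding saturation_def using c
      by (intro image_eqI[of _ _ "ginv G c"]) (simp_all add: ginv_closed rge_ginv src_ginv)
  qed
  obtain x c where xc: "x \<in> Z" "c \<in> F x" "src G c = y" using AE_exists[OF y(2)] by blast
  have "proper G C"
  proof (rule proper_of_finite_homs[OF y(1) conull])
    fix \<gamma> assume "\<gamma> \<in> arr" "src G \<gamma> = y"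
    then show "finite {\<delta> \<in> arr. rge G \<delta> = rge G \<gamma> \<and> src G \<delta> = y}"
      using finite_hom_sets[OF inv xc(1) _ xc(2), of \<gamma>] F xc Fa[OF xc(1,2)] by simp
  qed
  moreover have "essentially_transitive G C"
    unfolding essentially_transitive_def conull_iff space_unit_space using erg conull V_unit[OF y(1)] by blast
  ultimately show ?thesis ..
qed

end

lemma treeable_proper_and_transitive:
  assumes "measured_groupoid G C" "ergodic G C" "property_T G C" "treeable G C"
  shows "proper G C \<and> essentially_transitive G C"
proof -
  interpret measured_groupoid G C by (rule assms(1))
  obtain \<nu> \<kappa> U where d: "\<nu> \<in> C" "prob_space \<nu>" "disintegration G \<nu> \<kappa>" "inessential G C U"
    "\<forall>\<gamma> \<in> space (arrows (reduction G U)). equiv_measure (translate G \<kappa> \<gamma>) (\<kappa> (rge G \<gamma>))"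
    using invariant by blast
  obtain V E where V: "inessential G C V" "r_discrete_borel (reduction G V)" "tree_bundle (reduction G V) E"
    using assms(4) unfolding treeable_def treeable_borel_def by blast
  interpret treed_groupoid G C \<nu> \<kappa> U V E
    by (rule treed_groupoid.intro[OF disintegrated_groupoid.intro[OF assms(1) disintegrated_groupoid_axioms.intro]
          treed_groupoid_axioms.intro]) (use d V in \<open>simp_all add: space_reduction\<close>)
  show ?thesis by (rule proper_and_transitive[OF assms(2,3)])
qed

theorem corollary5p26:
  fixes G :: "'g borel_gpd" and C :: "'g measure set"
  assumes "measured_groupoid G C"
    and "r_discrete G C"
    and "property_T G C"
  shows "(ergodic G C \<and> \<not> proper G C \<longrightarrow> \<not> treeable G C) \<and>
         (properly_ergodic G C \<longrightarrow> \<not> treeable G C)"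
  using treeable_proper_and_transitive[OF assms(1) _ assms(3)] unfolding properly_ergodic_def by blast

end
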